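(* Let $\mathfrak L=L_{\boldsymbol m}(\mathfrak g,\boldsymbol\sigma,\mathfrak h)$ and $\mathfrak L'=L_{\boldsymbol m'}(\mathfrak g',\boldsymbol\sigma',\mathfrak h')$ be multiloop Lie algebras of nullity $n$ with $\mathfrak g^{\boldsymbol\sigma}\ne\{0\}$ and $\mathfrak g'^{\boldsymbol\sigma'}\ne\{0\}$. If $\mathfrak L$ and $\mathfrak L'$ are support-isomorphic, then there exists a bijection $\mathcal P(\mathfrak L)\to\mathcal P(\mathfrak L')$, $(\mathfrak D,\tau)\mapsto(\mathfrak D',\tau')$, such that $E(\mathfrak L,\mathfrak D,\tau)$ is isomorphic as EALAs to $E(\mathfrak L',\mathfrak D',\tau')$ for every $(\mathfrak D,\tau)\in\mathcal P(\mathfrak L)$.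
   Context: $k$ is algebraically closed of characteristic $0$; fixed roots of unity $\zeta_n$ with $\zeta_{mn}^m=\zeta_n$. Multiloop Lie algebra: $\mathfrak g$ finite-dimensional simple over $k$, $\boldsymbol\sigma=(\sigma_1,\dots,\sigma_n)$ pairwise commuting finite-order automorphisms, $\boldsymbol m\in\mathbb Z^n_{>0}$ with $\sigma_i^{m_i}=\mathrm{id}$; $\mathfrak g^{\bar\lambda}=\{g:\sigma_i(g)=\zeta_{m_i}^{l_i}g\ \forall i\}$ for $\lambda=(l_1,\dots,l_n)\in\mathbb Z^n$, $\mathfrak g^{\boldsymbol\sigma}=\mathfrak g^{\bar0}$; when $\mathfrak g^{\boldsymbol\sigma}\ne0$, $\mathfrak h$ is a Cartan subalgebra of $\mathfrak g^{\boldsymbol\sigma}$, acting diagonalizably on $\mathfrak g$ with root spaces $\mathfrak g_\alpha$; $Q_{\mathfrak h}$ is generated by the nonzero weights; $L_{\boldsymbol m}(\mathfrak g,\boldsymbol\sigma,\mathfrak h)=\bigoplus_{(\alpha,\lambda)\in Q_{\mathfrak h}\times\mathbb Z^n}(\mathfrak g_\alpha\cap\mathfrak g^{\bar\lambda})\otimes t^\lambda\subseteq\mathfrak g\otimes k[t_1^{\pm1},\dots,t_n^{\pm1}]$, $Q_{\mathfrak h}\times\mathbb Z^n$-graded; $\mathfrak L^\lambda=\mathfrak g^{\bar\lambda}\otimes t^\lambda$. Support-isomorphic: there are a Lie algebra isomorphism $\varphi:\mathfrak L\to\mathfrak L'$ and a group isomorphism $\varphi_{\mathrm{su}}$ from the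 subgroup generated by $\{(\alpha,\lambda):\mathfrak L^\lambda_\alpha\ne0\}$ onto the analogous subgroup for $\mathfrak L'$ with $\varphi(\mathfrak L^\lambda_\alpha)=\mathfrak L'^{\lambda'}_{\alpha'}$ where $(\alpha',\lambda')=\varphi_{\mathrm{su}}(\alpha,\lambda)$. Bilinear form on $\mathfrak L$: $(x\otimes t^\lambda|y\otimes t^\mu)=\kappa(x,y)$ if $\lambda+\mu=0$ and $0$ otherwise, $\kappa$ the Killing form of $\mathfrak g$. Construction: $\mathfrak L$ is $\mathbb Z^n$-graded. Its centroid $C(\mathfrak L)$ (linear endomorphisms commuting with all $\mathrm{ad}\,x$) is graded by $C(\mathfrak L)^\mu=\{c:c\mathfrak L^\nu\subseteq\mathfrak L^{\mu+\nu}\ \forall\nu\}$; $\Gamma=\{\mu:C(\mathfrak L)^\mu\ne0\}$ (a subgroup). For $\theta\in\mathrm{Hom}(\mathbb Z^n,k)$, $\partial_\theta(x)=\theta(\lambda)x$ for $x\in\mathfrak L^\lambda$. $\mathrm{SCDer}(\mathfrak L)=\bigoplus_{\mu\in\Gamma}C(\mathfrak L)^\mu\cdot\{\partial_\theta:\theta(\mu)=0\}$, a $\Gamma$-graded subalgebra of $\mathrm{Der}(\mathfrak L)$. $\mathcal P(\mathfrak L)$ is the set of pairs $(\mathfrak D,\tau)$ where: $\mathfrak D=\bigoplus_{\mu\in\Gamma}\mathfrak D^\mu$ is a $\Gamma$-graded subalgebra of $\mathrm{SCDer}(\mathfrak L)$ such that $\mathrm{ev}:\mathbb Z^n\to(\mathfrak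 D^0)^*$, $\mathrm{ev}(\lambda)(\partial_\theta)=\theta(\lambda)$, is injective; with $\mathfrak C=\bigoplus_{\mu\in\Gamma}(\mathfrak D^\mu)^*$, graded by $\mathfrak C^\mu=(\mathfrak D^{-\mu})^*$ and a $\mathfrak D$-module via the contragredient action $(d\cdot c)(d')=-c([d,d'])$, $\tau:\mathfrak D\times\mathfrak D\to\mathfrak C$ is a Lie algebra 2-cocycle with values in $\mathfrak C$ which is graded ($\tau(\mathfrak D^{\mu_1},\mathfrak D^{\mu_2})\subseteq\mathfrak C^{\mu_1+\mu_2}$), invariant ($\tau(d_1,d_2)(d_3)=\tau(d_2,d_3)(d_1)$), and satisfies $\tau(\mathfrak D,\mathfrak D^0)=0$. Then $E(\mathfrak L,\mathfrak D,\tau)=\mathfrak L\oplus\mathfrak C\oplus\mathfrak D$ with bracket $[x_1+c_1+d_1,x_2+c_2+d_2]=([x_1,x_2]+d_1(x_2)-d_2(x_1))+(\sigma_{\mathfrak D}(x_1,x_2)+d_1\cdot c_2-d_2\cdot c_1+\tau(d_1,d_2))+[d_1,d_2]$, where $\sigma_{\mathfrak D}(x,y)(d)=(d(x)|y)$, bilinear form $(x_1+c_1+d_1|x_2+c_2+d_2)=(x_1|x_2)+d_1(c_2)+d_2(c_1)$, and subalgebra $H=\mathfrak h\oplus\mathfrak C^0\oplus\mathfrak D^0$; this is an extended affine Lie algebra (EALA). EALA isomorphism: EALAs $(E,H,(\cdot|\cdot))$, $(E',H',(\cdot|\cdot)')$ are isomorphic if there is a Lie algebra isomorphism $\chi:E\to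 E'$ with $\chi(H)=H'$ and $(\chi(x)|\chi(y))'=a(x|y)$ for some $a\in k$. *)

theory Defs
  imports "HOL-Analysis.Analysis" "HOL-Library.Function_Algebras"
          "HOL-Computational_Algebra.Polynomial"
begin

definition alg_closed :: "'k::field itself \<Rightarrow> bool" where
  "alg_closed _ \<longleftrightarrow> (\<forall>p::'k poly. degree p > 0 \<longrightarrow> (\<exists>x. poly p x = 0))"

definition roots_ok :: "(nat \<Rightarrow> 'k::field) \<Rightarrow> bool" where
  "roots_ok zeta \<longleftrightarrow>
     (\<forall>n>0. zeta n ^ n = 1 \<and> (\<forall>j. 0 < j \<and> j < n \<longrightarrow> zeta n ^ j \<noteq> 1)) \<and>
     (\<forall>m n. 0 < m \<and> 0 < n \<longrightarrow> zeta (m * n) ^ m = zeta n)"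

definition lspan :: "('k::field \<Rightarrow> 'v::ab_group_add \<Rightarrow> 'v) \<Rightarrow> 'v set \<Rightarrow> 'v set" where
  "lspan s S = {(\<Sum>v\<in>T. s (r v) v) | T r. finite T \<and> T \<subseteq> S}"

definition subsp :: "('k::field \<Rightarrow> 'v::ab_group_add \<Rightarrow> 'v) \<Rightarrow> 'v set \<Rightarrow> bool" where
  "subsp s V \<longleftrightarrow> 0 \<in> V \<and> (\<forall>x\<in>V. \<forall>y\<in>V. x + y \<in> V) \<and> (\<forall>a. \<forall>x\<in>V. s a x \<in> V)"

definition linear_on ::
  "('k::field \<Rightarrow> 'v::ab_group_add \<Rightarrow> 'v) \<Rightarrow> ('k \<Rightarrow> 'w::ab_group_add \<Rightarrow> 'w) \<Rightarrow> 'v set \<Rightarrow> ('v \<Rightarrow> 'w) \<Rightarrow> bool" where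
  "linear_on s s' C f \<longleftrightarrow> (\<forall>x\<in>C. \<forall>y\<in>C. f (x + y) = f x + f y) \<and> (\<forall>a. \<forall>x\<in>C. f (s a x) = s' a (f x))"

definition fin_basis :: "('k::field \<Rightarrow> 'v::ab_group_add \<Rightarrow> 'v) \<Rightarrow> 'v set \<Rightarrow> bool" where
  "fin_basis s B \<longleftrightarrow> finite B \<and> lspan s B = UNIV \<and>
     (\<forall>r. (\<Sum>v\<in>B. s (r v) v) = 0 \<longrightarrow> (\<forall>v\<in>B. r v = 0))"

definition coord :: "('k::field \<Rightarrow> 'v::ab_group_add \<Rightarrow> 'v) \<Rightarrow> 'v set \<Rightarrow> 'v \<Rightarrow> 'v \<Rightarrow> 'k" where
  "coord s B v = (SOME r. v = (\<Sum>u\<in>B. s (r u) u))"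

definition ltrace :: "('k::field \<Rightarrow> 'v::ab_group_add \<Rightarrow> 'v) \<Rightarrow> ('v \<Rightarrow> 'v) \<Rightarrow> 'k" where
  "ltrace s T = (let B = (SOME B. fin_basis s B) in \<Sum>u\<in>B. coord s B (T u) u)"

definition killing :: "('k::field \<Rightarrow> 'v::ab_group_add \<Rightarrow> 'v) \<Rightarrow> ('v \<Rightarrow> 'v \<Rightarrow> 'v) \<Rightarrow> 'v \<Rightarrow> 'v \<Rightarrow> 'k" where
  "killing s b x y = ltrace s (\<lambda>v. b x (b y v))"

definition lie_alg_on :: "('k::field \<Rightarrow> 'v::ab_group_add \<Rightarrow> 'v) \<Rightarrow> ('v \<Rightarrow> 'v \<Rightarrow> 'v) \<Rightarrow> 'v set \<Rightarrow> bool" where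
  "lie_alg_on s b C \<longleftrightarrow> vector_space s \<and> subsp s C \<and> (\<forall>x\<in>C. \<forall>y\<in>C. b x y \<in> C) \<and>
     (\<forall>x\<in>C. \<forall>y\<in>C. \<forall>z\<in>C. b (x + y) z = b x z + b y z \<and> b x (y + z) = b x y + b x z) \<and>
     (\<forall>a. \<forall>x\<in>C. \<forall>y\<in>C. b (s a x) y = s a (b x y) \<and> b x (s a y) = s a (b x y)) \<and>
     (\<forall>x\<in>C. b x x = 0) \<and>
     (\<forall>x\<in>C. \<forall>y\<in>C. \<forall>z\<in>C. b x (b y z) + b y (b z x) + b z (b x y) = 0)"

definition simple_lie :: "('k::field \<Rightarrow> 'v::ab_group_add \<Rightarrow> 'v) \<Rightarrow> ('v \<Rightarrow> 'v \<Rightarrow> 'v) \<Rightarrow> bool" where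
  "simple_lie s b \<longleftrightarrow> lie_alg_on s b UNIV \<and> (\<exists>B. fin_basis s B) \<and> (\<exists>x y. b x y \<noteq> 0) \<and>
     (\<forall>I. subsp s I \<and> (\<forall>x y. y \<in> I \<longrightarrow> b x y \<in> I) \<longrightarrow> I = {0} \<or> I = UNIV)"

definition lie_aut :: "('k::field \<Rightarrow> 'v::ab_group_add \<Rightarrow> 'v) \<Rightarrow> ('v \<Rightarrow> 'v \<Rightarrow> 'v) \<Rightarrow> ('v \<Rightarrow> 'v) \<Rightarrow> bool" where
  "lie_aut s b f \<longleftrightarrow> bij f \<and> linear_on s s UNIV f \<and> (\<forall>x y. f (b x y) = b (f x) (f y))"

definition lie_iso ::
  "('k::field \<Rightarrow> 'v::ab_group_add \<Rightarrow> 'v) \<Rightarrow> ('v \<Rightarrow> 'v \<Rightarrow> 'v) \<Rightarrow> 'v set \<Rightarrow>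
   ('k \<Rightarrow> 'w::ab_group_add \<Rightarrow> 'w) \<Rightarrow> ('w \<Rightarrow> 'w \<Rightarrow> 'w) \<Rightarrow> 'w set \<Rightarrow> ('v \<Rightarrow> 'w) \<Rightarrow> bool" where
  "lie_iso s b C s' b' C' f \<longleftrightarrow> bij_betw f C C' \<and> linear_on s s' C f \<and>
     (\<forall>x\<in>C. \<forall>y\<in>C. f (b x y) = b' (f x) (f y))"

primrec lcs :: "('k::field \<Rightarrow> 'v::ab_group_add \<Rightarrow> 'v) \<Rightarrow> ('v \<Rightarrow> 'v \<Rightarrow> 'v) \<Rightarrow> 'v set \<Rightarrow> nat \<Rightarrow> 'v set" where
  "lcs s b V 0 = V"
| "lcs s b V (Suc i) = lspan s {b x y | x y. x \<in> V \<and> y \<in> lcs s b V i}"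

inductive_set gen_grp :: "'g::ab_group_add set \<Rightarrow> 'g set" for S where
  gen_zero: "0 \<in> gen_grp S"
| gen_base: "x \<in> S \<Longrightarrow> x \<in> gen_grp S"
| gen_diff: "x \<in> gen_grp S \<Longrightarrow> y \<in> gen_grp S \<Longrightarrow> x - y \<in> gen_grp S"

record ('k, 'a) mldatum =
  msc :: "'k \<Rightarrow> 'a \<Rightarrow> 'a"
  mbr :: "'a \<Rightarrow> 'a \<Rightarrow> 'a"
  msig :: "nat \<Rightarrow> 'a \<Rightarrow> 'a"
  mord :: "nat \<Rightarrow> nat"
  mcart :: "'a set"

type_synonym 'a lp = "(nat \<Rightarrow> int) \<Rightarrow> 'a"
type_synonym 'a endo = "'a lp \<Rightarrow> 'a lp"

definition Zn :: "nat \<Rightarrow> (nat \<Rightarrow> int) set" where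
  "Zn n = {l. \<forall>i\<ge>n. l i = 0}"

definition gl :: "nat \<Rightarrow> (nat \<Rightarrow> 'k::field) \<Rightarrow> ('k, 'a::ab_group_add) mldatum \<Rightarrow> (nat \<Rightarrow> int) \<Rightarrow> 'a set" where
  "gl n zeta G l = {x. \<forall>i<n. msig G i x = msc G (zeta (mord G i) powi l i) x}"

definition gfix :: "nat \<Rightarrow> (nat \<Rightarrow> 'k::field) \<Rightarrow> ('k, 'a::ab_group_add) mldatum \<Rightarrow> 'a set" where
  "gfix n zeta G = gl n zeta G 0"

definition rootsp :: "('k::field, 'a::ab_group_add) mldatum \<Rightarrow> ('a \<Rightarrow> 'k) \<Rightarrow> 'a set" where
  "rootsp G \<alpha> = {x. \<forall>y\<in>mcart G. mbr G y x = msc G (\<alpha> y) x}"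

text \<open>Weights of h on g (functionals are normalised to vanish off h).\<close>
definition weights :: "('k::field, 'a::ab_group_add) mldatum \<Rightarrow> ('a \<Rightarrow> 'k) set" where
  "weights G = {\<alpha>. (\<forall>y. y \<notin> mcart G \<longrightarrow> \<alpha> y = 0) \<and> rootsp G \<alpha> \<noteq> {0}}"

definition Qh :: "('k::field, 'a::ab_group_add) mldatum \<Rightarrow> ('a \<Rightarrow> 'k) set" where
  "Qh G = gen_grp (weights G - {0})"

definition cartan_sub :: "nat \<Rightarrow> (nat \<Rightarrow> 'k::field) \<Rightarrow> ('k, 'a::ab_group_add) mldatum \<Rightarrow> bool" where
  "cartan_sub n zeta G \<longleftrightarrow> mcart G \<subseteq> gfix n zeta G \<and> subsp (msc G) (mcart G) \<and>
     (\<forall>x\<in>mcart G. \<forall>y\<in>mcart G. mbr G x y \<in> mcart G) \<and>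
     (\<exists>i. lcs (msc G) (mbr G) (mcart G) i = {0}) \<and>
     {x\<in>gfix n zeta G. \<forall>y\<in>mcart G. mbr G x y \<in> mcart G} = mcart G"

definition multiloop_datum :: "nat \<Rightarrow> (nat \<Rightarrow> 'k::field) \<Rightarrow> ('k, 'a::ab_group_add) mldatum \<Rightarrow> bool" where
  "multiloop_datum n zeta G \<longleftrightarrow> simple_lie (msc G) (mbr G) \<and>
     (\<forall>i<n. lie_aut (msc G) (mbr G) (msig G i) \<and> 0 < mord G i \<and> (msig G i ^^ mord G i) = id) \<and>
     (\<forall>i<n. \<forall>j<n. msig G i \<circ> msig G j = msig G j \<circ> msig G i) \<and>
     cartan_sub n zeta G \<and>
     lspan (msc G) (\<Union>\<alpha>\<in>weights G. rootsp G \<alpha>) = UNIV"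

definition Lcar :: "nat \<Rightarrow> (nat \<Rightarrow> 'k::field) \<Rightarrow> ('k, 'a::ab_group_add) mldatum \<Rightarrow> 'a lp set" where
  "Lcar n zeta G = {f. finite {l. f l \<noteq> 0} \<and>
     (\<forall>l. f l \<noteq> 0 \<longrightarrow> l \<in> Zn n \<and>
        f l \<in> lspan (msc G) (\<Union>\<alpha>\<in>Qh G. rootsp G \<alpha> \<inter> gl n zeta G l))}"

definition Lsc :: "('k::field, 'a::ab_group_add) mldatum \<Rightarrow> 'k \<Rightarrow> 'a lp \<Rightarrow> 'a lp" where
  "Lsc G a f = (\<lambda>l. msc G a (f l))"

definition Lbr :: "('k::field, 'a::ab_group_add) mldatum \<Rightarrow> 'a lp \<Rightarrow> 'a lp \<Rightarrow> 'a lp" where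
  "Lbr G f g = (\<lambda>\<nu>. \<Sum>(l, \<mu>)\<in>{(l, \<mu>). f l \<noteq> 0 \<and> g \<mu> \<noteq> 0 \<and> l + \<mu> = \<nu>}. mbr G (f l) (g \<mu>))"

definition Lgr :: "nat \<Rightarrow> (nat \<Rightarrow> 'k::field) \<Rightarrow> ('k, 'a::ab_group_add) mldatum \<Rightarrow> ('a \<Rightarrow> 'k) \<Rightarrow> (nat \<Rightarrow> int) \<Rightarrow> 'a lp set" where
  "Lgr n zeta G \<alpha> l = {f \<in> Lcar n zeta G. (\<forall>\<nu>. \<nu> \<noteq> l \<longrightarrow> f \<nu> = 0) \<and> f l \<in> rootsp G \<alpha> \<inter> gl n zeta G l}"

definition Ldeg :: "nat \<Rightarrow> (nat \<Rightarrow> 'k::field) \<Rightarrow> ('k, 'a::ab_group_add) mldatum \<Rightarrow> (nat \<Rightarrow> int) \<Rightarrow> 'a lp set" where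
  "Ldeg n zeta G l = {f \<in> Lcar n zeta G. \<forall>\<nu>. \<nu> \<noteq> l \<longrightarrow> f \<nu> = 0}"

definition Lsupp :: "nat \<Rightarrow> (nat \<Rightarrow> 'k::field) \<Rightarrow> ('k, 'a::ab_group_add) mldatum \<Rightarrow> (('a \<Rightarrow> 'k) \<times> (nat \<Rightarrow> int)) set" where
  "Lsupp n zeta G = {(\<alpha>, l). \<alpha> \<in> Qh G \<and> l \<in> Zn n \<and> Lgr n zeta G \<alpha> l \<noteq> {0}}"

definition support_iso :: "nat \<Rightarrow> (nat \<Rightarrow> 'k::field) \<Rightarrow> ('k, 'a::ab_group_add) mldatum \<Rightarrow> ('k, 'b::ab_group_add) mldatum \<Rightarrow> bool" where
  "support_iso n zeta G G' \<longleftrightarrow> (\<exists>\<phi> \<psi>.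
     lie_iso (Lsc G) (Lbr G) (Lcar n zeta G) (Lsc G') (Lbr G') (Lcar n zeta G') \<phi> \<and>
     bij_betw \<psi> (gen_grp (Lsupp n zeta G)) (gen_grp (Lsupp n zeta G')) \<and>
     (\<forall>p\<in>gen_grp (Lsupp n zeta G). \<forall>q\<in>gen_grp (Lsupp n zeta G). \<psi> (p + q) = \<psi> p + \<psi> q) \<and>
     (\<forall>\<alpha> l. (\<alpha>, l) \<in> gen_grp (Lsupp n zeta G) \<longrightarrow>
        \<phi> ` Lgr n zeta G \<alpha> l = Lgr n zeta G' (fst (\<psi> (\<alpha>, l))) (snd (\<psi> (\<alpha>, l)))))"

definition Cent :: "nat \<Rightarrow> (nat \<Rightarrow> 'k::field) \<Rightarrow> ('k, 'a::ab_group_add) mldatum \<Rightarrow> 'a endo set" where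
  "Cent n zeta G = {c. (\<forall>x. x \<notin> Lcar n zeta G \<longrightarrow> c x = 0) \<and> c ` Lcar n zeta G \<subseteq> Lcar n zeta G \<and>
     linear_on (Lsc G) (Lsc G) (Lcar n zeta G) c \<and>
     (\<forall>x\<in>Lcar n zeta G. \<forall>y\<in>Lcar n zeta G. c (Lbr G x y) = Lbr G x (c y))}"

definition Cent_deg :: "nat \<Rightarrow> (nat \<Rightarrow> 'k::field) \<Rightarrow> ('k, 'a::ab_group_add) mldatum \<Rightarrow> (nat \<Rightarrow> int) \<Rightarrow> 'a endo set" where
  "Cent_deg n zeta G \<mu> = {c \<in> Cent n zeta G. \<forall>\<nu>. c ` Ldeg n zeta G \<nu> \<subseteq> Ldeg n zeta G (\<mu> + \<nu>)}"

definition Gam :: "nat \<Rightarrow> (nat \<Rightarrow> 'k::field) \<Rightarrow> ('k, 'a::ab_group_add) mldatum \<Rightarrow> (nat \<Rightarrow> int) set" where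
  "Gam n zeta G = {\<mu> \<in> Zn n. Cent_deg n zeta G \<mu> \<noteq> {0}}"

definition Th :: "nat \<Rightarrow> ((nat \<Rightarrow> int) \<Rightarrow> 'k::field) set" where
  "Th n = {\<theta>. \<exists>a. \<forall>l. \<theta> l = (\<Sum>i<n. a i * of_int (l i))}"

definition dth :: "nat \<Rightarrow> (nat \<Rightarrow> 'k::field) \<Rightarrow> ('k, 'a::ab_group_add) mldatum \<Rightarrow> ((nat \<Rightarrow> int) \<Rightarrow> 'k) \<Rightarrow> 'a endo" where
  "dth n zeta G \<theta> = (\<lambda>x. if x \<in> Lcar n zeta G then (\<lambda>l. msc G (\<theta> l) (x l)) else 0)"

definition Esc :: "('k::field, 'a::ab_group_add) mldatum \<Rightarrow> 'k \<Rightarrow> 'a endo \<Rightarrow> 'a endo" where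
  "Esc G a e = (\<lambda>x. Lsc G a (e x))"

definition comm :: "'a::ab_group_add endo \<Rightarrow> 'a endo \<Rightarrow> 'a endo" where
  "comm e1 e2 = (\<lambda>x. e1 (e2 x) - e2 (e1 x))"

definition SCdeg :: "nat \<Rightarrow> (nat \<Rightarrow> 'k::field) \<Rightarrow> ('k, 'a::ab_group_add) mldatum \<Rightarrow> (nat \<Rightarrow> int) \<Rightarrow> 'a endo set" where
  "SCdeg n zeta G \<mu> = lspan (Esc G)
     {c \<circ> dth n zeta G \<theta> | c \<theta>. c \<in> Cent_deg n zeta G \<mu> \<and> \<theta> \<in> Th n \<and> \<theta> \<mu> = 0}"

definition SCDer :: "nat \<Rightarrow> (nat \<Rightarrow> 'k::field) \<Rightarrow> ('k, 'a::ab_group_add) mldatum \<Rightarrow> 'a endo set" where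
  "SCDer n zeta G = lspan (Esc G) (\<Union>\<mu>\<in>Gam n zeta G. SCdeg n zeta G \<mu>)"

definition Ddeg :: "nat \<Rightarrow> (nat \<Rightarrow> 'k::field) \<Rightarrow> ('k, 'a::ab_group_add) mldatum \<Rightarrow> 'a endo set \<Rightarrow> (nat \<Rightarrow> int) \<Rightarrow> 'a endo set" where
  "Ddeg n zeta G D \<mu> = D \<inter> SCdeg n zeta G \<mu>"

text \<open>Graded subalgebra of SCDer with ev injective.\<close>
definition D_ok :: "nat \<Rightarrow> (nat \<Rightarrow> 'k::field) \<Rightarrow> ('k, 'a::ab_group_add) mldatum \<Rightarrow> 'a endo set \<Rightarrow> bool" where
  "D_ok n zeta G D \<longleftrightarrow> D \<subseteq> SCDer n zeta G \<and> subsp (Esc G) D \<and>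
     (\<forall>d1\<in>D. \<forall>d2\<in>D. comm d1 d2 \<in> D) \<and>
     D = lspan (Esc G) (\<Union>\<mu>\<in>Gam n zeta G. Ddeg n zeta G D \<mu>) \<and>
     (\<forall>l\<in>Zn n. l \<noteq> 0 \<longrightarrow> (\<exists>\<theta>\<in>Th n. dth n zeta G \<theta> \<in> Ddeg n zeta G D 0 \<and> \<theta> l \<noteq> 0))"

text \<open>The graded dual C = sum of (D^mu)^*, realised as linear functionals on D
  vanishing on all but finitely many D^mu.\<close>
definition Ccar :: "nat \<Rightarrow> (nat \<Rightarrow> 'k::field) \<Rightarrow> ('k, 'a::ab_group_add) mldatum \<Rightarrow> 'a endo set \<Rightarrow> ('a endo \<Rightarrow> 'k) set" where
  "Ccar n zeta G D = {c. (\<forall>d. d \<notin> D \<longrightarrow> c d = 0) \<and> linear_on (Esc G) (*) D c \<and>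
     finite {\<mu> \<in> Gam n zeta G. \<exists>d\<in>Ddeg n zeta G D \<mu>. c d \<noteq> 0}}"

definition Cdeg :: "nat \<Rightarrow> (nat \<Rightarrow> 'k::field) \<Rightarrow> ('k, 'a::ab_group_add) mldatum \<Rightarrow> 'a endo set \<Rightarrow> (nat \<Rightarrow> int) \<Rightarrow> ('a endo \<Rightarrow> 'k) set" where
  "Cdeg n zeta G D \<mu> = {c \<in> Ccar n zeta G D.
     \<forall>\<nu>\<in>Gam n zeta G. \<nu> \<noteq> - \<mu> \<longrightarrow> (\<forall>d\<in>Ddeg n zeta G D \<nu>. c d = 0)}"

definition act :: "'a::ab_group_add endo set \<Rightarrow> 'a endo \<Rightarrow> ('a endo \<Rightarrow> 'k::field) \<Rightarrow> ('a endo \<Rightarrow> 'k)" where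
  "act D d c = (\<lambda>d'. if d' \<in> D then - c (comm d d') else 0)"

definition tau_ok :: "nat \<Rightarrow> (nat \<Rightarrow> 'k::field) \<Rightarrow> ('k, 'a::ab_group_add) mldatum \<Rightarrow> 'a endo set \<Rightarrow>
     ('a endo \<Rightarrow> 'a endo \<Rightarrow> ('a endo \<Rightarrow> 'k)) \<Rightarrow> bool" where
  "tau_ok n zeta G D \<tau> \<longleftrightarrow>
     (\<forall>d1 d2. d1 \<notin> D \<or> d2 \<notin> D \<longrightarrow> \<tau> d1 d2 = 0) \<and>
     (\<forall>d1\<in>D. \<forall>d2\<in>D. \<tau> d1 d2 \<in> Ccar n zeta G D) \<and>
     (\<forall>d1\<in>D. \<forall>d2\<in>D. \<forall>d3\<in>D. \<tau> (d1 + d2) d3 = \<tau> d1 d3 + \<tau> d2 d3) \<and>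
     (\<forall>a. \<forall>d1\<in>D. \<forall>d2\<in>D. \<tau> (Esc G a d1) d2 = (\<lambda>d. a * \<tau> d1 d2 d)) \<and>
     (\<forall>d\<in>D. \<tau> d d = 0) \<and>
     (\<forall>x\<in>D. \<forall>y\<in>D. \<forall>z\<in>D.
        act D x (\<tau> y z) - act D y (\<tau> x z) + act D z (\<tau> x y)
        - \<tau> (comm x y) z + \<tau> (comm x z) y - \<tau> (comm y z) x = 0) \<and>
     (\<forall>\<mu>1\<in>Gam n zeta G. \<forall>\<mu>2\<in>Gam n zeta G. \<forall>d1\<in>Ddeg n zeta G D \<mu>1. \<forall>d2\<in>Ddeg n zeta G D \<mu>2.
        \<tau> d1 d2 \<in> Cdeg n zeta G D (\<mu>1 + \<mu>2)) \<and>
     (\<forall>d1\<in>D. \<forall>d2\<in>D. \<forall>d3\<in>D. \<tau> d1 d2 d3 = \<tau> d2 d3 d1) \<and>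
     (\<forall>d1\<in>D. \<forall>d2\<in>Ddeg n zeta G D 0. \<tau> d1 d2 = 0)"

definition Pset :: "nat \<Rightarrow> (nat \<Rightarrow> 'k::field) \<Rightarrow> ('k, 'a::ab_group_add) mldatum \<Rightarrow>
     ('a endo set \<times> ('a endo \<Rightarrow> 'a endo \<Rightarrow> ('a endo \<Rightarrow> 'k))) set" where
  "Pset n zeta G = {(D, \<tau>). D_ok n zeta G D \<and> tau_ok n zeta G D \<tau>}"

definition Lform :: "('k::field, 'a::ab_group_add) mldatum \<Rightarrow> 'a lp \<Rightarrow> 'a lp \<Rightarrow> 'k" where
  "Lform G x y = (\<Sum>l\<in>{l. x l \<noteq> 0}. killing (msc G) (mbr G) (x l) (y (- l)))"

type_synonym ('k, 'a) eelt = "'a lp \<times> ('a endo \<Rightarrow> 'k) \<times> 'a endo"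

definition Ecar :: "nat \<Rightarrow> (nat \<Rightarrow> 'k::field) \<Rightarrow> ('k, 'a::ab_group_add) mldatum \<Rightarrow> 'a endo set \<Rightarrow> ('k, 'a) eelt set" where
  "Ecar n zeta G D = Lcar n zeta G \<times> Ccar n zeta G D \<times> D"

definition Escal :: "('k::field, 'a::ab_group_add) mldatum \<Rightarrow> 'k \<Rightarrow> ('k, 'a) eelt \<Rightarrow> ('k, 'a) eelt" where
  "Escal G a p = (case p of (x, c, d) \<Rightarrow> (Lsc G a x, (\<lambda>e. a * c e), Esc G a d))"

definition sigD :: "('k::field, 'a::ab_group_add) mldatum \<Rightarrow> 'a endo set \<Rightarrow> 'a lp \<Rightarrow> 'a lp \<Rightarrow> ('a endo \<Rightarrow> 'k)" where
  "sigD G D x y = (\<lambda>d. if d \<in> D then Lform G (d x) y else 0)"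

definition Ebr :: "('k::field, 'a::ab_group_add) mldatum \<Rightarrow> 'a endo set \<Rightarrow>
     ('a endo \<Rightarrow> 'a endo \<Rightarrow> ('a endo \<Rightarrow> 'k)) \<Rightarrow> ('k, 'a) eelt \<Rightarrow> ('k, 'a) eelt \<Rightarrow> ('k, 'a) eelt" where
  "Ebr G D \<tau> p q = (case p of (x1, c1, d1) \<Rightarrow> case q of (x2, c2, d2) \<Rightarrow>
     (Lbr G x1 x2 + d1 x2 - d2 x1,
      sigD G D x1 x2 + act D d1 c2 - act D d2 c1 + \<tau> d1 d2,
      comm d1 d2))"

definition Eform :: "('k::field, 'a::ab_group_add) mldatum \<Rightarrow> ('k, 'a) eelt \<Rightarrow> ('k, 'a) eelt \<Rightarrow> 'k" where
  "Eform G p q = (case p of (x1, c1, d1) \<Rightarrow> case q of (x2, c2, d2) \<Rightarrow>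
     Lform G x1 x2 + c2 d1 + c1 d2)"

definition Hsub :: "nat \<Rightarrow> (nat \<Rightarrow> 'k::field) \<Rightarrow> ('k, 'a::ab_group_add) mldatum \<Rightarrow> 'a endo set \<Rightarrow> ('k, 'a) eelt set" where
  "Hsub n zeta G D = {(x, c, d). x \<in> Lcar n zeta G \<and> (\<forall>\<nu>. \<nu> \<noteq> 0 \<longrightarrow> x \<nu> = 0) \<and> x 0 \<in> mcart G \<and>
     c \<in> Cdeg n zeta G D 0 \<and> d \<in> Ddeg n zeta G D 0}"

definition eala_iso :: "nat \<Rightarrow> (nat \<Rightarrow> 'k::field) \<Rightarrow>
     ('k, 'a::ab_group_add) mldatum \<Rightarrow> 'a endo set \<Rightarrow> ('a endo \<Rightarrow> 'a endo \<Rightarrow> ('a endo \<Rightarrow> 'k)) \<Rightarrow>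
     ('k, 'b::ab_group_add) mldatum \<Rightarrow> 'b endo set \<Rightarrow> ('b endo \<Rightarrow> 'b endo \<Rightarrow> ('b endo \<Rightarrow> 'k)) \<Rightarrow> bool" where
  "eala_iso n zeta G D \<tau> G' D' \<tau>' \<longleftrightarrow> (\<exists>chi a.
     lie_iso (Escal G) (Ebr G D \<tau>) (Ecar n zeta G D) (Escal G') (Ebr G' D' \<tau>') (Ecar n zeta G' D') chi \<and>
     chi ` Hsub n zeta G D = Hsub n zeta G' D' \<and>
     (\<forall>p\<in>Ecar n zeta G D. \<forall>q\<in>Ecar n zeta G D. Eform G' (chi p) (chi q) = a * Eform G p q))"

end

theory Submission
  imports Defs
begin

text \<open>
  Write the support-isomorphism as \<open>(\<phi>, \<psi>)\<close>. Conjugation by \<open>\<phi>\<close> maps the centroid of \<open>L\<close> onto that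
  of \<open>L'\<close>, and both centroids are Laurent polynomial rings over the lattice \<open>m\<^sub>1\<int> \<times> \<dots> \<times> m\<^sub>n\<int>\<close>, which
  makes \<open>\<psi>\<close> restrict to an isomorphism \<open>p\<close> of these lattices. The map \<open>\<phi>\<close> need not respect the
  \<open>\<int>\<^sup>n\<close>-gradings, so \<open>\<phi> d \<phi>\<inverse>\<close> need not be a skew centroidal derivation of \<open>L'\<close>; but the defect of a
  degree derivation acts on each root space by a scalar depending additively on the root, and such
  an operator is inner. Hence for every skew centroidal \<open>d\<close> there is a unique pair of a skew
  centroidal \<open>\<Phi> d\<close> and an element \<open>Y d\<close> of the centroid span of the Cartan subalgebra with
  \<open>\<Phi> d = \<phi> d \<phi>\<inverse> + ad (Y d)\<close>. Uniqueness makes \<open>\<Phi>\<close> a Lie algebra isomorphism. By uniqueness of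
  invariant forms, \<open>\<phi>\<close> scales the form by a nonzero \<open>a\<close>. The bijection sends \<open>(D, \<tau>)\<close> to \<open>\<Phi> D\<close> with
  \<open>\<tau>\<close> transported and scaled by \<open>a\<close>, and the isomorphism of extended affine Lie algebras is
  \<open>(x, c, d) \<mapsto> (\<phi> x - Y d, c', \<Phi> d)\<close> with
  \<open>c' (\<Phi> e) = a c e + (\<phi> x | Y e) - (Y d | Y e) / 2\<close>.
\<close>

section \<open>Traces, eigenvectors and invariant forms on simple Lie algebras\<close>

text \<open>The obstacle is that the degree part of \<open>\<psi> (\<alpha>, l)\<close> depends on
  \<open>\<alpha>\<close> as well as on \<open>l\<close>, so degree derivations are not carried to
  degree derivations. On the centroid lattice, taken with root zero, \<open>\<psi>\<close> acts on
  degrees alone. This lattice has finite index in \<open>Zn\<close>, so in characteristic 0 it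
  determines an additive function on \<open>Zn\<close>, and the discrepancy elsewhere becomes a
  function of the root. To realise that function by a Cartan element, derivations of the simple
  algebra must be inner, hence its Killing form must be nondegenerate; the nonvanishing of the form
  is extracted from the root decomposition. The pair is unique because the centroid span of the
  Cartan subalgebra is abelian: an inner derivation by one of its elements kills that span, and a
  skew centroidal derivation that does so is zero. The term \<open>(Y d | Y e) / 2\<close> is half
  of the defect that the shift by \<open>Y\<close> creates in the form, split evenly between the two
  functionals involved.\<close>

lemma subsp_sum:
  assumes "subsp s C" "\<And>v. v \<in> T \<Longrightarrow> g v \<in> C"
  shows "sum g T \<in> C"
  using assms(2)
proof (induction T rule: infinite_finite_induct)
  case (insert x F)
  then show ?case using assms(1) by (simp add: subsp_def)
qed (use assms(1) in \<open>simp_all add: subsp_def\<close>)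

lemma linear_on_zero:
  assumes "linear_on s s' C f" "subsp s C"
  shows "f 0 = 0"
proof -
  have "f (0 + 0) = f 0 + f 0"
    using assms unfolding linear_on_def subsp_def by blast
  then show ?thesis by simp
qed

lemma linear_on_sum:
  assumes "linear_on s s' C f" "subsp s C" "\<And>v. v \<in> T \<Longrightarrow> g v \<in> C"
  shows "f (sum g T) = (\<Sum>v\<in>T. f (g v))"
  using assms(3)
proof (induction T rule: infinite_finite_induct)
  case (insert x F)
  then show ?case using assms(1) subsp_sum[OF assms(2), of F g]
    by (simp add: linear_on_def)
qed (use linear_on_zero[OF assms(1,2)] in simp_all)

lemma subsp_UNIV [simp]: "subsp s UNIV"
  by (simp add: subsp_def)

lemma subsp_add: "subsp s C \<Longrightarrow> x \<in> C \<Longrightarrow> y \<in> C \<Longrightarrow> x + y \<in> C"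
  and subsp_scale: "subsp s C \<Longrightarrow> x \<in> C \<Longrightarrow> s a x \<in> C"
  and subsp_0: "subsp s C \<Longrightarrow> 0 \<in> C"
  by (simp_all add: subsp_def)

lemma linear_on_add: "linear_on s s' C f \<Longrightarrow> x \<in> C \<Longrightarrow> y \<in> C \<Longrightarrow> f (x + y) = f x + f y"
  and linear_on_scale: "linear_on s s' C f \<Longrightarrow> x \<in> C \<Longrightarrow> f (s a x) = s' a (f x)"
  by (simp_all add: linear_on_def)

lemma subsp_minus:
  assumes "vector_space s" "subsp s C" "x \<in> C"
  shows "- x \<in> C"
proof -
  interpret vector_space s by fact
  show ?thesis using subsp_scale[OF assms(2,3), of "- 1"] by simp
qed

lemma subsp_diff:
  assumes "vector_space s" "subsp s C" "x \<in> C" "y \<in> C"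
  shows "x - y \<in> C"
  using subsp_add[OF assms(2,3) subsp_minus[OF assms(1,2,4)]] by simp

lemma linear_on_minus:
  assumes "linear_on s s' C f" "vector_space s" "vector_space s'" "x \<in> C"
  shows "f (- x) = - f x"
proof -
  interpret a: vector_space s by fact
  interpret b: vector_space s' by fact
  show ?thesis using linear_on_scale[OF assms(1,4), of "- 1"] by simp
qed

lemma linear_on_diff:
  assumes "linear_on s s' C f" "vector_space s" "vector_space s'" "subsp s C" "x \<in> C" "y \<in> C"
  shows "f (x - y) = f x - f y"
  using linear_on_add[OF assms(1,5) subsp_minus[OF assms(2,4,6)]] linear_on_minus[OF assms(1,2,3,6)]
  by simp

lemma linear_onI:
  assumes "\<And>x y. x \<in> C \<Longrightarrow> y \<in> C \<Longrightarrow> f (x + y) = f x + f y"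
    and "\<And>a x. x \<in> C \<Longrightarrow> f (s a x) = s' a (f x)"
  shows "linear_on s s' C f"
  using assms by (simp add: linear_on_def)

section \<open>Coordinates, bases and traces\<close>

context vector_space
begin

lemma lspan_eq_span: "lspan scale S = span S"
  unfolding lspan_def span_explicit by auto

lemma subsp_iff_subspace: "subsp scale V \<longleftrightarrow> subspace V"
  unfolding subsp_def subspace_def by auto

lemma fin_basis_iff: "fin_basis scale B \<longleftrightarrow> finite B \<and> independent B \<and> span B = UNIV"
  unfolding fin_basis_def lspan_eq_span using dependent_finite[of B] by auto

lemma coord_sum:
  assumes "fin_basis scale B"
  shows "(\<Sum>u\<in>B. scale (coord scale B v u) u) = v"
proof -
  have "v \<in> span B" using assms by (simp add: fin_basis_iff)
  then obtain r where "v = (\<Sum>u\<in>B. scale (r u) u)"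
    using assms span_finite[of B] by (auto simp: fin_basis_iff)
  then have "v = (\<Sum>u\<in>B. scale (coord scale B v u) u)"
    unfolding coord_def by (rule someI[where P = "\<lambda>r. v = (\<Sum>u\<in>B. scale (r u) u)"])
  then show ?thesis by simp
qed

lemma coord_unique:
  assumes "fin_basis scale B" "v = (\<Sum>u\<in>B. scale (r u) u)" "u \<in> B"
  shows "coord scale B v u = r u"
proof -
  have "(\<Sum>u\<in>B. scale (coord scale B v u - r u) u) = 0"
    by (simp add: scale_left_diff_distrib sum_subtractf coord_sum[OF assms(1)] flip: assms(2))
  then have "\<forall>u\<in>B. coord scale B v u - r u = 0"
    using assms(1) unfolding fin_basis_def by fast
  then have "coord scale B v u - r u = 0" using assms(3) by (rule bspec)
  then show ?thesis by simp
qed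

lemma coord_add:
  assumes "fin_basis scale B" "u \<in> B"
  shows "coord scale B (v + w) u = coord scale B v u + coord scale B w u"
  by (rule coord_unique[OF assms(1) _ assms(2)])
     (simp add: scale_left_distrib sum.distrib coord_sum[OF assms(1)])

lemma coord_scale:
  assumes "fin_basis scale B" "u \<in> B"
  shows "coord scale B (scale a v) u = a * coord scale B v u"
  by (rule coord_unique[OF assms(1) _ assms(2)])
     (simp add: scale_sum_right[symmetric] coord_sum[OF assms(1)] flip: scale_scale)

lemma coord_basis:
  assumes "fin_basis scale B" "u \<in> B" "v \<in> B"
  shows "coord scale B v u = (if u = v then 1 else 0)"
  by (rule coord_unique[OF assms(1) _ assms(2)])
     (use assms in \<open>simp add: fin_basis_def if_distrib[of "\<lambda>c. scale c _"] cong: if_cong\<close>)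

lemma linear_on_coord:
  assumes "fin_basis scale B" "u \<in> B"
  shows "linear_on scale (*) UNIV (\<lambda>v. coord scale B v u)"
  by (rule linear_onI) (simp_all add: coord_add[OF assms] coord_scale[OF assms])

lemma fin_basis_expand:
  assumes "fin_basis scale B" "linear_on scale s' UNIV f"
  shows "f v = (\<Sum>u\<in>B. s' (coord scale B v u) (f u))"
proof -
  have "f v = f (\<Sum>u\<in>B. scale (coord scale B v u) u)"
    by (simp add: coord_sum[OF assms(1)])
  also have "\<dots> = (\<Sum>u\<in>B. f (scale (coord scale B v u) u))"
    by (rule linear_on_sum[OF assms(2)]) simp_all
  finally show ?thesis using assms(2) by (simp add: linear_on_def)
qed

lemma linear_extension:
  assumes "fin_basis scale B" "vector_space s'"
  obtains f where "linear_on scale s' UNIV f" "\<And>u. u \<in> B \<Longrightarrow> f u = h u"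
proof -
  interpret t: vector_space s' by fact
  have [simp]: "finite B" using assms(1) by (simp add: fin_basis_def)
  let ?f = "\<lambda>v. \<Sum>u\<in>B. s' (coord scale B v u) (h u)"
  have "linear_on scale s' UNIV ?f"
    by (rule linear_onI)
       (simp_all add: coord_add[OF assms(1)] coord_scale[OF assms(1)] t.scale_left_distrib
          sum.distrib t.scale_sum_right)
  moreover have "?f v = h v" if "v \<in> B" for v
  proof -
    have "?f v = (\<Sum>u\<in>B. if u = v then h v else 0)"
      by (rule sum.cong) (auto simp: coord_basis[OF assms(1) _ that])
    then show ?thesis using that by simp
  qed
  ultimately show ?thesis using that by blast
qed

text \<open>Independence of the basis hidden in the choice made by \<open>ltrace\<close>: expanding
  \<open>T u\<close> in the chosen basis, and the vectors of that basis in \<open>B\<close>, turns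
  both diagonal sums into one double sum.\<close>

lemma ltrace_basis:
  assumes B: "fin_basis scale B" and T: "linear_on scale scale UNIV T"
  shows "ltrace scale T = (\<Sum>u\<in>B. coord scale B (T u) u)"
proof -
  define B0 where "B0 = (SOME B. fin_basis scale B)"
  have B0: "fin_basis scale B0" unfolding B0_def by (rule someI) (rule B)
  have "(\<Sum>u\<in>B. coord scale B (T u) u)
      = (\<Sum>u\<in>B. \<Sum>v\<in>B0. coord scale B0 (T u) v * coord scale B v u)"
    by (rule sum.cong[OF refl])
       (rule fin_basis_expand[OF B0 linear_on_coord[OF B]])
  also have "\<dots> = (\<Sum>v\<in>B0. \<Sum>u\<in>B. coord scale B v u * coord scale B0 (T u) v)"
    by (subst sum.swap) (simp add: mult.commute)
  also have "\<dots> = (\<Sum>v\<in>B0. coord scale B0 (T v) v)"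
  proof (rule sum.cong[OF refl])
    fix v assume v: "v \<in> B0"
    have "linear_on scale (*) UNIV (\<lambda>w. coord scale B0 (T w) v)"
      using T linear_on_coord[OF B0 v] by (simp add: linear_on_def)
    from fin_basis_expand[OF B this, of v]
    show "(\<Sum>u\<in>B. coord scale B v u * coord scale B0 (T u) v) = coord scale B0 (T v) v"
      by simp
  qed
  finally show ?thesis by (simp add: ltrace_def B0_def Let_def)
qed

lemma ltrace_eigenbasis:
  assumes B: "fin_basis scale B" and T: "linear_on scale scale UNIV T"
    and "\<And>u. u \<in> B \<Longrightarrow> T u = scale (c u) u"
  shows "ltrace scale T = sum c B"
  by (simp add: ltrace_basis[OF B T] assms(3) coord_scale[OF B] coord_basis[OF B] cong: sum.cong)

end

section \<open>Finite-dimensional spaces: trace identities, duality, eigenvectors\<close>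

locale fd_space = vector_space s for s :: "'k::field \<Rightarrow> 'v::ab_group_add \<Rightarrow> 'v" +
  assumes ex_fin_basis: "\<exists>B. fin_basis s B"
begin

abbreviation lin :: "('v \<Rightarrow> 'v) \<Rightarrow> bool" where
  "lin \<equiv> linear_on s s UNIV"

lemma lin_comp: "lin f \<Longrightarrow> lin g \<Longrightarrow> lin (\<lambda>x. f (g x))"
  by (simp add: linear_on_def)

lemma ltrace_add:
  assumes "lin f" "lin g"
  shows "ltrace s (\<lambda>v. f v + g v) = ltrace s f + ltrace s g"
proof -
  obtain B where B: "fin_basis s B" using ex_fin_basis by blast
  have "lin (\<lambda>v. f v + g v)" using assms by (auto simp: linear_on_def scale_right_distrib)
  then show ?thesis using assms
    by (simp add: ltrace_basis[OF B] coord_add[OF B] sum.distrib)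
qed

lemma ltrace_scale:
  assumes "lin f"
  shows "ltrace s (\<lambda>v. s a (f v)) = a * ltrace s f"
proof -
  obtain B where B: "fin_basis s B" using ex_fin_basis by blast
  have "lin (\<lambda>v. s a (f v))" using assms by (auto simp: linear_on_def scale_right_distrib mult.commute)
  then show ?thesis using assms
    by (simp add: ltrace_basis[OF B] coord_scale[OF B] sum_distrib_left)
qed

lemma ltrace_diff:
  assumes "lin f" "lin g"
  shows "ltrace s (\<lambda>v. f v - g v) = ltrace s f - ltrace s g"
proof -
  have g: "lin (\<lambda>v. s (- 1) (g v))" using assms by (auto simp: linear_on_def scale_right_distrib)
  show ?thesis
    using ltrace_add[OF assms(1) g] ltrace_scale[OF assms(2), of "- 1"] by simp
qed

lemma ltrace_comm:
  assumes f: "lin f" and g: "lin g"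
  shows "ltrace s (\<lambda>v. f (g v)) = ltrace s (\<lambda>v. g (f v))"
proof -
  obtain B where B: "fin_basis s B" using ex_fin_basis by blast
  have *: "ltrace s (\<lambda>v. f (g v)) = (\<Sum>u\<in>B. \<Sum>w\<in>B. coord s B (g u) w * coord s B (f w) u)"
    if f: "lin f" and g: "lin g" for f g
    unfolding ltrace_basis[OF B lin_comp[OF f g]]
  proof (rule sum.cong[OF refl])
    fix u assume u: "u \<in> B"
    have "linear_on s (*) UNIV (\<lambda>w. coord s B (f w) u)"
      using f linear_on_coord[OF B u] by (simp add: linear_on_def)
    from fin_basis_expand[OF B this, of "g u"]
    show "coord s B (f (g u)) u = (\<Sum>w\<in>B. coord s B (g u) w * coord s B (f w) u)" .
  qed
  show ?thesis
    unfolding *[OF f g] *[OF g f] by (subst sum.swap) (simp add: mult.commute)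
qed

lemma fin_basis_subset:
  assumes "span S = UNIV"
  obtains B where "B \<subseteq> S" "fin_basis s B"
proof -
  obtain B0 where B0: "fin_basis s B0" using ex_fin_basis by blast
  interpret fd: finite_dimensional_vector_space s B0
    using B0 by unfold_locales (auto simp: fin_basis_iff)
  obtain B where B: "B \<subseteq> S" "independent B" "S \<subseteq> span B"
    using maximal_independent_subset by blast
  have "span B = UNIV" using B(3) assms by (metis span_mono span_span top.extremum_uniqueI)
  then show ?thesis using that[OF B(1)] B(2) fd.finiteI_independent by (simp add: fin_basis_iff)
qed

text \<open>Using the values \<open>k x u\<close> on a basis as coordinates turns \<open>k\<close>
  into an endomorphism \<open>T\<close> of the space itself. Nondegeneracy makes it injective, hence
  surjective by dimension, and a preimage of the vector with coordinates \<open>f u\<close>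
  represents \<open>f\<close>.\<close>

lemma riesz:
  assumes k1: "\<And>y. linear_on s (*) UNIV (\<lambda>x. k x y)"
    and k2: "\<And>x. linear_on s (*) UNIV (k x)"
    and nd: "\<And>x. (\<And>y. k x y = 0) \<Longrightarrow> x = 0"
    and f: "linear_on s (*) UNIV f"
  obtains t where "\<And>y. k t y = f y"
proof -
  obtain B where B: "fin_basis s B" using ex_fin_basis by blast
  interpret fd: finite_dimensional_vector_space s B
    using B by unfold_locales (auto simp: fin_basis_iff)
  define T where "T x = (\<Sum>u\<in>B. s (k x u) u)" for x
  have T: "Vector_Spaces.linear s s T"
    unfolding Vector_Spaces.linear_iff using k1 vector_space_axioms
    by (auto simp: T_def linear_on_def scale_left_distrib sum.distrib scale_sum_right)
  have cT: "coord s B (T x) u = k x u" if "u \<in> B" for x u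
    by (rule coord_unique[OF B _ that]) (simp add: T_def)
  have "inj T"
  proof (rule injI)
    fix x y assume "T x = T y"
    then have k: "k x u = k y u" if "u \<in> B" for u using cT that by metis
    have kk: "k x z = k y z" for z
      unfolding fin_basis_expand[OF B k2, of x z] fin_basis_expand[OF B k2, of y z]
      using k by simp
    have "k (x - y) z = 0" for z
      using linear_on_diff[OF k1, of x y z] kk vector_space_axioms
      by (simp add: vector_space_def algebra_simps)
    then show "x = y" using nd[of "x - y"] by simp
  qed
  then have "surj T" using fd.linear_inj_imp_surj[OF T] by simp
  then obtain t where t: "T t = (\<Sum>u\<in>B. s (f u) u)" by (metis surj_def)
  have "k t u = f u" if "u \<in> B" for u
    using cT[OF that, of t] coord_unique[OF B t that] by simp
  then have "k t y = f y" for y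
    unfolding fin_basis_expand[OF B k2, of t y] fin_basis_expand[OF B f, of y] by simp
  then show ?thesis using that by blast
qed

text \<open>The iterates \<open>x, f x, ..., f^N x\<close>, with \<open>N\<close> the dimension, are
  too many to be independent.\<close>

lemma ex_annihilating_poly:
  assumes "lin f"
  obtains p where "p \<noteq> 0" "(\<Sum>i\<le>degree p. s (coeff p i) ((f ^^ i) x)) = 0"
proof -
  obtain B where B: "fin_basis s B" using ex_fin_basis by blast
  interpret fd: finite_dimensional_vector_space s B
    using B by unfold_locales (auto simp: fin_basis_iff)
  let ?g = "\<lambda>i. (f ^^ i) x"
  let ?N = "card B"
  have "\<exists>r. (\<exists>i\<le>?N. r i \<noteq> 0) \<and> (\<Sum>i\<le>?N. s (r i) (?g i)) = 0"
  proof (cases "inj_on ?g {..?N}")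
    case True
    have "card (?g ` {..?N}) > card B" using True by (simp add: card_image)
    then have "dependent (?g ` {..?N})"
      using fd.independent_card_le_dim[of "?g ` {..?N}" UNIV] fd.dim_UNIV by (auto simp: fd.dimension_def)
    then obtain r where r: "\<exists>v\<in>?g ` {..?N}. r v \<noteq> 0" "(\<Sum>v\<in>?g ` {..?N}. s (r v) v) = 0"
      using dependent_finite[of "?g ` {..?N}"] by auto
    then show ?thesis
      using sum.reindex[OF True, of "\<lambda>v. s (r v) v"] by (intro exI[of _ "\<lambda>i. r (?g i)"]) auto
  next
    case False
    \<comment> \<open>Coinciding iterates may form a set too small for the dimension count; they
      satisfy the relation with coefficients 1 and -1.\<close>
    then obtain i j where ij: "i \<le> ?N" "j \<le> ?N" "i \<noteq> j" "?g i = ?g j" by (auto simp: inj_on_def)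
    let ?r = "\<lambda>k. (if k = i then 1 else 0) - (if k = j then 1 else (0::'k))"
    have "(\<Sum>k\<le>?N. s (?r k) (?g k)) = (\<Sum>k\<le>?N. if k = i then ?g i else 0) - (\<Sum>k\<le>?N. if k = j then ?g j else 0)"
      unfolding sum_subtractf[symmetric] by (rule sum.cong) (auto simp: scale_left_diff_distrib)
    then show ?thesis using ij by (intro exI[of _ ?r]) auto
  qed
  then obtain r i where r: "i \<le> ?N" "r i \<noteq> 0" "(\<Sum>i\<le>?N. s (r i) (?g i)) = 0" by blast
  define p where "p = (\<Sum>i\<le>?N. monom (r i) i)"
  have c: "coeff p i = (if i \<le> ?N then r i else 0)" for i
    by (simp add: p_def coeff_sum)
  have "p \<noteq> 0" using c[of i] r by auto
  moreover have "degree p \<le> ?N" by (rule degree_le) (simp add: c)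
  then have "(\<Sum>i\<le>degree p. s (coeff p i) (?g i)) = (\<Sum>i\<le>?N. s (coeff p i) (?g i))"
    by (intro sum.mono_neutral_left) (auto simp: coeff_eq_0)
  ultimately show ?thesis using that[of p] r c by simp
qed

text \<open>Take an annihilating polynomial \<open>p\<close> of least degree over all nonzero
  vectors. For a root \<open>a\<close> and \<open>p = (X - a) q\<close>, minimality gives
  \<open>q(f) x \<noteq> 0\<close>, and this vector is an eigenvector for \<open>a\<close>. Here
  \<open>act p x\<close> is \<open>p(f) x\<close>.\<close>

lemma ex_eigenvector:
  assumes ac: "alg_closed TYPE('k)" and f: "lin f" and x0: "x0 \<noteq> (0::'v)"
  obtains a x where "x \<noteq> 0" "f x = s a x"
proof -
  define act where "act p x = (\<Sum>i\<le>degree p. s (coeff p i) ((f ^^ i) x))" for p x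
  have act_ge: "act p x = (\<Sum>i\<le>N. s (coeff p i) ((f ^^ i) x))" if "degree p \<le> N" for p x N
    unfolding act_def using that by (intro sum.mono_neutral_left) (auto simp: coeff_eq_0)
  have lf: "f (sum g A) = (\<Sum>v\<in>A. f (g v))" for g :: "nat \<Rightarrow> 'v" and A
    by (rule linear_on_sum[OF f]) simp_all
  have f_scale: "f (s a v) = s a (f v)" for a v using f by (simp add: linear_on_def)
  define d where "d = (LEAST d. \<exists>p x. p \<noteq> 0 \<and> x \<noteq> 0 \<and> act p x = 0 \<and> degree p = d)"
  have ex: "\<exists>d p x. p \<noteq> 0 \<and> x \<noteq> 0 \<and> act p x = 0 \<and> degree p = d"
    using ex_annihilating_poly[OF f, of x0] x0 unfolding act_def by metis
  have "\<exists>p x. p \<noteq> 0 \<and> x \<noteq> 0 \<and> act p x = 0 \<and> degree p = d"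
    unfolding d_def by (rule LeastI_ex) (rule ex)
  then obtain p x where p: "p \<noteq> 0" "x \<noteq> 0" "act p x = 0" "degree p = d" by blast
  have min: "act q y \<noteq> 0" if "q \<noteq> 0" "y \<noteq> 0" "degree q < d" for q y
    using that not_less_Least[of "degree q" "\<lambda>d. \<exists>p x. p \<noteq> 0 \<and> x \<noteq> 0 \<and> act p x = 0 \<and> degree p = d"]
    unfolding d_def by blast
  have "degree p > 0"
  proof (rule ccontr)
    assume "\<not> degree p > 0"
    then have "act p x = s (coeff p 0) x" "coeff p 0 \<noteq> 0"
      using p(1) by (auto simp: act_def) (metis leading_coeff_0_iff)
    then show False using p by simp
  qed
  then obtain a where "poly p a = 0" using ac by (auto simp: alg_closed_def)
  then obtain q where q: "p = [:- a, 1:] * q" using poly_eq_0_iff_dvd by (metis dvdE)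
  have q0: "q \<noteq> 0" using p(1) q by auto
  have "degree p = degree [:- a, 1:] + degree q"
    unfolding q by (rule degree_mult_eq) (use q0 in auto)
  then have dq: "degree p = Suc (degree q)" by simp
  have "f (act q x) - s a (act q x) = act p x"
  proof -
    let ?N = "Suc (degree q)"
    have c: "coeff p i = (case i of 0 \<Rightarrow> 0 | Suc j \<Rightarrow> coeff q j) - a * coeff q i" for i
      unfolding q by (cases i) (simp_all add: mult_pCons_left)
    have "act p x = (\<Sum>i\<le>?N. s (case i of 0 \<Rightarrow> 0 | Suc j \<Rightarrow> coeff q j) ((f ^^ i) x))
        - (\<Sum>i\<le>?N. s (a * coeff q i) ((f ^^ i) x))"
      unfolding act_ge[of p ?N x, OF eq_refl[OF dq]] c
      by (simp add: scale_left_diff_distrib sum_subtractf)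
    also have "(\<Sum>i\<le>?N. s (case i of 0 \<Rightarrow> 0 | Suc j \<Rightarrow> coeff q j) ((f ^^ i) x)) = f (act q x)"
      by (subst sum.atMost_Suc_shift) (simp add: act_def lf f_scale)
    also have "(\<Sum>i\<le>?N. s (a * coeff q i) ((f ^^ i) x)) = s a (act q x)"
      unfolding act_ge[of q ?N x, OF le_SucI[OF order_refl]] by (simp add: scale_sum_right scale_right_distrib)
    finally show ?thesis by simp
  qed
  then have "f (act q x) = s a (act q x)" using p(3) by simp
  moreover have "act q x \<noteq> 0" using min[of q x] q0 p(2,4) dq by simp
  ultimately show ?thesis using that by blast
qed

end

section \<open>Simple Lie algebras: Schur's lemma, the Killing form, derivations\<close>

locale simple_lie_alg =
  fixes s :: "'k::field_char_0 \<Rightarrow> 'v::ab_group_add \<Rightarrow> 'v" and b :: "'v \<Rightarrow> 'v \<Rightarrow> 'v"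
  assumes simple: "simple_lie s b"

sublocale simple_lie_alg \<subseteq> fd_space s
  using simple by (auto simp: fd_space_def fd_space_axioms_def simple_lie_def lie_alg_on_def)

context simple_lie_alg
begin

lemma vs: "vector_space s" by (rule vector_space_axioms)

lemma b_add_left: "b (x + y) z = b x z + b y z"
  and b_add_right: "b x (y + z) = b x y + b x z"
  and b_scale_left: "b (s a x) y = s a (b x y)"
  and b_scale_right: "b x (s a y) = s a (b x y)"
  and b_self: "b x x = 0"
  and b_cyclic: "b x (b y z) + b y (b z x) + b z (b x y) = 0"
  using simple unfolding simple_lie_def lie_alg_on_def by blast+

lemma lin_ad: "lin (b x)"
  by (rule linear_onI) (simp_all add: b_add_right b_scale_right)

lemma lin_ad_left: "lin (\<lambda>x. b x y)"
  by (rule linear_onI) (simp_all add: b_add_left b_scale_left)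

lemma b_zero_left [simp]: "b 0 y = 0"
  and b_zero_right [simp]: "b y 0 = 0"
  using linear_on_zero[OF lin_ad] linear_on_zero[OF lin_ad_left] by auto

lemma b_minus_left: "b (- x) y = - b x y"
  and b_minus_right: "b y (- x) = - b y x"
  using linear_on_minus[OF lin_ad vs vs, of x] linear_on_minus[OF lin_ad_left vs vs, of x] by auto

lemma b_diff_left: "b (x - z) y = b x y - b z y"
  using linear_on_diff[OF lin_ad_left vs vs, of x z] by auto

lemma b_sum_right: "b y (sum g T) = (\<Sum>v\<in>T. b y (g v))"
  by (rule linear_on_sum[OF lin_ad]) simp_all

lemma b_anti: "b y x = - b x y"
proof -
  have "b (x + y) (x + y) = b x x + b x y + (b y x + b y y)"
    by (simp only: b_add_left b_add_right ac_simps)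
  then show ?thesis by (simp add: b_self eq_neg_iff_add_eq_0 add.commute)
qed

lemma jacobi: "b x (b y z) = b (b x y) z + b y (b x z)"
proof -
  have "b x (b y z) + b y (- b x z) + - b (b x y) z = 0"
    using b_cyclic[of x y z] by (metis b_anti)
  then show ?thesis by (simp add: b_minus_right algebra_simps)
qed

lemma idealD:
  assumes "subsp s I" "\<And>x y. y \<in> I \<Longrightarrow> b x y \<in> I"
  shows "I = {0} \<or> I = UNIV"
  using simple assms unfolding simple_lie_def by blast

lemma nonabelian: "\<exists>x y. b x y \<noteq> 0"
  using simple unfolding simple_lie_def by blast

lemma center_zero:
  assumes "\<And>y. b x y = 0"
  shows "x = 0"
proof -
  let ?I = "{x. \<forall>y. b x y = 0}"
  have "subsp s ?I" by (auto simp: subsp_def b_add_left b_scale_left)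
  moreover have "b z y \<in> ?I" if "y \<in> ?I" for z y
  proof -
    have "b (b z y) w = 0" for w
      using jacobi[of z y w] that by simp
    then show ?thesis by simp
  qed
  ultimately have "?I = {0} \<or> ?I = UNIV" by (rule idealD)
  then show ?thesis using assms nonabelian by auto
qed

lemma perfect: "span {b x y | x y. True} = UNIV"
proof -
  let ?I = "span {b x y | x y. True}"
  have "?I = {0} \<or> ?I = UNIV"
  proof (rule idealD)
    show "subsp s ?I" by (simp add: subsp_iff_subspace)
    show "b x y \<in> ?I" for x y by (rule span_base) blast
  qed
  moreover obtain x y where "b x y \<noteq> 0" using nonabelian by blast
  moreover have "b x y \<in> ?I" by (rule span_base) blast
  ultimately show ?thesis by auto
qed

text \<open>Every eigenspace of such a map is an ideal, and a nonzero one exists over an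
  algebraically closed field.\<close>

lemma schur:
  assumes ac: "alg_closed TYPE('k)" and c: "lin c" and comm: "\<And>x y. c (b x y) = b x (c y)"
  obtains a where "\<And>x. c x = s a x"
proof -
  obtain x0 y0 where "b x0 y0 \<noteq> 0" using nonabelian by blast
  then obtain a x where ax: "x \<noteq> 0" "c x = s a x" by (rule ex_eigenvector[OF ac c])
  let ?I = "{x. c x = s a x}"
  have "?I = {0} \<or> ?I = UNIV"
  proof (rule idealD)
    show "subsp s ?I" using c linear_on_zero[OF c]
      by (auto simp: subsp_def linear_on_def scale_right_distrib mult.commute)
  qed (simp add: comm b_scale_right)
  then have "c x = s a x" for x using ax by blast
  then show ?thesis using that by blast
qed

abbreviation kap :: "'v \<Rightarrow> 'v \<Rightarrow> 'k" where
  "kap \<equiv> killing s b"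

lemma kap_sym: "kap x y = kap y x"
  unfolding killing_def by (rule ltrace_comm[OF lin_ad lin_ad])

lemma lin_ad_ad: "lin (\<lambda>v. b x (b y v))"
  by (rule lin_comp[OF lin_ad lin_ad])

lemma kap_linear_left: "linear_on s (*) UNIV (\<lambda>x. kap x y)"
  unfolding killing_def
  by (rule linear_onI)
     (simp_all add: b_add_left b_scale_left ltrace_add[OF lin_ad_ad lin_ad_ad] ltrace_scale[OF lin_ad_ad])

lemma kap_linear_right: "linear_on s (*) UNIV (kap x)"
  using kap_linear_left[of x] by (simp add: kap_sym[of _ x])

text \<open>Cyclicity of the trace gives \<open>tr (D ad [y, z]) = tr ([D, ad y] ad z)\<close>, and
  \<open>[D, ad y] = ad (D y)\<close> for a derivation. The case \<open>D = ad x\<close> is the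
  invariance of the Killing form.\<close>

lemma ltrace_deriv:
  assumes D: "lin D" and der: "\<And>x y. D (b x y) = b (D x) y + b x (D y)"
  shows "ltrace s (\<lambda>v. D (b (b y z) v)) = kap (D y) z"
proof -
  have D_diff: "D (u - v) = D u - D v" for u v
    by (rule linear_on_diff[OF D vs vs]) simp_all
  have "ltrace s (\<lambda>v. D (b (b y z) v)) = ltrace s (\<lambda>v. D (b y (b z v)) - D (b z (b y v)))"
    by (simp add: jacobi[of y z] flip: D_diff)
  also have "\<dots> = ltrace s (\<lambda>v. D (b y (b z v))) - ltrace s (\<lambda>v. D (b z (b y v)))"
    by (rule ltrace_diff[OF lin_comp[OF D lin_ad_ad] lin_comp[OF D lin_ad_ad]])
  also have "ltrace s (\<lambda>v. D (b z (b y v))) = ltrace s (\<lambda>v. b y (D (b z v)))"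
    by (rule ltrace_comm[OF lin_comp[OF D lin_ad] lin_ad])
  also have "ltrace s (\<lambda>v. D (b y (b z v))) - ltrace s (\<lambda>v. b y (D (b z v)))
      = ltrace s (\<lambda>v. D (b y (b z v)) - b y (D (b z v)))"
    by (rule ltrace_diff[OF lin_comp[OF D lin_ad_ad] lin_comp[OF lin_ad lin_comp[OF D lin_ad]], symmetric])
  also have "\<dots> = kap (D y) z"
    by (simp add: der killing_def)
  finally show ?thesis .
qed

lemma kap_invariant: "kap (b x y) z = kap x (b y z)"
proof -
  have "ltrace s (\<lambda>v. b x (b (b y z) v)) = kap (b x y) z"
    by (rule ltrace_deriv[OF lin_ad jacobi])
  then show ?thesis by (simp add: killing_def)
qed

text \<open>\<open>ad (f x)\<close> is the conjugate of \<open>ad x\<close> by \<open>f\<close>, and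
  the trace is invariant under conjugation.\<close>

lemma kap_automorphism:
  assumes "lie_aut s b f"
  shows "kap (f x) (f y) = kap x y"
proof -
  have bij: "bij f" and f: "lin f" and hom: "\<And>x y. f (b x y) = b (f x) (f y)"
    using assms by (auto simp: lie_aut_def)
  let ?g = "inv f"
  have fg: "f (?g v) = v" and gf: "?g (f v) = v" for v
    using bij by (simp_all add: bij_is_surj surj_f_inv_f bij_is_inj)
  have g: "lin ?g"
    by (rule linear_onI) (metis f fg gf linear_on_add UNIV_I, metis f fg gf linear_on_scale UNIV_I)
  have *: "b (f x) (b (f y) v) = f (b x (b y (?g v)))" for v
    by (simp add: hom fg)
  have "kap (f x) (f y) = ltrace s (\<lambda>v. f (b x (b y (?g v))))"
    unfolding killing_def * ..
  also have "\<dots> = ltrace s (\<lambda>v. b x (b y (?g (f v))))"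
    by (rule ltrace_comm[OF f lin_comp[OF lin_ad_ad g]])
  finally show ?thesis by (simp add: gf killing_def)
qed

text \<open>The radical is an ideal. A nonzero value of the form is a hypothesis at this stage; it
  comes later from the root decomposition, in \<open>kap_nonzero\<close>.\<close>

lemma kap_nondeg:
  assumes "\<exists>x y. kap x y \<noteq> 0" and "\<And>y. kap x y = 0"
  shows "x = 0"
proof -
  let ?I = "{x. \<forall>y. kap x y = 0}"
  have "?I = {0} \<or> ?I = UNIV"
  proof (rule idealD)
    show "subsp s ?I"
      using linear_on_zero[OF kap_linear_left] linear_on_add[OF kap_linear_left] linear_on_scale[OF kap_linear_left]
      by (simp add: subsp_def)
    show "b x y \<in> ?I" if "y \<in> ?I" for x y
    proof -
      have "kap (b x y) z = 0" for z
        using that kap_invariant[of y x z] linear_on_minus[OF kap_linear_left vs, of "b y x"]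
        by (simp add: b_anti[of x y] vector_space_def algebra_simps)
      then show ?thesis by simp
    qed
  qed
  then show ?thesis using assms by auto
qed

text \<open>The functional \<open>y \<mapsto> tr (D ad y)\<close> is represented by some
  \<open>t\<close>. Then \<open>\<kappa>(D x, y) = tr (D ad [x, y]) = \<kappa>(t, [x, y]) =
  \<kappa>([t, x], y)\<close> for all \<open>y\<close>.\<close>

lemma derivation_inner:
  assumes nz: "\<exists>x y. kap x y \<noteq> 0"
    and D: "lin D" and der: "\<And>x y. D (b x y) = b (D x) y + b x (D y)"
  obtains t where "\<And>x. D x = b t x"
proof -
  have lt: "linear_on s (*) UNIV (\<lambda>y. ltrace s (\<lambda>v. D (b y v)))"
  proof (rule linear_onI)
    show "ltrace s (\<lambda>v. D (b (x + y) v)) = ltrace s (\<lambda>v. D (b x v)) + ltrace s (\<lambda>v. D (b y v))" for x y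
      using ltrace_add[OF lin_comp[OF D lin_ad[of x]] lin_comp[OF D lin_ad[of y]]]
      by (simp add: b_add_left linear_on_add[OF D])
    show "ltrace s (\<lambda>v. D (b (s a x) v)) = a * ltrace s (\<lambda>v. D (b x v))" for a x
      using ltrace_scale[OF lin_comp[OF D lin_ad[of x]], of a]
      by (simp add: b_scale_left linear_on_scale[OF D])
  qed
  have "\<exists>t. \<forall>y. kap t y = ltrace s (\<lambda>v. D (b y v))"
    by (rule riesz[OF kap_linear_left kap_linear_right kap_nondeg[OF nz] lt]) auto
  then obtain t where t: "\<And>y. kap t y = ltrace s (\<lambda>v. D (b y v))" by blast
  have "D x - b t x = 0" for x
  proof (rule kap_nondeg[OF nz])
    fix y
    have "kap (D x) y = ltrace s (\<lambda>v. D (b (b x y) v))" by (rule ltrace_deriv[OF D der, symmetric])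
    also have "\<dots> = kap (b t x) y" by (simp add: kap_invariant flip: t)
    finally show "kap (D x - b t x) y = 0"
      using linear_on_diff[OF kap_linear_left vs, of "D x" "b t x" y]
      by (simp add: vector_space_def algebra_simps)
  qed
  then show ?thesis using that by simp
qed

text \<open>Nondegeneracy yields a linear \<open>c\<close> with
  \<open>\<beta> x y = \<kappa>(c x, y)\<close>. Invariance of both forms makes \<open>c\<close>
  commute with all \<open>ad x\<close>, so \<open>c\<close> is a scalar.\<close>

lemma invariant_form_unique:
  assumes nz: "\<exists>x y. kap x y \<noteq> 0" and ac: "alg_closed TYPE('k)"
    and l1: "\<And>y. linear_on s (*) UNIV (\<lambda>x. \<beta> x y)" and l2: "\<And>x. linear_on s (*) UNIV (\<beta> x)"
    and inv: "\<And>x y z. \<beta> (b x y) z = \<beta> x (b y z)"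
  obtains a where "\<And>x y. \<beta> x y = a * kap x y"
proof -
  have "\<exists>t. \<forall>y. kap t y = \<beta> x y" for x
    by (rule riesz[OF kap_linear_left kap_linear_right kap_nondeg[OF nz] l2[of x]]) auto
  then obtain c where c: "\<And>x y. kap (c x) y = \<beta> x y" by metis
  have cancel: "x = y" if "\<And>z. kap x z = kap y z" for x y
  proof -
    have "kap (x - y) z = 0" for z
      using that linear_on_diff[OF kap_linear_left vs, of x y z]
      by (simp add: vector_space_def algebra_simps)
    then show ?thesis using kap_nondeg[OF nz, of "x - y"] by simp
  qed
  have "lin c"
    by (rule linear_onI; rule cancel)
       (simp_all add: c linear_on_add[OF kap_linear_left] linear_on_scale[OF kap_linear_left]
         linear_on_add[OF l1] linear_on_scale[OF l1])
  moreover have c_left: "c (b x y) = b (c x) y" for x y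
    by (rule cancel) (simp add: c inv kap_invariant)
  then have "c (b x y) = b x (c y)" for x y
    using linear_on_minus[OF \<open>lin c\<close> vs vs, of "b y x"] by (metis UNIV_I b_anti)
  ultimately obtain a where "\<And>x. c x = s a x" using schur[OF ac] by blast
  then have "\<beta> x y = a * kap x y" for x y
    using c[of x y] linear_on_scale[OF kap_linear_left, of x a y] by simp
  then show ?thesis using that by blast
qed

end

section \<open>Root spaces and the Killing form\<close>

lemma sum_power_primitive_root:
  fixes w :: "'k::field"
  assumes "w ^ m = 1" "w \<noteq> 1"
  shows "(\<Sum>j<m. w ^ j) = 0"
  using assms by (simp add: geometric_sum)

text \<open>The vectors \<open>y j\<close>, sums of \<open>z^(-ij) f^i x\<close> over
  \<open>i\<close>, are \<open>m\<close> times the eigenprojections of \<open>x\<close>, and they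
  add up to \<open>m x\<close>. The invariant subspace \<open>W\<close> lets the statement be
  iterated over commuting automorphisms.\<close>

lemma (in vector_space) finite_order_eigen_span:
  fixes z :: 'a
  assumes f: "linear_on scale scale UNIV f" and m: "0 < m" "(of_nat m :: 'a) \<noteq> 0" and fm: "f ^^ m = id"
    and z: "z ^ m = 1" "\<And>j. 0 < j \<Longrightarrow> j < m \<Longrightarrow> z ^ j \<noteq> 1"
    and W: "subsp scale W" "\<And>x. x \<in> W \<Longrightarrow> f x \<in> W" and x: "x \<in> W"
  shows "x \<in> span {y \<in> W. \<exists>j::nat. f y = scale (z ^ j) y}"
proof -
  have z0: "z \<noteq> 0" using z(1) m by (metis power_0_left zero_neq_one neq0_conv)
  let ?w = "inverse z"
  define y where "y j = (\<Sum>i<m. scale (?w ^ (i * j)) ((f ^^ i) x))" for j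
  have fW: "(f ^^ i) x \<in> W" for i by (induction i) (use x W in auto)
  have yW: "y j \<in> W" for j
    unfolding y_def by (rule subsp_sum[OF W(1)]) (rule subsp_scale[OF W(1) fW])
  have fy: "f (y j) = scale (z ^ j) (y j)" for j
  proof -
    let ?g = "\<lambda>i. scale (?w ^ (i * j)) ((f ^^ i) x)"
    \<comment> \<open>\<open>f\<close> shifts the summation index; the wrapped term matches because
      \<open>f^m = id\<close> and \<open>z^m = 1\<close>.\<close>
    have gm: "?g m = ?g 0"
      using fm z(1) by (simp add: power_mult power_inverse)
    have "f (y j) = (\<Sum>i<m. f (?g i))"
      unfolding y_def by (rule linear_on_sum[OF f]) simp_all
    also have "\<dots> = (\<Sum>i<m. scale (z ^ j) (?g (Suc i)))"
    proof (rule sum.cong[OF refl])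
      fix i
      have "z ^ j * ?w ^ (Suc i * j) = ?w ^ (i * j)"
        using z0 by (simp add: power_add power_inverse)
      then show "f (?g i) = scale (z ^ j) (?g (Suc i))"
        using linear_on_scale[OF f, of "(f ^^ i) x"] by simp
    qed
    also have "\<dots> = scale (z ^ j) (\<Sum>i<m. ?g (Suc i))" by (simp only: scale_sum_right)
    also have "(\<Sum>i<m. ?g (Suc i)) = (\<Sum>i<m. ?g i)"
      using sum.lessThan_Suc_shift[of ?g m] gm by (simp add: sum.lessThan_Suc add.commute)
    finally show ?thesis by (simp add: y_def)
  qed
  have "(\<Sum>j<m. y j) = (\<Sum>i<m. scale (\<Sum>j<m. (?w ^ i) ^ j) ((f ^^ i) x))"
    unfolding y_def by (subst sum.swap) (simp add: scale_sum_left power_mult)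
  also have "\<dots> = (\<Sum>i<m. if i = 0 then scale (of_nat m) x else 0)"
  proof (rule sum.cong[OF refl])
    fix i assume i: "i \<in> {..<m}"
    show "scale (\<Sum>j<m. (?w ^ i) ^ j) ((f ^^ i) x) = (if i = 0 then scale (of_nat m) x else 0)"
    proof (cases "i = 0")
      case False
      have "(?w ^ i) ^ m = (?w ^ m) ^ i" by (simp add: mult.commute flip: power_mult)
      then have "(?w ^ i) ^ m = 1" using z(1) by (simp add: power_inverse)
      moreover have "?w ^ i \<noteq> 1" using z(2)[of i] False i by (simp add: power_inverse)
      ultimately have "(\<Sum>j<m. (?w ^ i) ^ j) = 0" by (rule sum_power_primitive_root)
      then show ?thesis using False by simp
    qed simp
  qed
  finally have "(\<Sum>j<m. y j) = scale (of_nat m) x" using m by simp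
  then have "x = scale (inverse (of_nat m)) (\<Sum>j<m. y j)" using m by simp
  moreover have "y j \<in> span {y \<in> W. \<exists>j::nat. f y = scale (z ^ j) y}" for j
    by (rule span_base) (use yW fy in blast)
  ultimately show ?thesis by (metis (no_types, lifting) span_scale span_sum)
qed

text \<open>The coordinate at \<open>\<alpha>\<close> in a basis over the rationals that contains
  \<open>\<alpha>\<close>. Rational values are wanted because a vanishing sum of squares then has
  vanishing terms, which fails in an algebraically closed field.\<close>

lemma ex_rational_functional:
  fixes \<alpha> :: "'a \<Rightarrow> 'k::field_char_0"
  assumes "\<alpha> \<noteq> 0"
  obtains f :: "('a \<Rightarrow> 'k) \<Rightarrow> rat"
    where "\<And>x y. f (x + y) = f x + f y" "\<And>q x. f (\<lambda>y. of_rat q * x y) = q * f x" "f \<alpha> = 1"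
proof -
  interpret v: vector_space "\<lambda>(q::rat) (x::'a \<Rightarrow> 'k) y. of_rat q * x y"
    by unfold_locales (auto simp: fun_eq_iff algebra_simps of_rat_add of_rat_mult)
  have i: "v.independent {\<alpha>}" using assms by (simp add: v.independent_insert)
  let ?B = "v.extend_basis {\<alpha>}"
  have B: "v.independent ?B" "v.span ?B = UNIV" "\<alpha> \<in> ?B"
    using v.independent_extend_basis[OF i] v.span_extend_basis[OF i] v.extend_basis_superset[OF i] by auto
  have s: "x \<in> v.span ?B" for x using B(2) by simp
  show ?thesis
  proof (rule that[of "\<lambda>x. v.representation ?B x \<alpha>"])
    show "v.representation ?B (x + y) \<alpha> = v.representation ?B x \<alpha> + v.representation ?B y \<alpha>" for x y
      by (simp add: v.representation_add[OF B(1) s s])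
    show "v.representation ?B (\<lambda>y. of_rat q * x y) \<alpha> = q * v.representation ?B x \<alpha>" for q x
      by (simp add: v.representation_scale[OF B(1) s])
    show "v.representation ?B \<alpha> \<alpha> = 1"
      by (simp add: v.representation_basis[OF B(1,3)])
  qed
qed

lemma sum_apply: "sum f A x = (\<Sum>a\<in>A. f a x)"
  for f :: "'a \<Rightarrow> 'b \<Rightarrow> 'c::comm_monoid_add"
  by (induction A rule: infinite_finite_induct) simp_all

lemma gen_grp_add:
  assumes "x \<in> gen_grp S" "y \<in> gen_grp S"
  shows "x + y \<in> gen_grp S"
  using gen_diff[OF assms(1) gen_diff[OF gen_zero assms(2)]] by simp


section \<open>Roots and degrees on the simple algebra of a multiloop datum\<close>

locale multiloop =
  fixes n :: nat and zeta :: "nat \<Rightarrow> 'k::field_char_0" and G :: "('k, 'a::ab_group_add) mldatum"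
  assumes ac: "alg_closed TYPE('k)" and roots: "roots_ok zeta"
    and datum: "multiloop_datum n zeta G" and fixed: "gfix n zeta G \<noteq> {0}"

sublocale multiloop \<subseteq> simple_lie_alg "msc G" "mbr G"
  using datum by (simp add: simple_lie_alg_def multiloop_datum_def)

context multiloop
begin

abbreviation sc where "sc \<equiv> msc G"
abbreviation br where "br \<equiv> mbr G"
abbreviation \<h> where "\<h> \<equiv> mcart G"
abbreviation rs where "rs \<equiv> rootsp G"
abbreviation dg where "dg \<equiv> gl n zeta G"

text \<open>Roots are encoded as functions on the whole algebra; this normalisation makes agreement
  on the Cartan subalgebra the same as equality.\<close>

definition normal :: "('a \<Rightarrow> 'k) \<Rightarrow> bool" where
  "normal \<alpha> \<longleftrightarrow> (\<forall>y. y \<notin> \<h> \<longrightarrow> \<alpha> y = 0)"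

text \<open>The relation that decides when two degrees define the same eigenspace: see
  \<open>dg_cong\<close> and \<open>dg_unique\<close>.\<close>

definition dcong :: "(nat \<Rightarrow> int) \<Rightarrow> (nat \<Rightarrow> int) \<Rightarrow> bool" where
  "dcong l m \<longleftrightarrow> (\<forall>i<n. int (mord G i) dvd l i - m i)"

lemma normal_0 [simp]: "normal 0" by (simp add: normal_def)
lemma normal_add: "normal \<alpha> \<Longrightarrow> normal \<beta> \<Longrightarrow> normal (\<alpha> + \<beta>)" by (simp add: normal_def)
lemma weights_normal: "\<alpha> \<in> weights G \<Longrightarrow> normal \<alpha>" by (auto simp: weights_def normal_def)

lemma Qh_normal: "\<alpha> \<in> Qh G \<Longrightarrow> normal \<alpha>"
  unfolding Qh_def by (induction rule: gen_grp.induct) (auto simp: weights_def normal_def)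

lemma weights_Qh: "\<alpha> \<in> weights G \<Longrightarrow> \<alpha> \<in> Qh G"
  unfolding Qh_def by (cases "\<alpha> = 0") (auto intro: gen_grp.intros)

lemma normal_weight: "normal \<alpha> \<Longrightarrow> x \<in> rs \<alpha> \<Longrightarrow> x \<noteq> 0 \<Longrightarrow> \<alpha> \<in> weights G"
  unfolding weights_def normal_def by auto

lemma sig:
  assumes "i < n"
  shows sig_aut: "lie_aut sc br (msig G i)" and mord_pos: "0 < mord G i"
    and sig_pow: "msig G i ^^ mord G i = id"
  using datum assms by (auto simp: multiloop_datum_def)

lemma sig_comm: "i < n \<Longrightarrow> j < n \<Longrightarrow> msig G i (msig G j x) = msig G j (msig G i x)"
  using datum by (auto simp: multiloop_datum_def fun_eq_iff)

lemma sig_lin: "i < n \<Longrightarrow> lin (msig G i)"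
  and sig_br: "i < n \<Longrightarrow> msig G i (br x y) = br (msig G i x) (msig G i y)"
  using sig_aut by (auto simp: lie_aut_def)

lemma zeta_pow: "0 < m \<Longrightarrow> zeta m ^ m = 1"
  and zeta_prim: "0 < m \<Longrightarrow> 0 < j \<Longrightarrow> j < m \<Longrightarrow> zeta m ^ j \<noteq> 1"
  using roots by (auto simp: roots_ok_def)

lemma zeta_nz: "0 < m \<Longrightarrow> zeta m \<noteq> 0"
  using zeta_pow[of m] by (metis power_0_left zero_neq_one neq0_conv)

lemma zeta_powi_1:
  assumes m: "0 < m"
  shows "zeta m powi c = 1 \<longleftrightarrow> int m dvd c"
proof -
  let ?q = "c div int m" and ?r = "c mod int m"
  have "zeta m powi c = zeta m powi (int m * ?q + ?r)" by simp
  also have "\<dots> = (zeta m powi int m) powi ?q * zeta m powi ?r"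
    using zeta_nz[OF m] by (subst power_int_add) (simp_all only: power_int_mult simp_thms)
  also have "\<dots> = zeta m ^ nat ?r"
    using m zeta_pow[OF m] by (simp add: power_int_def)
  finally have *: "zeta m powi c = zeta m ^ nat ?r" .
  have "?r < int m" using m by simp
  then have "nat ?r < m" using m by linarith
  moreover have "?r \<ge> 0" using m by simp
  ultimately show ?thesis
    unfolding * using zeta_prim[OF m, of "nat ?r"] by (cases "?r = 0") (simp_all add: dvd_eq_mod_eq_0 del: pos_mod_sign)
qed

lemma zeta_powi_eq:
  assumes "0 < m"
  shows "zeta m powi a = zeta m powi b \<longleftrightarrow> int m dvd a - b"
  using zeta_powi_1[OF assms, of "a - b"] zeta_nz[OF assms] by (simp add: power_int_diff)

lemma subsp_rs: "subsp sc (rs \<alpha>)"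
  by (auto simp: subsp_def rootsp_def b_add_right b_scale_right scale_right_distrib mult.commute)

lemma subsp_dg: "subsp sc (dg l)"
  using linear_on_zero[OF sig_lin] linear_on_add[OF sig_lin] linear_on_scale[OF sig_lin]
  by (auto simp: subsp_def gl_def scale_right_distrib mult.commute)

lemma rs_br: "x \<in> rs \<alpha> \<Longrightarrow> y \<in> rs \<beta> \<Longrightarrow> br x y \<in> rs (\<alpha> + \<beta>)"
  by (auto simp: rootsp_def jacobi b_scale_left b_scale_right scale_left_distrib)

lemma dg_br: 
  assumes "x \<in> dg l" "y \<in> dg m"
  shows "br x y \<in> dg (l + m)"
  using assms zeta_nz[OF mord_pos]
  by (simp add: gl_def sig_br b_scale_left b_scale_right power_int_add)


lemma dg_cong:
  assumes "dcong l m"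
  shows "dg l = dg m"
proof -
  have "zeta (mord G i) powi l i = zeta (mord G i) powi m i" if "i < n" for i
    using assms that zeta_powi_eq[OF mord_pos[OF that]] by (simp add: dcong_def)
  then show ?thesis by (simp add: gl_def)
qed

lemma dg_unique: "x \<in> dg l \<Longrightarrow> x \<in> dg m \<Longrightarrow> x \<noteq> 0 \<Longrightarrow> dcong l m"
  using zeta_powi_eq[OF mord_pos] unfolding gl_def dcong_def
  by (metis (mono_tags, lifting) mem_Collect_eq scale_right_imp_eq)

lemma h_fixed: "y \<in> \<h> \<Longrightarrow> y \<in> dg 0"
  and subsp_h: "subsp sc \<h>"
  and h_nilp: "\<exists>i. lcs sc br \<h> i = {0}"
  and h_self_norm: "x \<in> dg 0 \<Longrightarrow> (\<And>y. y \<in> \<h> \<Longrightarrow> br x y \<in> \<h>) \<Longrightarrow> x \<in> \<h>"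
  using datum by (auto simp: multiloop_datum_def cartan_sub_def gfix_def)

lemma sig_h: "i < n \<Longrightarrow> y \<in> \<h> \<Longrightarrow> msig G i y = y"
  using h_fixed[of y] by (simp add: gl_def)

lemma sig_rs: "i < n \<Longrightarrow> x \<in> rs \<alpha> \<Longrightarrow> msig G i x \<in> rs \<alpha>"
  unfolding rootsp_def
  by (auto simp: linear_on_scale[OF sig_lin] sig_h simp flip: sig_br)
     (metis sig_br sig_h linear_on_scale[OF sig_lin] UNIV_I)

text \<open>Each step diagonalises one more automorphism. The common eigenspace of the first
  \<open>k\<close> inside the root space is stable under the next one, since the automorphisms
  commute and fix the Cartan subalgebra pointwise.\<close>

lemma eigen_span_step:
  assumes "k \<le> n" "x \<in> rs \<alpha>"
  shows "x \<in> span {y \<in> rs \<alpha>. \<exists>l. \<forall>i<k. msig G i y = sc (zeta (mord G i) powi l i) y}"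
  using assms(1)
proof (induction k)
  case 0
  show ?case by (rule span_base) (use assms(2) in simp)
next
  case (Suc k)
  let ?S = "\<lambda>k. {y \<in> rs \<alpha>. \<exists>l. \<forall>i<k. msig G i y = sc (zeta (mord G i) powi l i) y}"
  have k: "k < n" using Suc.prems by simp
  have "?S k \<subseteq> span (?S (Suc k))"
  proof
    fix y assume "y \<in> ?S k"
    then obtain l where y: "y \<in> rs \<alpha>" "\<forall>i<k. msig G i y = sc (zeta (mord G i) powi l i) y" by blast
    let ?W = "{y \<in> rs \<alpha>. \<forall>i<k. msig G i y = sc (zeta (mord G i) powi l i) y}"
    have W: "subsp sc ?W"
      using subsp_rs[of \<alpha>] linear_on_zero[OF sig_lin] linear_on_add[OF sig_lin] linear_on_scale[OF sig_lin] k
      by (auto simp: subsp_def scale_right_distrib mult.commute)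
    have W': "msig G k x \<in> ?W" if "x \<in> ?W" for x
      using that sig_rs[OF k] sig_comm[OF _ k] linear_on_scale[OF sig_lin[OF k]] k by auto
    have "y \<in> span {y \<in> ?W. \<exists>j::nat. msig G k y = sc (zeta (mord G k) ^ j) y}"
      by (rule finite_order_eigen_span[OF sig_lin[OF k] mord_pos[OF k] _ sig_pow[OF k]
            zeta_pow[OF mord_pos[OF k]] zeta_prim[OF mord_pos[OF k]] W W'])
         (use y mord_pos[OF k] in auto)
    also have "\<dots> \<subseteq> span (?S (Suc k))"
    proof (rule span_mono, safe)
      fix x j assume x: "x \<in> rs \<alpha>" "\<forall>i<k. msig G i x = sc (zeta (mord G i) powi l i) x"
        "msig G k x = sc (zeta (mord G k) ^ j) x"
      show "\<exists>l. \<forall>i<Suc k. msig G i x = sc (zeta (mord G i) powi l i) x"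
        by (rule exI[of _ "l(k := int j)"]) (use x in \<open>auto simp: less_Suc_eq\<close>)
    qed
    finally show "y \<in> span (?S (Suc k))" .
  qed
  then have "span (?S k) \<subseteq> span (?S (Suc k))" by (rule span_minimal) simp
  then show ?case using Suc by auto
qed

text \<open>Selected from the spanning set of vectors homogeneous in both root and degree. Linear
  maps on the simple algebra are later prescribed on such a basis.\<close>

lemma homogeneous_basis:
  obtains B wt deg where "fin_basis sc B"
    "\<And>u. u \<in> B \<Longrightarrow> u \<noteq> 0" "\<And>u. u \<in> B \<Longrightarrow> wt u \<in> weights G" "\<And>u. u \<in> B \<Longrightarrow> deg u \<in> Zn n"
    "\<And>u. u \<in> B \<Longrightarrow> u \<in> rs (wt u)" "\<And>u. u \<in> B \<Longrightarrow> u \<in> dg (deg u)"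
proof -
  let ?S = "\<Union>\<alpha>\<in>weights G. \<Union>l\<in>Zn n. rs \<alpha> \<inter> dg l"
  have "(\<Union>\<alpha>\<in>weights G. rs \<alpha>) \<subseteq> span ?S"
  proof safe
    fix \<alpha> x assume \<alpha>: "\<alpha> \<in> weights G" and x: "x \<in> rs \<alpha>"
    have "x \<in> span {y \<in> rs \<alpha>. \<exists>l. \<forall>i<n. msig G i y = sc (zeta (mord G i) powi l i) y}"
      by (rule eigen_span_step) (use x in auto)
    also have "\<dots> \<subseteq> span ?S"
    proof (rule span_mono, safe)
      fix y l assume y: "y \<in> rs \<alpha>" "\<forall>i<n. msig G i y = sc (zeta (mord G i) powi l i) y"
      let ?l = "\<lambda>i. if i < n then l i else 0"
      have "?l \<in> Zn n" "y \<in> dg ?l" using y by (auto simp: Zn_def gl_def)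
      then show "y \<in> ?S" using \<alpha> y by blast
    qed
    finally show "x \<in> span ?S" .
  qed
  then have "span (\<Union>\<alpha>\<in>weights G. rs \<alpha>) \<subseteq> span ?S" by (rule span_minimal) simp
  then have "span ?S = UNIV"
    using datum by (auto simp: multiloop_datum_def lspan_eq_span)
  then obtain B where B: "B \<subseteq> ?S" "fin_basis sc B" by (rule fin_basis_subset)
  have "\<forall>u\<in>B. \<exists>\<alpha> l. \<alpha> \<in> weights G \<and> l \<in> Zn n \<and> u \<in> rs \<alpha> \<and> u \<in> dg l" using B(1) by blast
  then obtain wt deg where
    "\<forall>u\<in>B. wt u \<in> weights G \<and> deg u \<in> Zn n \<and> u \<in> rs (wt u) \<and> u \<in> dg (deg u)" by metis
  moreover have "u \<noteq> 0" if "u \<in> B" for u using B(2) that dependent_zero by (auto simp: fin_basis_iff)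
  ultimately show ?thesis using that[of B wt deg] B(2) by blast
qed

lemma fin_basis_induct [consumes 1, case_names zero add scale base]:
  assumes "fin_basis sc B" "P 0" "\<And>x y. P x \<Longrightarrow> P y \<Longrightarrow> P (x + y)" "\<And>a x. P x \<Longrightarrow> P (sc a x)"
    "\<And>u. u \<in> B \<Longrightarrow> P u"
  shows "P x"
proof -
  have "x \<in> span B" using assms(1) by (simp add: fin_basis_iff)
  moreover have "subspace {x. P x}" using assms by (auto simp: subspace_def)
  ultimately show ?thesis using span_minimal[of B "{x. P x}"] assms(5) by auto
qed

text \<open>Compare coordinates on the two sides of \<open>f x = a x\<close>. Through
  \<open>coord_wt\<close> and \<open>coord_deg\<close> this becomes the directness of the root and
  degree decompositions.\<close>

lemma coord_eigen:
  assumes B: "fin_basis sc B" and f: "lin f" and e: "\<And>u. u \<in> B \<Longrightarrow> f u = sc (c u) u"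
    and x: "f x = sc a x" and u: "u \<in> B" "coord sc B x u \<noteq> 0"
  shows "c u = a"
proof -
  have "f x = (\<Sum>u\<in>B. sc (coord sc B x u * c u) u)"
    unfolding fin_basis_expand[OF B f, of x] by (rule sum.cong) (simp_all add: e)
  from coord_unique[OF B this u(1)] have "coord sc B (f x) u = coord sc B x u * c u" .
  then show ?thesis using u by (simp add: x coord_scale[OF B u(1)])
qed

lemma coord_wt:
  assumes B: "fin_basis sc B" and w: "\<And>u. u \<in> B \<Longrightarrow> wt u \<in> weights G" "\<And>u. u \<in> B \<Longrightarrow> u \<in> rs (wt u)"
    and x: "x \<in> rs \<alpha>" "normal \<alpha>" and u: "u \<in> B" "coord sc B x u \<noteq> 0"
  shows "wt u = \<alpha>"
proof
  fix y
  show "wt u y = \<alpha> y"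
  proof (cases "y \<in> \<h>")
    case True
    show ?thesis
      by (rule coord_eigen[OF B lin_ad[of y] _ _ u, where c = "\<lambda>u. wt u y"])
         (use True w x in \<open>auto simp: rootsp_def\<close>)
  next
    case False
    then show ?thesis using weights_normal[OF w(1)[OF u(1)]] x(2) by (simp add: normal_def)
  qed
qed

lemma coord_deg:
  assumes B: "fin_basis sc B" and w: "\<And>u. u \<in> B \<Longrightarrow> u \<in> dg (deg u)"
    and x: "x \<in> dg l" and u: "u \<in> B" "coord sc B x u \<noteq> 0"
  shows "dcong (deg u) l"
  unfolding dcong_def
proof safe
  fix i assume i: "i < n"
  have "zeta (mord G i) powi deg u i = zeta (mord G i) powi l i"
    by (rule coord_eigen[OF B sig_lin[OF i] _ _ u, where c = "\<lambda>u. zeta (mord G i) powi deg u i"])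
       (use i w x in \<open>auto simp: gl_def\<close>)
  then show "int (mord G i) dvd deg u i - l i" using zeta_powi_eq[OF mord_pos[OF i]] by simp
qed

text \<open>The operator \<open>ad y\<close> is both nilpotent on \<open>\<h>\<close> and diagonalizable.\<close>

lemma h_abelian:
  assumes x: "x \<in> \<h>" and y: "y \<in> \<h>"
  shows "br y x = 0"
proof -
  obtain B wt deg where B: "fin_basis sc B"
    "\<And>u. u \<in> B \<Longrightarrow> wt u \<in> weights G" "\<And>u. u \<in> B \<Longrightarrow> u \<in> rs (wt u)"
    using homogeneous_basis by metis
  have e: "br y u = sc (wt u y) u" if "u \<in> B" for u using B(3)[OF that] y by (simp add: rootsp_def)
  have pow: "(br y ^^ k) x = (\<Sum>u\<in>B. sc (coord sc B x u * wt u y ^ k) u)" for k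
  proof (induction k)
    case 0
    then show ?case by (simp add: coord_sum[OF B(1)])
  next
    case (Suc k)
    then show ?case
      by (simp add: b_sum_right b_scale_right e mult.commute mult.left_commute cong: sum.cong)
  qed
  have mem: "(br y ^^ k) x \<in> lcs sc br \<h> k" for k
  proof (induction k)
    case (Suc k)
    then show ?case using y by (auto simp: lspan_eq_span intro!: span_base)
  qed (use x in simp)
  obtain k where "lcs sc br \<h> k = {0}" using h_nilp by blast
  then have "(br y ^^ k) x = 0" using mem[of k] by simp
  then have "coord sc B x u * wt u y ^ k = 0" if "u \<in> B" for u
    using coord_unique[OF B(1) pow[of k, symmetric, THEN sym] that] coord_unique[OF B(1), of 0 "\<lambda>_. 0" u] that
    by simp
  \<comment> \<open>In a field \<open>c * w ^ k = 0\<close> forces \<open>c * w = 0\<close>, so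
    \<open>ad y\<close> already kills \<open>x\<close>.\<close>
  then have z: "coord sc B x u * wt u y = 0" if "u \<in> B" for u
    using that by fastforce
  have "br y x = (\<Sum>u\<in>B. sc (coord sc B x u * wt u y) u)" using pow[of 1] by simp
  also have "\<dots> = 0" by (rule sum.neutral) (simp add: z)
  finally show ?thesis .
qed

text \<open>A fixed vector commuting with the Cartan subalgebra normalises it, hence lies in it. The
  converse inclusion is \<open>h_abelian\<close>.\<close>

lemma h_eq: "rs 0 \<inter> dg 0 = \<h>"
proof safe
  fix x assume x: "x \<in> rs 0" "x \<in> dg 0"
  show "x \<in> \<h>"
  proof (rule h_self_norm[OF x(2)])
    fix y assume "y \<in> \<h>"
    then have "br x y = 0" using x(1) b_anti[of x y] by (simp add: rootsp_def)
    then show "br x y \<in> \<h>" using subsp_h by (simp add: subsp_def)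
  qed
qed (auto simp: rootsp_def h_abelian h_fixed)

text \<open>If the Cartan subalgebra were zero, every fixed vector would normalise it, and
  self-normalisation would make the fixed algebra zero.\<close>

lemma h_nonzero: "\<exists>y\<in>\<h>. y \<noteq> 0"
proof (rule ccontr)
  assume "\<not> ?thesis"
  then have h0: "\<h> = {0}" using subsp_h by (auto simp: subsp_def)
  have "gfix n zeta G \<subseteq> {0}"
  proof
    fix x assume "x \<in> gfix n zeta G"
    then have "x \<in> dg 0" by (simp add: gfix_def)
    then have "x \<in> \<h>" by (rule h_self_norm) (simp add: h0)
    then show "x \<in> {0}" using h0 by simp
  qed
  moreover have "0 \<in> gfix n zeta G" using subsp_dg[of 0] by (simp add: gfix_def subsp_def)
  ultimately show False using fixed by blast
qed

text \<open>The product rule on basis vectors \<open>u\<close>, \<open>v\<close> is trivial when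
  \<open>[u, v] = 0\<close>; otherwise the sum of their weights is again a weight, and additivity of
  \<open>F\<close> is exactly the rule.\<close>

lemma diag_derivation:
  assumes F: "\<And>\<alpha> \<beta>. \<alpha> \<in> Qh G \<Longrightarrow> \<beta> \<in> Qh G \<Longrightarrow> F (\<alpha> + \<beta>) = F \<alpha> + F \<beta>"
  obtains D where "lin D" "\<And>x y. D (br x y) = br (D x) y + br x (D y)"
    "\<And>\<alpha> x. \<alpha> \<in> weights G \<Longrightarrow> x \<in> rs \<alpha> \<Longrightarrow> D x = sc (F \<alpha>) x"
proof -
  obtain B wt deg where B: "fin_basis sc B"
    "\<And>u. u \<in> B \<Longrightarrow> wt u \<in> weights G" "\<And>u. u \<in> B \<Longrightarrow> u \<in> rs (wt u)"
    using homogeneous_basis by metis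
  obtain D where D: "lin D" "\<And>u. u \<in> B \<Longrightarrow> D u = sc (F (wt u)) u"
    using linear_extension[OF B(1) vs, of "\<lambda>u. sc (F (wt u)) u"] by blast
  have Drs: "D x = sc (F \<alpha>) x" if \<alpha>: "\<alpha> \<in> weights G" and x: "x \<in> rs \<alpha>" for \<alpha> x
  proof -
    have "D x = (\<Sum>u\<in>B. sc (coord sc B x u) (D u))" by (rule fin_basis_expand[OF B(1) D(1)])
    also have "\<dots> = (\<Sum>u\<in>B. sc (F \<alpha>) (sc (coord sc B x u) u))"
    proof (rule sum.cong[OF refl])
      fix u assume u: "u \<in> B"
      show "sc (coord sc B x u) (D u) = sc (F \<alpha>) (sc (coord sc B x u) u)"
        using coord_wt[OF B x weights_normal[OF \<alpha>] u] D(2)[OF u] by (cases "coord sc B x u = 0") auto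
    qed
    also have "\<dots> = sc (F \<alpha>) x" by (simp only: coord_sum[OF B(1)] flip: scale_sum_right)
    finally show ?thesis .
  qed
  have D0: "D 0 = 0" by (rule linear_on_zero[OF D(1)]) simp
  have base: "D (br u v) = br (D u) v + br u (D v)" if uv: "u \<in> B" "v \<in> B" for u v
  proof (cases "br u v = 0")
    case True
    then show ?thesis using uv D by (simp add: D0 b_scale_left b_scale_right)
  next
    case False
    have r: "br u v \<in> rs (wt u + wt v)" using rs_br B(3) uv by blast
    then have "wt u + wt v \<in> weights G"
      using normal_weight[OF _ r False] normal_add weights_normal B(2) uv by blast
    then have "D (br u v) = sc (F (wt u + wt v)) (br u v)" using Drs r by blast
    then show ?thesis
      using F[OF weights_Qh[OF B(2)[OF uv(1)]] weights_Qh[OF B(2)[OF uv(2)]]] D(2) uv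
      by (simp add: b_scale_left b_scale_right scale_left_distrib)
  qed
  have left: "D (br u y) = br (D u) y + br u (D y)" if u: "u \<in> B" for u y
    by (rule fin_basis_induct[OF B(1), where P = "\<lambda>y. D (br u y) = br (D u) y + br u (D y)"])
       (auto simp: D0 b_add_right b_scale_right linear_on_add[OF D(1)] linear_on_scale[OF D(1)]
         scale_right_distrib base[OF u] algebra_simps)
  have "D (br x y) = br (D x) y + br x (D y)" for x y
    by (rule fin_basis_induct[OF B(1), where P = "\<lambda>x. D (br x y) = br (D x) y + br x (D y)"])
       (auto simp: D0 b_add_left b_scale_left linear_on_add[OF D(1)] linear_on_scale[OF D(1)]
         scale_right_distrib left algebra_simps)
  then show ?thesis using that D(1) Drs by blast
qed

text \<open>If the Killing form vanished, then \<open>tr (D ad x) = 0\<close> for every derivation \<open>D\<close>. Take for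
  \<open>D\<close> the operator acting on the root space of \<open>\<alpha>\<close> by \<open>f \<alpha>\<close>, with \<open>f\<close> additive and rational-valued:
  this forces \<open>\<Sum> f(\<alpha>)^2 dim = 0\<close>, although \<open>f\<close> can be chosen nonzero at any given root.\<close>

lemma kap_nonzero: "\<exists>x y. kap x y \<noteq> 0"
proof (rule ccontr)
  assume "\<not> ?thesis"
  then have k0: "kap x y = 0" for x y by blast
  obtain B wt deg where B: "fin_basis sc B"
    "\<And>u. u \<in> B \<Longrightarrow> wt u \<in> weights G" "\<And>u. u \<in> B \<Longrightarrow> u \<in> rs (wt u)" "\<And>u. u \<in> B \<Longrightarrow> u \<noteq> 0"
    using homogeneous_basis by metis
  have fB: "finite B" using B(1) by (simp add: fin_basis_def)
  \<comment> \<open>Otherwise the nonzero Cartan subalgebra would be central.\<close>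
  have "\<exists>u\<in>B. wt u \<noteq> 0"
  proof (rule ccontr)
    assume *: "\<not> ?thesis"
    obtain y where y: "y \<in> \<h>" "y \<noteq> 0" using h_nonzero by blast
    have "br y x = 0" for x
      by (rule fin_basis_induct[OF B(1), where P = "\<lambda>x. br y x = 0"]) (use * y B(3) in \<open>auto simp: b_add_right b_scale_right rootsp_def\<close>)
    then show False using center_zero y by blast
  qed
  then obtain u0 where u0: "u0 \<in> B" "wt u0 \<noteq> 0" by blast
  obtain f :: "('a \<Rightarrow> 'k) \<Rightarrow> rat" where f: "\<And>x y. f (x + y) = f x + f y"
    "\<And>q x. f (\<lambda>y. of_rat q * x y) = q * f x" "f (wt u0) = 1"
    using ex_rational_functional[OF u0(2)] by metis
  obtain D where D: "lin D" "\<And>x y. D (br x y) = br (D x) y + br x (D y)"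
    "\<And>\<alpha> x. \<alpha> \<in> weights G \<Longrightarrow> x \<in> rs \<alpha> \<Longrightarrow> D x = sc (of_rat (f \<alpha>)) x"
    using diag_derivation[of "\<lambda>\<alpha>. of_rat (f \<alpha>)"] by (auto simp: f of_rat_add)
  have tr0: "ltrace sc (\<lambda>v. D (br x v)) = 0" for x
  proof -
    let ?P = "{x. ltrace sc (\<lambda>v. D (br x v)) = 0}"
    have "subspace ?P"
      unfolding subsp_iff_subspace[symmetric] subsp_def
      using ltrace_add[OF lin_comp[OF D(1) lin_ad] lin_comp[OF D(1) lin_ad]]
        ltrace_scale[OF lin_comp[OF D(1) lin_ad]] ltrace_scale[OF lin_comp[OF D(1) lin_ad], of 0]
      by (auto simp: b_add_left b_scale_left linear_on_add[OF D(1)] linear_on_scale[OF D(1)] linear_on_zero[OF D(1)])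
    moreover have "{br x y |x y. True} \<subseteq> ?P" using ltrace_deriv[OF D(1,2)] k0 by auto
    ultimately show ?thesis using span_minimal[of _ ?P] perfect by blast
  qed
  \<comment> \<open>On the Cartan subalgebra this functional is
    \<open>y \<mapsto> tr (D ad y)\<close>; applying \<open>f\<close> to it produces the sum of
    squares.\<close>
  have "(\<Sum>u\<in>B. (\<lambda>y. of_rat (f (wt u)) * wt u y)) = 0"
  proof
    fix y
    have "(\<Sum>u\<in>B. of_rat (f (wt u)) * wt u y) = 0"
    proof (cases "y \<in> \<h>")
      case True
      have "ltrace sc (\<lambda>v. D (br y v)) = (\<Sum>u\<in>B. of_rat (f (wt u)) * wt u y)"
        by (rule ltrace_eigenbasis[OF B(1) lin_comp[OF D(1) lin_ad]])
           (use B(3) D(3)[OF B(2) B(3)] True in \<open>auto simp: rootsp_def linear_on_scale[OF D(1)] mult.commute\<close>)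
      then show ?thesis using tr0 by simp
    next
      case False
      then show ?thesis using weights_normal[OF B(2)] by (simp add: normal_def cong: sum.cong)
    qed
    then show "(\<Sum>u\<in>B. (\<lambda>y. of_rat (f (wt u)) * wt u y)) y = 0 y"
      by (simp add: sum_apply)
  qed
  note eq0 = this
  have f0: "f 0 = 0" using f(1)[of 0 0] by simp
  have f_sum: "f (sum g A) = (\<Sum>u\<in>A. f (g u))" for g :: "'a \<Rightarrow> 'a \<Rightarrow> 'k" and A
    by (induction A rule: infinite_finite_induct)
       (simp_all only: f(1) f0 sum.infinite sum.empty sum.insert not_False_eq_True)
  have "(\<Sum>u\<in>B. f (wt u) * f (wt u)) = f (\<Sum>u\<in>B. (\<lambda>y. of_rat (f (wt u)) * wt u y))"
    by (simp only: f_sum f(2))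
  also have "\<dots> = 0" by (simp only: eq0 f0)
  finally have "(\<Sum>u\<in>B. f (wt u) * f (wt u)) = 0" .
  then have "f (wt u0) * f (wt u0) = 0"
    using sum_nonneg_eq_0_iff[OF fB, of "\<lambda>u. f (wt u) * f (wt u)"] u0(1) by auto
  then show False using f(3) by simp
qed

lemma kap_rs_orth:
  assumes x: "x \<in> rs \<alpha>" and y: "y \<in> rs \<beta>" and n: "normal \<alpha>" "normal \<beta>" and k: "kap x y \<noteq> 0"
  shows "\<alpha> + \<beta> = 0"
proof
  fix z
  show "(\<alpha> + \<beta>) z = 0 z"
  proof (cases "z \<in> \<h>")
    case True
    have "kap (br z x) y = - kap (br x z) y"
      using b_anti[of z x] linear_on_minus[OF kap_linear_left vs, of "br x z" y]
      by (simp add: vector_space_def algebra_simps)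
    then have "kap (br z x) y + kap x (br z y) = 0" using kap_invariant[of x z y] by simp
    then have "\<alpha> z * kap x y + \<beta> z * kap x y = 0"
      using True x y by (simp add: rootsp_def linear_on_scale[OF kap_linear_left] linear_on_scale[OF kap_linear_right])
    then show ?thesis using k by (simp flip: distrib_right)
  next
    case False
    then show ?thesis using n by (simp add: normal_def)
  qed
qed

text \<open>Applying the \<open>i\<close>-th automorphism to both arguments multiplies the value by
  the root of unity to the power \<open>l i + m i\<close>.\<close>

lemma kap_dg_orth:
  assumes x: "x \<in> dg l" and y: "y \<in> dg m" and k: "kap x y \<noteq> 0"
  shows "dcong m (- l)"
  unfolding dcong_def
proof safe
  fix i assume i: "i < n"
  have "kap x y = zeta (mord G i) powi l i * zeta (mord G i) powi m i * kap x y"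
    using kap_automorphism[OF sig_aut[OF i], of x y] x y i
    by (simp add: gl_def linear_on_scale[OF kap_linear_left] linear_on_scale[OF kap_linear_right] mult.commute)
  then have "zeta (mord G i) powi (l i + m i) = 1"
    using k zeta_nz[OF mord_pos[OF i]] by (simp add: power_int_add mult.commute)
  then show "int (mord G i) dvd m i - (- l) i"
    using zeta_powi_1[OF mord_pos[OF i]] by (simp add: add.commute)
qed

text \<open>The diagonal derivation given by \<open>F\<close> is \<open>ad t\<close> for some
  \<open>t\<close>. It commutes with the automorphisms, which preserve root spaces, and the centre
  is zero, so \<open>t\<close> is fixed. It kills the Cartan subalgebra, which has root zero, so
  self-normalisation puts \<open>t\<close> into it.\<close>

lemma toral_element:
  assumes F: "\<And>\<alpha> \<beta>. \<alpha> \<in> Qh G \<Longrightarrow> \<beta> \<in> Qh G \<Longrightarrow> F (\<alpha> + \<beta>) = F \<alpha> + F \<beta>"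
  obtains t where "t \<in> \<h>" "\<And>\<alpha>. \<alpha> \<in> weights G \<Longrightarrow> \<alpha> t = F \<alpha>"
proof -
  obtain D where D: "lin D" "\<And>x y. D (br x y) = br (D x) y + br x (D y)"
    "\<And>\<alpha> x. \<alpha> \<in> weights G \<Longrightarrow> x \<in> rs \<alpha> \<Longrightarrow> D x = sc (F \<alpha>) x"
    using diag_derivation[of F] F by blast
  obtain t where t: "\<And>x. D x = br t x"
    using derivation_inner[OF kap_nonzero D(1,2)] by blast
  obtain B wt deg where B: "fin_basis sc B"
    "\<And>u. u \<in> B \<Longrightarrow> wt u \<in> weights G" "\<And>u. u \<in> B \<Longrightarrow> u \<in> rs (wt u)"
    using homogeneous_basis by metis
  have "0 \<in> Qh G" unfolding Qh_def by (rule gen_zero)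
  then have F0: "F 0 = 0" using F[of 0 0] by simp
  have th: "br t y = 0" if y: "y \<in> \<h>" for y
  proof (cases "y = 0")
    case False
    have "y \<in> rs 0" using h_eq y by blast
    then show ?thesis using D(3)[OF normal_weight[OF _ _ False], of 0] t F0 by simp
  qed simp
  have "t \<in> dg 0"
    unfolding gl_def
  proof (safe)
    fix i assume i: "i < n"
    have "br (msig G i t) x = br t x" for x
    proof -
      have "surj (msig G i)" using sig_aut[OF i] by (simp add: lie_aut_def bij_is_surj)
      then obtain y where x: "x = msig G i y" by (metis surj_def)
      have "D (msig G i y) = msig G i (D y)" for y
      proof (rule fin_basis_induct[OF B(1), where P = "\<lambda>y. D (msig G i y) = msig G i (D y)"])
        show "D (msig G i u) = msig G i (D u)" if "u \<in> B" for u
          using D(3)[OF B(2)[OF that] B(3)[OF that]] D(3)[OF B(2)[OF that] sig_rs[OF i B(3)[OF that]]]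
          by (simp add: linear_on_scale[OF sig_lin[OF i]])
      qed (simp_all add: linear_on_zero[OF D(1)] linear_on_zero[OF sig_lin[OF i]] linear_on_add[OF D(1)]
          linear_on_add[OF sig_lin[OF i]] linear_on_scale[OF D(1)] linear_on_scale[OF sig_lin[OF i]])
      from this[of y] show ?thesis using sig_br[OF i, of t y] by (simp add: t x)
    qed
    then have "br (msig G i t - t) x = 0" for x by (simp add: b_diff_left)
    then have "msig G i t - t = 0" by (rule center_zero)
    then show "msig G i t = sc (zeta (mord G i) powi 0 i) t" by simp
  qed
  then have "t \<in> \<h>" by (rule h_self_norm) (use th subsp_h in \<open>simp add: subsp_def\<close>)
  moreover have "\<alpha> t = F \<alpha>" if \<alpha>: "\<alpha> \<in> weights G" for \<alpha>
  proof -
    have "rs \<alpha> \<noteq> {0}" using \<alpha> by (simp add: weights_def)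
    then obtain x where x: "x \<in> rs \<alpha>" "x \<noteq> 0" using subsp_0[OF subsp_rs] by blast
    then have "sc (\<alpha> t) x = sc (F \<alpha>) x"
      using D(3)[OF \<alpha> x(1)] \<open>t \<in> \<h>\<close> by (simp add: t rootsp_def)
    then show ?thesis using x(2) by simp
  qed
  ultimately show ?thesis using that by blast
qed

end

section \<open>The multiloop algebra\<close>

text \<open>The monomial \<open>x \<otimes> t^l\<close> of the loop algebra.\<close>

definition sing :: "(nat \<Rightarrow> int) \<Rightarrow> 'a::zero \<Rightarrow> 'a lp" where
  "sing l x = (\<lambda>\<nu>. if \<nu> = l then x else 0)"

lemma sing_apply: "sing l x \<nu> = (if \<nu> = l then x else 0)"
  by (simp add: sing_def)

text \<open>As default simp rules these would take apart every eta-expanded function.\<close>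

lemmas fun_apply = plus_fun_apply zero_fun_apply minus_apply uminus_apply sing_apply

declare fun_apply [simp del]

lemma sing_same [simp]: "sing l x l = x"
  by (simp add: fun_apply)

lemma sing_0 [simp]: "sing l 0 = 0"
  by (rule ext) (simp add: fun_apply)

lemma sing_add: "sing l (x + y) = sing l x + sing l (y :: 'a::monoid_add)"
  by (rule ext) (simp add: fun_apply)

lemma sing_minus: "sing l (- x) = - sing l (x :: 'a::group_add)"
  by (rule ext) (simp add: fun_apply)

lemma finite_sing [simp]: "finite {\<nu>. sing l x \<nu> \<noteq> 0}"
  by (rule finite_subset[of _ "{l}"]) (auto simp: fun_apply)

lemma sum_sing: "(\<Sum>l\<in>{l. f l \<noteq> 0}. sing l (f l)) = f"
  if "finite {l. f l \<noteq> 0}" for f :: "'a::comm_monoid_add lp"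
  using that by (intro ext) (simp add: sum_apply fun_apply)

lemma Zn_add: "l \<in> Zn n \<Longrightarrow> m \<in> Zn n \<Longrightarrow> l + m \<in> Zn n"
  and Zn_diff: "l \<in> Zn n \<Longrightarrow> m \<in> Zn n \<Longrightarrow> l - m \<in> Zn n"
  and Zn_uminus: "l \<in> Zn n \<Longrightarrow> - l \<in> Zn n"
  and Zn_0 [simp]: "0 \<in> Zn n"
  by (auto simp: Zn_def fun_apply)

lemma Th_add: "\<theta> \<in> Th n \<Longrightarrow> \<theta> (l + m) = \<theta> l + \<theta> m"
  and Th_at_0: "\<theta> \<in> Th n \<Longrightarrow> \<theta> 0 = 0"
  by (auto simp: Th_def fun_apply algebra_simps sum.distrib)

lemma Th_0 [simp]: "0 \<in> Th n"
  unfolding Th_def by (auto simp: fun_apply intro!: exI[of _ "\<lambda>_. 0"])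

lemma Th_lincomb:
  assumes "\<theta> \<in> Th n" "\<eta> \<in> Th n"
  shows "(\<lambda>l. a * \<theta> l + b * \<eta> l) \<in> Th n"
proof -
  obtain f g where "\<forall>l. \<theta> l = (\<Sum>i<n. f i * of_int (l i))" "\<forall>l. \<eta> l = (\<Sum>i<n. g i * of_int (l i))"
    using assms unfolding Th_def by blast
  then have "\<forall>l. a * \<theta> l + b * \<eta> l = (\<Sum>i<n. (a * f i + b * g i) * of_int (l i))"
    by (simp add: algebra_simps sum.distrib sum_distrib_left)
  then show ?thesis
    unfolding Th_def by (intro CollectI exI[of _ "\<lambda>i. a * f i + b * g i"])
qed

lemma Th_plus: "\<theta> \<in> Th n \<Longrightarrow> \<eta> \<in> Th n \<Longrightarrow> \<theta> + \<eta> \<in> Th n"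
  using Th_lincomb[of \<theta> n \<eta> 1 1] by (simp add: plus_fun_def)


section \<open>Monomials, bracket and form of the multiloop algebra\<close>

context multiloop
begin

abbreviation L where "L \<equiv> Lcar n zeta G"
abbreviation lbr where "lbr \<equiv> Lbr G"
abbreviation lsc where "lsc \<equiv> Lsc G"
abbreviation form where "form \<equiv> Lform G"

text \<open>The degrees congruent to zero, that is, the periods of \<open>dg\<close>; by
  \<open>Gam_eq\<close> they are the support of the centroid.\<close>

definition Mlat :: "(nat \<Rightarrow> int) set" where
  "Mlat = {\<mu> \<in> Zn n. \<forall>i<n. int (mord G i) dvd \<mu> i}"

lemma Mlat_Zn: "\<mu> \<in> Mlat \<Longrightarrow> \<mu> \<in> Zn n" by (simp add: Mlat_def)
lemma Mlat_0 [simp]: "0 \<in> Mlat" by (simp add: Mlat_def fun_apply)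
lemma Mlat_add: "\<mu> \<in> Mlat \<Longrightarrow> \<nu> \<in> Mlat \<Longrightarrow> \<mu> + \<nu> \<in> Mlat" by (auto simp: Mlat_def fun_apply intro: Zn_add)
lemma Mlat_uminus: "\<mu> \<in> Mlat \<Longrightarrow> - \<mu> \<in> Mlat" by (auto simp: Mlat_def fun_apply intro: Zn_uminus)
lemma Mlat_diff: "\<mu> \<in> Mlat \<Longrightarrow> \<nu> \<in> Mlat \<Longrightarrow> \<mu> - \<nu> \<in> Mlat" by (auto simp: Mlat_def fun_apply intro: Zn_diff)

lemma dcong_Mlat: "dcong l m \<Longrightarrow> l \<in> Zn n \<Longrightarrow> m \<in> Zn n \<Longrightarrow> l - m \<in> Mlat"
  by (auto simp: dcong_def Mlat_def fun_apply Zn_diff)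

lemma Mlat_dcong: "l - m \<in> Mlat \<Longrightarrow> dcong l m"
  by (auto simp: dcong_def Mlat_def fun_apply)

lemma dg_Mlat_add: "\<mu> \<in> Mlat \<Longrightarrow> dg (l + \<mu>) = dg l"
  by (rule dg_cong) (simp add: Mlat_dcong)

lemma dg_Mlat: "\<mu> \<in> Mlat \<Longrightarrow> dg \<mu> = dg 0"
  using dg_Mlat_add[of \<mu> 0] by simp

text \<open>Coordinates are absorbed into the basis vectors, so that \<open>x\<close> is the sum of
  a plain finite set. Distinct basis vectors with nonzero coordinates keep distinct multiples by
  independence; \<open>r\<close> undoes the scaling.\<close>

lemma weight_expansion:
  assumes "x \<in> dg l"
  obtains B wt deg where "finite B"
    "\<And>u. u \<in> B \<Longrightarrow> wt u \<in> weights G" "\<And>u. u \<in> B \<Longrightarrow> deg u \<in> Zn n"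
    "\<And>u. u \<in> B \<Longrightarrow> u \<in> rs (wt u)" "\<And>u. u \<in> B \<Longrightarrow> u \<in> dg (deg u)"
    "\<And>u. u \<in> B \<Longrightarrow> dcong (deg u) l" "x = \<Sum>B"
proof -
  obtain B wt deg where B: "fin_basis sc B"
    "\<And>u. u \<in> B \<Longrightarrow> u \<noteq> 0" "\<And>u. u \<in> B \<Longrightarrow> wt u \<in> weights G" "\<And>u. u \<in> B \<Longrightarrow> deg u \<in> Zn n"
    "\<And>u. u \<in> B \<Longrightarrow> u \<in> rs (wt u)" "\<And>u. u \<in> B \<Longrightarrow> u \<in> dg (deg u)"
    using homogeneous_basis by metis
  let ?c = "coord sc B x"
  let ?B = "{u \<in> B. ?c u \<noteq> 0}"
  let ?g = "\<lambda>u. sc (?c u) u"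
  have fin: "finite B" using B(1) by (simp add: fin_basis_def)
  have inj: "inj_on ?g ?B"
  proof (rule inj_onI)
    fix u v assume u: "u \<in> ?B" and v: "v \<in> ?B" and e: "?g u = ?g v"
    have "coord sc B (?g u) u = coord sc B (?g v) u" by (simp add: e)
    then show "u = v"
      using u v by (auto simp: coord_scale[OF B(1)] coord_basis[OF B(1)] split: if_splits)
  qed
  define r where "r = inv_into ?B ?g"
  have r: "r (?g u) = u" if "u \<in> ?B" for u using inv_into_f_f[OF inj that] by (simp add: r_def)
  show ?thesis
  proof (rule that[of "?g ` ?B" "wt \<circ> r" "deg \<circ> r"])
    show "finite (?g ` ?B)" using fin by simp
    have "x = (\<Sum>u\<in>B. ?g u)" by (simp add: coord_sum[OF B(1)])
    also have "\<dots> = (\<Sum>u\<in>?B. ?g u)" by (rule sum.mono_neutral_right) (use fin in auto)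
    also have "\<dots> = \<Sum>(?g ` ?B)" by (simp add: sum.reindex[OF inj])
    finally show "x = \<Sum>(?g ` ?B)" .
  qed (auto simp: r B subsp_scale[OF subsp_rs] subsp_scale[OF subsp_dg] intro!: coord_deg[OF B(1) B(6) assms])
qed

lemma dg_in_span:
  assumes x: "x \<in> dg l"
  shows "x \<in> span (\<Union>\<alpha>\<in>Qh G. rs \<alpha> \<inter> dg l)"
proof -
  obtain B wt deg where B: "finite B"
    "\<And>u. u \<in> B \<Longrightarrow> wt u \<in> weights G" "\<And>u. u \<in> B \<Longrightarrow> deg u \<in> Zn n"
    "\<And>u. u \<in> B \<Longrightarrow> u \<in> rs (wt u)" "\<And>u. u \<in> B \<Longrightarrow> u \<in> dg (deg u)"
    "\<And>u. u \<in> B \<Longrightarrow> dcong (deg u) l" "x = \<Sum>B"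
    using weight_expansion[OF x] by metis
  have *: "u \<in> (\<Union>\<alpha>\<in>Qh G. rs \<alpha> \<inter> dg l)" if u: "u \<in> B" for u
    using weights_Qh[OF B(2)[OF u]] B(4)[OF u] B(5)[OF u] dg_cong[OF B(6)[OF u]] by auto
  show ?thesis unfolding B(7) by (rule span_sum) (rule span_base[OF *])
qed

text \<open>Every degree component is spanned by its root vectors, so membership can be tested on
  degrees.\<close>

lemma Lcar_iff: "f \<in> L \<longleftrightarrow> finite {l. f l \<noteq> 0} \<and> (\<forall>l. f l \<noteq> 0 \<longrightarrow> l \<in> Zn n \<and> f l \<in> dg l)"
proof -
  have "span (\<Union>\<alpha>\<in>Qh G. rs \<alpha> \<inter> dg l) \<subseteq> dg l" for l
    by (rule span_minimal) (use subsp_dg[of l] in \<open>auto simp: subsp_iff_subspace\<close>)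
  then show ?thesis unfolding Lcar_def lspan_eq_span using dg_in_span by blast
qed

lemma L_finite: "f \<in> L \<Longrightarrow> finite {l. f l \<noteq> 0}"
  and L_Zn: "f \<in> L \<Longrightarrow> f l \<noteq> 0 \<Longrightarrow> l \<in> Zn n"
  and L_dg: "f \<in> L \<Longrightarrow> f l \<in> dg l"
  using subsp_0[OF subsp_dg[of l]] by (auto simp: Lcar_iff) metis

lemma vs_lsc: "vector_space lsc"
  by unfold_locales (auto simp: Lsc_def fun_apply fun_eq_iff scale_right_distrib scale_left_distrib)

lemma lsc_apply: "lsc a f l = sc a (f l)" by (simp add: Lsc_def)

lemma subsp_L: "subsp lsc L"
  unfolding subsp_def
proof (intro conjI ballI allI)
  show "0 \<in> L" by (simp add: Lcar_iff fun_apply)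
  fix x y a assume x: "x \<in> L" and y: "y \<in> L"
  have "finite {l. (x + y) l \<noteq> 0}"
    by (rule finite_subset[of _ "{l. x l \<noteq> 0} \<union> {l. y l \<noteq> 0}"]) (use L_finite x y in \<open>auto simp: fun_apply\<close>)
  then show "x + y \<in> L" using x y subsp_add[OF subsp_dg] by (auto simp: Lcar_iff fun_apply) (metis add_0 add_0_right)+
next
  fix a x assume x: "x \<in> L"
  have "finite {l. lsc a x l \<noteq> 0}"
    by (rule finite_subset[OF _ L_finite[OF x]]) (auto simp: lsc_apply)
  then show "lsc a x \<in> L" using x subsp_scale[OF subsp_dg] by (auto simp: Lcar_iff lsc_apply)
qed

lemmas L_0 = subsp_0[OF subsp_L] and L_add = subsp_add[OF subsp_L] and L_scale = subsp_scale[OF subsp_L]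
  and L_diff = subsp_diff[OF vs_lsc subsp_L]

lemma sing_L: "l \<in> Zn n \<Longrightarrow> x \<in> dg l \<Longrightarrow> sing l x \<in> L"
  by (auto simp: Lcar_iff sing_apply split: if_splits)

lemma sing_scale: "sing l (sc a x) = lsc a (sing l x)"
  by (rule ext) (simp add: fun_apply lsc_apply)

lemma L_induct_deg [consumes 1, case_names zero add sing]:
  assumes f: "f \<in> L" and "P 0" "\<And>x y. x \<in> L \<Longrightarrow> y \<in> L \<Longrightarrow> P x \<Longrightarrow> P y \<Longrightarrow> P (x + y)"
    and "\<And>l x. l \<in> Zn n \<Longrightarrow> x \<in> dg l \<Longrightarrow> P (sing l x)"
  shows "P f"
proof -
  have "finite A \<Longrightarrow> A \<subseteq> {l. f l \<noteq> 0} \<Longrightarrow> (\<Sum>l\<in>A. sing l (f l)) \<in> L \<and> P (\<Sum>l\<in>A. sing l (f l))" for A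
  proof (induction A rule: finite_induct)
    case (insert a A)
    have "a \<in> Zn n" "f a \<in> dg a" using insert.prems L_Zn[OF f] L_dg[OF f] by auto
    then show ?case using insert assms sing_L L_add by simp
  qed (simp add: assms L_0)
  from this[of "{l. f l \<noteq> 0}"] show ?thesis using sum_sing[OF L_finite[OF f]] L_finite[OF f] by simp
qed

text \<open>Finer than \<open>L_induct_deg\<close>: a support-isomorphism is controlled on elements
  homogeneous in both root and degree.\<close>

lemma L_induct [consumes 1, case_names zero add sing]:
  assumes "f \<in> L" and P0: "P 0" and Padd: "\<And>x y. x \<in> L \<Longrightarrow> y \<in> L \<Longrightarrow> P x \<Longrightarrow> P y \<Longrightarrow> P (x + y)"
    and Ps: "\<And>\<alpha> l x. \<alpha> \<in> Qh G \<Longrightarrow> l \<in> Zn n \<Longrightarrow> x \<in> rs \<alpha> \<Longrightarrow> x \<in> dg l \<Longrightarrow> P (sing l x)"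
  shows "P f"
  using assms(1)
proof (induction rule: L_induct_deg)
  case (sing l x)
  obtain B wt deg where B: "finite B"
    "\<And>u. u \<in> B \<Longrightarrow> wt u \<in> weights G" "\<And>u. u \<in> B \<Longrightarrow> deg u \<in> Zn n"
    "\<And>u. u \<in> B \<Longrightarrow> u \<in> rs (wt u)" "\<And>u. u \<in> B \<Longrightarrow> u \<in> dg (deg u)"
    "\<And>u. u \<in> B \<Longrightarrow> dcong (deg u) l" "x = \<Sum>B"
    using weight_expansion[OF sing(2)] by metis
  have "finite A \<Longrightarrow> A \<subseteq> B \<Longrightarrow> sing l (\<Sum>A) \<in> L \<and> P (sing l (\<Sum>A))" for A
  proof (induction A rule: finite_induct)
    case (insert a A)
    then have u: "a \<in> B" by simp
    have a: "wt a \<in> Qh G" "a \<in> rs (wt a)" "a \<in> dg l"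
      using weights_Qh[OF B(2)[OF u]] B(4)[OF u] B(5)[OF u] dg_cong[OF B(6)[OF u]] by auto
    have "P (sing l a)" by (rule Ps[OF a(1) sing(1) a(2,3)])
    moreover have "sing l a \<in> L" by (rule sing_L[OF sing(1) a(3)])
    ultimately show ?case using insert L_add Padd by (simp add: sing_add)
  qed (simp add: assms L_0)
  then show ?case using B by blast
qed (use assms in auto)

lemma L_linear_eqI:
  assumes f: "linear_on lsc s' L f" and g: "linear_on lsc s' L g" and x: "x \<in> L"
    and e: "\<And>\<alpha> l x. \<alpha> \<in> Qh G \<Longrightarrow> l \<in> Zn n \<Longrightarrow> x \<in> rs \<alpha> \<Longrightarrow> x \<in> dg l \<Longrightarrow> f (sing l x) = g (sing l x)"
  shows "f x = g x"
  using x
  by (induction rule: L_induct)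
     (simp_all add: linear_on_zero[OF f subsp_L] linear_on_zero[OF g subsp_L] linear_on_add[OF f] linear_on_add[OF g] e)

text \<open>Any finite superset of the support of \<open>f\<close> may index the sum; a common
  superset makes additivity in the first argument a termwise statement.\<close>

lemma lbr_eq:
  assumes "finite A" "{l. f l \<noteq> 0} \<subseteq> A"
  shows "lbr f g \<nu> = (\<Sum>l\<in>A. br (f l) (g (\<nu> - l)))"
proof -
  let ?S = "{l. f l \<noteq> 0 \<and> g (\<nu> - l) \<noteq> 0}"
  have S: "{(l, \<mu>). f l \<noteq> 0 \<and> g \<mu> \<noteq> 0 \<and> l + \<mu> = \<nu>} = (\<lambda>l. (l, \<nu> - l)) ` ?S"
    by (auto simp: image_iff algebra_simps)
  have "lbr f g \<nu> = (\<Sum>l\<in>?S. br (f l) (g (\<nu> - l)))"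
    unfolding Lbr_def S by (subst sum.reindex) (auto intro: inj_onI)
  also have "\<dots> = (\<Sum>l\<in>A. br (f l) (g (\<nu> - l)))"
    by (rule sum.mono_neutral_left) (use assms in auto)
  finally show ?thesis .
qed

lemma lbr_sing: "lbr (sing l x) (sing m y) = sing (l + m) (br x y)"
proof
  fix \<nu>
  have "lbr (sing l x) (sing m y) \<nu> = (\<Sum>k\<in>{l}. br (sing l x k) (sing m y (\<nu> - k)))"
    by (rule lbr_eq) (auto simp: sing_apply)
  then show "lbr (sing l x) (sing m y) \<nu> = sing (l + m) (br x y) \<nu>"
    by (auto simp: sing_apply algebra_simps)
qed

lemma lbr_add_left: "f \<in> L \<Longrightarrow> g \<in> L \<Longrightarrow> lbr (f + g) k = lbr f k + lbr g k"
proof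
  fix \<nu> assume fg: "f \<in> L" "g \<in> L"
  let ?A = "{l. f l \<noteq> 0} \<union> {l. g l \<noteq> 0}"
  have fin: "finite ?A" using fg L_finite by simp
  have 1: "{l. (f + g) l \<noteq> 0} \<subseteq> ?A" "{l. f l \<noteq> 0} \<subseteq> ?A" "{l. g l \<noteq> 0} \<subseteq> ?A" by (auto simp: fun_apply)
  show "lbr (f + g) k \<nu> = (lbr f k + lbr g k) \<nu>"
    unfolding plus_fun_apply[of "lbr f k" "lbr g k"]
      lbr_eq[OF fin 1(1), of k \<nu>] lbr_eq[OF fin 1(2), of k \<nu>] lbr_eq[OF fin 1(3), of k \<nu>]
    by (simp add: fun_apply b_add_left sum.distrib)
qed

lemma lbr_add_right: "f \<in> L \<Longrightarrow> lbr f (g + k) = lbr f g + lbr f k"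
proof
  fix \<nu> assume "f \<in> L"
  note e = lbr_eq[OF L_finite[OF this] order_refl, of _ \<nu>]
  show "lbr f (g + k) \<nu> = (lbr f g + lbr f k) \<nu>"
    by (simp add: e fun_apply b_add_right sum.distrib)
qed

lemma lbr_scale_left: "f \<in> L \<Longrightarrow> lbr (lsc a f) k = lsc a (lbr f k)"
proof
  fix \<nu> assume f: "f \<in> L"
  have 1: "{l. lsc a f l \<noteq> 0} \<subseteq> {l. f l \<noteq> 0}" by (auto simp: lsc_apply)
  show "lbr (lsc a f) k \<nu> = lsc a (lbr f k) \<nu>"
    unfolding lsc_apply lbr_eq[OF L_finite[OF f] 1, of k \<nu>] lbr_eq[OF L_finite[OF f] order_refl, of k \<nu>]
    by (simp add: lsc_apply b_scale_left scale_sum_right)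
qed

lemma lbr_scale_right: "f \<in> L \<Longrightarrow> lbr f (lsc a k) = lsc a (lbr f k)"
proof
  fix \<nu> assume f: "f \<in> L"
  show "lbr f (lsc a k) \<nu> = lsc a (lbr f k) \<nu>"
    using lbr_eq[OF L_finite[OF f] order_refl, of _ \<nu>]
    by (simp add: lsc_apply b_scale_right scale_sum_right)
qed

lemma lbr_zero_left [simp]: "lbr 0 k = 0"
  by (rule ext) (simp add: Lbr_def fun_apply)

lemma lbr_zero_right [simp]: "lbr k 0 = 0"
  by (rule ext) (simp add: Lbr_def fun_apply)

lemma lbr_L: "f \<in> L \<Longrightarrow> g \<in> L \<Longrightarrow> lbr f g \<in> L"
proof (induction f rule: L_induct_deg)
  case (sing l x)
  from sing(3) show ?case
    by (induction g rule: L_induct_deg)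
       (auto simp: L_0 L_add lbr_add_right sing_L[OF sing(1,2)] lbr_sing sing(1,2) intro!: sing_L Zn_add dg_br)
qed (auto simp: L_0 L_add lbr_add_left)

lemma lbr_linear_right: "f \<in> L \<Longrightarrow> linear_on lsc lsc L (lbr f)"
  and lbr_linear_left: "linear_on lsc lsc L (\<lambda>f. lbr f g)"
  by (auto intro!: linear_onI simp: lbr_add_left lbr_add_right lbr_scale_left lbr_scale_right)

lemmas lbr_diff_right = linear_on_diff[OF lbr_linear_right vs_lsc vs_lsc subsp_L]
  and lbr_diff_left = linear_on_diff[OF lbr_linear_left vs_lsc vs_lsc subsp_L]
  and lbr_minus_left = linear_on_minus[OF lbr_linear_left vs_lsc vs_lsc]

lemma lbr_anti: "f \<in> L \<Longrightarrow> g \<in> L \<Longrightarrow> lbr g f = - lbr f g"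
proof (induction f rule: L_induct_deg)
  case (sing l x)
  note s = sing_L[OF sing(1,2)]
  from sing(3) show ?case
  proof (induction g rule: L_induct_deg)
    case (sing m y)
    show ?case by (simp add: lbr_sing b_anti[of y x] sing_minus add.commute)
  qed (simp_all add: lbr_add_right lbr_add_left s)
qed (simp_all add: lbr_add_right lbr_add_left)

lemma lbr_jacobi:
  "f \<in> L \<Longrightarrow> g \<in> L \<Longrightarrow> k \<in> L \<Longrightarrow> lbr f (lbr g k) = lbr (lbr f g) k + lbr g (lbr f k)"
proof (induction f rule: L_induct_deg)
  case (sing l x)
  note s = sing_L[OF sing(1,2)]
  from sing(3,4) show ?case
  proof (induction g rule: L_induct_deg)
    case (sing m y)
    note t = sing_L[OF sing(1,2)]
    from sing(3) show ?case
    proof (induction k rule: L_induct_deg)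
      case (sing q z)
      show ?case by (simp add: lbr_sing jacobi[of x y z] sing_add algebra_simps)
    qed (simp_all add: lbr_add_right lbr_add_left lbr_L s t)
  qed (simp_all add: lbr_add_right lbr_add_left lbr_L s)
qed (simp_all add: lbr_add_right lbr_add_left lbr_L)

text \<open>The coefficient of \<open>[f, u t^(deg u)]\<close> at \<open>l + deg u\<close> is
  \<open>[f l, u]\<close>, so each coefficient of \<open>f\<close> is central in the simple
  algebra.\<close>

lemma L_center:
  assumes f: "f \<in> L" and z: "\<And>g. g \<in> L \<Longrightarrow> lbr f g = 0"
  shows "f = 0"
proof
  fix l
  obtain B wt deg where B: "fin_basis sc B" "\<And>u. u \<in> B \<Longrightarrow> deg u \<in> Zn n" "\<And>u. u \<in> B \<Longrightarrow> u \<in> dg (deg u)"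
    using homogeneous_basis by metis
  have "br (f l) x = 0" for x
  proof (rule fin_basis_induct[OF B(1), where P = "\<lambda>x. br (f l) x = 0"])
    fix u assume u: "u \<in> B"
    have "lbr f (sing (deg u) u) (l + deg u) = (\<Sum>k\<in>insert l {k. f k \<noteq> 0}. br (f k) (sing (deg u) u (l + deg u - k)))"
      by (rule lbr_eq) (use L_finite[OF f] in auto)
    also have "\<dots> = (\<Sum>k\<in>insert l {k. f k \<noteq> 0}. if k = l then br (f l) u else 0)"
      by (rule sum.cong) (auto simp: sing_apply algebra_simps)
    also have "\<dots> = br (f l) u" using L_finite[OF f] by simp
    finally show "br (f l) u = 0" using z[OF sing_L[OF B(2,3)]] u by (simp add: fun_apply)
  qed (auto simp: b_add_right b_scale_right)
  then show "f l = 0 l" using center_zero by (simp add: fun_apply)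
qed

lemma form_eq:
  assumes "finite A" "{l. f l \<noteq> 0} \<subseteq> A"
  shows "form f g = (\<Sum>l\<in>A. kap (f l) (g (- l)))"
  unfolding Lform_def
  by (rule sum.mono_neutral_left) (use assms in \<open>auto simp: linear_on_zero[OF kap_linear_left]\<close>)

lemma form_add_left: "f \<in> L \<Longrightarrow> g \<in> L \<Longrightarrow> form (f + g) k = form f k + form g k"
proof -
  assume fg: "f \<in> L" "g \<in> L"
  let ?A = "{l. f l \<noteq> 0} \<union> {l. g l \<noteq> 0}"
  have fin: "finite ?A" using fg L_finite by simp
  have 1: "{l. (f + g) l \<noteq> 0} \<subseteq> ?A" "{l. f l \<noteq> 0} \<subseteq> ?A" "{l. g l \<noteq> 0} \<subseteq> ?A" by (auto simp: fun_apply)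
  show "form (f + g) k = form f k + form g k"
    unfolding form_eq[OF fin 1(1), of k] form_eq[OF fin 1(2), of k] form_eq[OF fin 1(3), of k]
    by (simp add: fun_apply linear_on_add[OF kap_linear_left] sum.distrib)
qed

lemma form_add_right: "form f (g + k) = form f g + form f k"
  by (simp add: fun_apply Lform_def linear_on_add[OF kap_linear_right] sum.distrib)

lemma form_scale_right: "form f (lsc a g) = a * form f g"
  by (simp add: Lform_def lsc_apply linear_on_scale[OF kap_linear_right] sum_distrib_left)

lemma form_zero_left [simp]: "form 0 g = 0"
  and form_zero_right [simp]: "form g 0 = 0"
  by (simp_all add: fun_apply Lform_def linear_on_zero[OF kap_linear_right])

lemma form_sing: "form (sing l x) (sing m y) = (if l + m = 0 then kap x y else 0)"
proof -
  have "form (sing l x) (sing m y) = (\<Sum>k\<in>{l}. kap (sing l x k) (sing m y (- k)))"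
    by (rule form_eq) (auto simp: sing_apply)
  moreover have "- l = m \<longleftrightarrow> l + m = 0" by (metis neg_eq_iff_add_eq_0)
  ultimately show ?thesis by (simp add: sing_apply linear_on_zero[OF kap_linear_right])
qed

lemma form_sym: "f \<in> L \<Longrightarrow> g \<in> L \<Longrightarrow> form f g = form g f"
proof (induction f rule: L_induct_deg)
  case (sing l x)
  note s = sing_L[OF sing(1,2)]
  from sing(3) show ?case
    by (induction g rule: L_induct_deg)
       (auto simp: form_add_right form_add_left s form_sing kap_sym add.commute)
qed (simp_all add: form_add_right form_add_left)

lemma form_scale_left: "f \<in> L \<Longrightarrow> g \<in> L \<Longrightarrow> form (lsc a f) g = a * form f g"
  using form_sym[of f g] form_sym[of "lsc a f" g] by (simp add: L_scale form_scale_right)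

lemma form_linear_right: "linear_on lsc (*) L (form f)"
  and form_linear_left: "g \<in> L \<Longrightarrow> linear_on lsc (*) L (\<lambda>f. form f g)"
  by (auto intro!: linear_onI simp: form_add_left form_add_right form_scale_left form_scale_right)

lemma vs_mult: "vector_space ((*) :: 'k \<Rightarrow> 'k \<Rightarrow> 'k)"
  by unfold_locales (auto simp: algebra_simps)

lemmas form_diff_right = linear_on_diff[OF form_linear_right vs_lsc vs_mult subsp_L]
  and form_diff_left = linear_on_diff[OF form_linear_left vs_lsc vs_mult subsp_L]
  and form_minus_left = linear_on_minus[OF form_linear_left vs_lsc vs_mult]

lemma form_invariant: "f \<in> L \<Longrightarrow> g \<in> L \<Longrightarrow> k \<in> L \<Longrightarrow> form (lbr f g) k = form f (lbr g k)"
proof (induction f rule: L_induct_deg)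
  case (sing l x)
  note s = sing_L[OF sing(1,2)]
  from sing(3,4) show ?case
  proof (induction g rule: L_induct_deg)
    case (sing m y)
    note t = sing_L[OF sing(1,2)]
    from sing(3) show ?case
      by (induction k rule: L_induct_deg)
         (simp_all add: lbr_sing form_sing kap_invariant add.assoc form_add_right lbr_add_right s t)
  qed (simp_all add: lbr_add_right lbr_add_left lbr_L form_add_right form_add_left s)
qed (simp_all add: lbr_add_left lbr_L form_add_left)

subsection \<open>Centroid and skew centroidal derivations\<close>

lemma dcong_sym: "dcong l m \<Longrightarrow> dcong m l"
  by (simp add: dcong_def dvd_diff_commute)

lemma dcong_trans:
  assumes "dcong l m" "dcong m k"
  shows "dcong l k"
  unfolding dcong_def
proof safe
  fix i assume "i < n"
  then have "int (mord G i) dvd (l i - m i) + (m i - k i)"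
    using assms unfolding dcong_def by (intro dvd_add) auto
  then show "int (mord G i) dvd l i - k i" by simp
qed

text \<open>The simple algebra is perfect, so \<open>x\<close> is a combination of brackets. The
  projection \<open>p\<close> onto the component of degree \<open>l\<close> keeps, among brackets of
  homogeneous basis vectors, just those whose degrees add up to the class of
  \<open>l\<close>.\<close>

lemma graded_perfect:
  assumes x: "x \<in> dg l" and l: "l \<in> Zn n"
  shows "x \<in> span {br y z | y z k. k \<in> Zn n \<and> y \<in> dg k \<and> z \<in> dg (l - k)}"
proof -
  define T where "T = {br y z | y z k. k \<in> Zn n \<and> y \<in> dg k \<and> z \<in> dg (l - k)}"
  obtain B wt deg where B: "fin_basis sc B" "\<And>u. u \<in> B \<Longrightarrow> deg u \<in> Zn n" "\<And>u. u \<in> B \<Longrightarrow> u \<in> dg (deg u)"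
    using homogeneous_basis by metis
  obtain p where p: "lin p" "\<And>u. u \<in> B \<Longrightarrow> p u = (if dcong (deg u) l then u else 0)"
    using linear_extension[OF B(1) vs, of "\<lambda>u. if dcong (deg u) l then u else 0"] by blast
  have p0: "p 0 = 0" by (rule linear_on_zero[OF p(1)]) simp
  have p_dg: "p y = (if dcong m l then y else 0)" if y: "y \<in> dg m" for y m
  proof -
    have "p y = (\<Sum>u\<in>B. sc (coord sc B y u) (p u))" by (rule fin_basis_expand[OF B(1) p(1)])
    also have "\<dots> = (\<Sum>u\<in>B. if dcong m l then sc (coord sc B y u) u else 0)"
    proof (rule sum.cong[OF refl])
      fix u assume u: "u \<in> B"
      have "dcong (deg u) l \<longleftrightarrow> dcong m l" if "coord sc B y u \<noteq> 0"
      proof -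
        have "dcong (deg u) m" by (rule coord_deg[OF B(1) B(3) y u that])
        then show ?thesis using dcong_trans dcong_sym by blast
      qed
      then show "sc (coord sc B y u) (p u) = (if dcong m l then sc (coord sc B y u) u else 0)"
        using p(2)[OF u] by (cases "coord sc B y u = 0") auto
    qed
    also have "\<dots> = (if dcong m l then y else 0)" by (simp add: coord_sum[OF B(1)])
    finally show ?thesis .
  qed
  have base: "p (br u v) \<in> span T" if uv: "u \<in> B" "v \<in> B" for u v
  proof (cases "dcong (deg u + deg v) l")
    case True
    then have "dcong (deg v) (l - deg u)" by (simp add: dcong_def fun_apply algebra_simps)
    then have "v \<in> dg (l - deg u)" using B(3)[OF uv(2)] dg_cong by blast
    then have "br u v \<in> T" using B(2,3)[OF uv(1)] unfolding T_def by blast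
    then show ?thesis using p_dg[OF dg_br[OF B(3)[OF uv(1)] B(3)[OF uv(2)]]] True by (auto intro: span_base)
  next
    case False
    then show ?thesis using p_dg[OF dg_br[OF B(3)[OF uv(1)] B(3)[OF uv(2)]]] by (simp add: span_zero)
  qed
  have left: "p (br u z) \<in> span T" if u: "u \<in> B" for u z
    by (rule fin_basis_induct[OF B(1), where P = "\<lambda>z. p (br u z) \<in> span T"])
       (auto simp: p0 b_add_right b_scale_right linear_on_add[OF p(1)] linear_on_scale[OF p(1)]
          span_zero span_add span_scale base[OF u])
  have all: "p (br y z) \<in> span T" for y z
    by (rule fin_basis_induct[OF B(1), where P = "\<lambda>y. p (br y z) \<in> span T"])
       (auto simp: p0 b_add_left b_scale_left linear_on_add[OF p(1)] linear_on_scale[OF p(1)]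
          span_zero span_add span_scale left)
  have "subspace {y. p y \<in> span T}"
    by (auto simp: subspace_def p0 linear_on_add[OF p(1)] linear_on_scale[OF p(1)] span_zero span_add span_scale)
  then have "span {br y z | y z. True} \<subseteq> {y. p y \<in> span T}"
    by (intro span_minimal) (use all in auto)
  then have "p x \<in> span T" using perfect by auto
  moreover have "dcong l l" by (simp add: dcong_def)
  ultimately show ?thesis using p_dg[OF x] by (simp add: T_def)
qed

lemma graded_perfect_induct:
  assumes x: "x \<in> dg l" and l: "l \<in> Zn n" and W: "subspace W"
    and base: "\<And>y z k. k \<in> Zn n \<Longrightarrow> y \<in> dg k \<Longrightarrow> z \<in> dg (l - k) \<Longrightarrow> br y z \<in> W"
  shows "x \<in> W"
proof -
  have "span {br y z | y z k. k \<in> Zn n \<and> y \<in> dg k \<and> z \<in> dg (l - k)} \<subseteq> W"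
    by (rule span_minimal) (use base W in auto)
  then show ?thesis using graded_perfect[OF x l] by blast
qed

text \<open>A tool for gluing: maps given degree by degree are linear on single components, and the
  coordinates of \<open>x\<close> vanish at basis vectors of other degree classes.\<close>

lemma dg_sum_expansion:
  assumes B: "fin_basis sc B" "\<And>u. u \<in> B \<Longrightarrow> u \<in> dg (deg u)" and x: "x \<in> dg l"
    and f: "linear_on sc s' UNIV f" and c: "linear_on sc s' (dg l) c"
    and e: "\<And>u. u \<in> B \<Longrightarrow> dcong (deg u) l \<Longrightarrow> f u = c u"
  shows "f x = c x"
proof -
  have [simp]: "finite B" using B(1) by (simp add: fin_basis_def)
  let ?B = "{u \<in> B. coord sc B x u \<noteq> 0}"
  have d: "dcong (deg u) l" "u \<in> dg l" if "u \<in> ?B" for u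
  proof -
    show "dcong (deg u) l" using coord_deg[OF B x] that by blast
    then show "u \<in> dg l" using dg_cong B(2) that by blast
  qed
  have "x = (\<Sum>u\<in>B. sc (coord sc B x u) u)" by (simp add: coord_sum[OF B(1)])
  also have "\<dots> = (\<Sum>u\<in>?B. sc (coord sc B x u) u)" by (rule sum.mono_neutral_right) auto
  finally have x': "x = (\<Sum>u\<in>?B. sc (coord sc B x u) u)" .
  have "f x = (\<Sum>u\<in>?B. f (sc (coord sc B x u) u))"
    by (subst x') (rule linear_on_sum[OF f], simp_all)
  also have "\<dots> = (\<Sum>u\<in>?B. c (sc (coord sc B x u) u))"
    by (rule sum.cong) (auto simp: linear_on_scale[OF f] linear_on_scale[OF c] d e)
  also have "\<dots> = c (\<Sum>u\<in>?B. sc (coord sc B x u) u)"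
    by (rule linear_on_sum[OF c subsp_dg, symmetric]) (use d subsp_scale[OF subsp_dg] in blast)
  also have "\<dots> = c x" by (simp flip: x')
  finally show ?thesis .
qed

text \<open>\<open>sd \<mu> \<theta>\<close> is multiplication by \<open>t\<^sup>\<mu>\<close> composed with \<open>\<partial>\<^sub>\<theta>\<close>.\<close>

definition sd :: "(nat \<Rightarrow> int) \<Rightarrow> ((nat \<Rightarrow> int) \<Rightarrow> 'k) \<Rightarrow> 'a endo" where
  "sd \<mu> \<theta> = (\<lambda>f. if f \<in> L then (\<lambda>\<nu>. sc (\<theta> (\<nu> - \<mu>)) (f (\<nu> - \<mu>))) else 0)"

lemma sd_apply: "f \<in> L \<Longrightarrow> sd \<mu> \<theta> f \<nu> = sc (\<theta> (\<nu> - \<mu>)) (f (\<nu> - \<mu>))"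
  by (simp add: sd_def)

lemma sd_outside: "f \<notin> L \<Longrightarrow> sd \<mu> \<theta> f = 0"
  by (simp add: sd_def)

lemma sd_sing:
  assumes "l \<in> Zn n" "x \<in> dg l"
  shows "sd \<mu> \<theta> (sing l x) = sing (l + \<mu>) (sc (\<theta> l) x)"
proof
  fix \<nu> show "sd \<mu> \<theta> (sing l x) \<nu> = sing (l + \<mu>) (sc (\<theta> l) x) \<nu>"
    by (auto simp: sd_apply[OF sing_L[OF assms]] sing_apply algebra_simps)
qed

lemma sd_linear: "linear_on lsc lsc L (sd \<mu> \<theta>)"
  by (rule linear_onI; rule ext)
     (simp_all add: sd_apply L_add L_scale lsc_apply plus_fun_apply scale_right_distrib mult.commute)

lemma sd_L:
  assumes \<mu>: "\<mu> \<in> Mlat" and f: "f \<in> L"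
  shows "sd \<mu> \<theta> f \<in> L"
  using f
proof (induction rule: L_induct_deg)
  case (sing l x)
  then show ?case
    using Zn_add[OF sing(1) Mlat_Zn[OF \<mu>]] subsp_scale[OF subsp_dg] dg_Mlat_add[OF \<mu>, of l]
    by (simp add: sd_sing sing_L)
qed (simp_all add: linear_on_zero[OF sd_linear subsp_L] L_0 linear_on_add[OF sd_linear] L_add)

lemma sd_plus: "sd \<mu> \<theta> + sd \<mu> \<eta> = sd \<mu> (\<theta> + \<eta>)"
  by (rule ext, rule ext) (simp add: sd_def plus_fun_apply zero_fun_apply scale_left_distrib)

lemma sd_scale: "Esc G a (sd \<mu> \<theta>) = sd \<mu> (\<lambda>l. a * \<theta> l)"
  by (rule ext, rule ext) (simp add: sd_def Esc_def lsc_apply zero_fun_apply)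

lemma sd_zero: "sd \<mu> 0 = 0"
  by (rule ext, rule ext) (simp add: sd_def zero_fun_apply)

lemma dth_eq_sd: "dth n zeta G \<theta> = sd 0 \<theta>"
  by (rule ext, rule ext) (simp add: sd_def dth_def)

lemma vs_Esc: "vector_space (Esc G)"
  by unfold_locales
     (auto simp: Esc_def Lsc_def fun_apply fun_eq_iff scale_right_distrib scale_left_distrib)


lemma Cent_degD:
  assumes "c \<in> Cent_deg n zeta G \<mu>"
  shows "x \<notin> L \<Longrightarrow> c x = 0" and "x \<in> L \<Longrightarrow> c x \<in> L" and "linear_on lsc lsc L c"
    and "x \<in> L \<Longrightarrow> y \<in> L \<Longrightarrow> c (lbr x y) = lbr x (c y)"
    and "l \<in> Zn n \<Longrightarrow> u \<in> dg l \<Longrightarrow> c (sing l u) = sing (\<mu> + l) (c (sing l u) (\<mu> + l))"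
proof -
  have c: "c \<in> Cent n zeta G" "\<And>\<nu>. c ` Ldeg n zeta G \<nu> \<subseteq> Ldeg n zeta G (\<mu> + \<nu>)"
    using assms by (auto simp: Cent_deg_def)
  show "x \<notin> L \<Longrightarrow> c x = 0" "x \<in> L \<Longrightarrow> c x \<in> L" "linear_on lsc lsc L c"
    "x \<in> L \<Longrightarrow> y \<in> L \<Longrightarrow> c (lbr x y) = lbr x (c y)"
    using c(1) by (auto simp: Cent_def)
  show "c (sing l u) = sing (\<mu> + l) (c (sing l u) (\<mu> + l))" if "l \<in> Zn n" "u \<in> dg l"
  proof -
    have "sing l u \<in> Ldeg n zeta G l" using sing_L[OF that] by (simp add: Ldeg_def sing_apply)
    then have "c (sing l u) \<in> Ldeg n zeta G (\<mu> + l)" using c(2) by blast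
    then show ?thesis by (intro ext) (auto simp: Ldeg_def sing_apply)
  qed
qed

lemma Cent_degI:
  assumes "\<And>x. x \<notin> L \<Longrightarrow> c x = 0" and "linear_on lsc lsc L c" and "\<And>x. x \<in> L \<Longrightarrow> c x \<in> L"
    and "\<And>x y. x \<in> L \<Longrightarrow> y \<in> L \<Longrightarrow> c (lbr x y) = lbr x (c y)"
    and deg: "\<And>l x. l \<in> Zn n \<Longrightarrow> x \<in> dg l \<Longrightarrow> \<exists>y. c (sing l x) = sing (\<mu> + l) y"
  shows "c \<in> Cent_deg n zeta G \<mu>"
proof -
  have "c x \<in> Ldeg n zeta G (\<mu> + \<nu>)" if x: "x \<in> Ldeg n zeta G \<nu>" for x \<nu>
  proof (cases "x \<nu> = 0")
    case True
    then have "x = 0" using x by (intro ext) (simp add: Ldeg_def zero_fun_apply, metis)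
    then show ?thesis using linear_on_zero[OF assms(2) subsp_L] by (simp add: Ldeg_def L_0 zero_fun_apply)
  next
    case False
    have xL: "x \<in> L" using x by (simp add: Ldeg_def)
    have "x = sing \<nu> (x \<nu>)" using x by (intro ext) (simp add: Ldeg_def sing_apply)
    moreover obtain y where "c (sing \<nu> (x \<nu>)) = sing (\<mu> + \<nu>) y"
      using deg[OF L_Zn[OF xL False] L_dg[OF xL]] by blast
    ultimately have "c x = sing (\<mu> + \<nu>) y" by simp
    then show ?thesis using assms(3)[OF xL] by (simp add: Ldeg_def sing_apply)
  qed
  then show ?thesis using assms by (auto simp: Cent_deg_def Cent_def)
qed

lemma sh_Cent:
  assumes \<mu>: "\<mu> \<in> Mlat"
  shows "sd \<mu> (\<lambda>_. a) \<in> Cent_deg n zeta G \<mu>"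
proof (rule Cent_degI)
  show "sd \<mu> (\<lambda>_. a) (lbr x y) = lbr x (sd \<mu> (\<lambda>_. a) y)" if "x \<in> L" "y \<in> L" for x y
    using that
  proof (induction x rule: L_induct_deg)
    case (sing l x)
    note s = sing_L[OF sing(1,2)]
    from sing(3) show ?case
    proof (induction y rule: L_induct_deg)
      case (sing m y)
      then show ?case using \<open>l \<in> Zn n\<close> \<open>x \<in> dg l\<close>
        by (simp add: lbr_sing sd_sing Zn_add dg_br b_scale_right add.assoc)
    qed (simp_all add: lbr_add_right lbr_L s linear_on_zero[OF sd_linear subsp_L] linear_on_add[OF sd_linear])
  qed (simp_all add: lbr_add_left lbr_L sd_L[OF \<mu>] linear_on_zero[OF sd_linear subsp_L] linear_on_add[OF sd_linear])
  show "\<exists>y. sd \<mu> (\<lambda>_. a) (sing l x) = sing (\<mu> + l) y" if "l \<in> Zn n" "x \<in> dg l" for l x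
    using sd_sing[OF that] by (auto simp: add.commute)
qed (use sd_outside sd_L[OF \<mu>] sd_linear in auto)

text \<open>A centroid element of degree \<open>\<mu>\<close> is a family of maps between the homogeneous components of
  the simple algebra; by perfectness this family is periodic, so it glues to an element of the
  centroid of the simple algebra, which is a scalar.\<close>

lemma Cent_deg_scalar:
  assumes \<mu>: "\<mu> \<in> Zn n" and c: "c \<in> Cent_deg n zeta G \<mu>"
  obtains a where "a = 0 \<or> \<mu> \<in> Mlat" "c = sd \<mu> (\<lambda>_. a)"
proof -
  note cc = Cent_degD[OF c]
  define cl where "cl l x = c (sing l x) (\<mu> + l)" for l x
  have cl: "c (sing l x) = sing (\<mu> + l) (cl l x)" if "l \<in> Zn n" "x \<in> dg l" for l x
    unfolding cl_def by (rule cc(5)[OF that])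
  have cl_dg: "cl l x \<in> dg (\<mu> + l)" if "l \<in> Zn n" "x \<in> dg l" for l x
    unfolding cl_def by (rule L_dg[OF cc(2)[OF sing_L[OF that]]])
  have cl_lin: "linear_on sc sc (dg l) (cl l)" if l: "l \<in> Zn n" for l
    by (rule linear_onI)
       (simp_all add: cl_def sing_add sing_scale linear_on_add[OF cc(3)] linear_on_scale[OF cc(3)]
         sing_L[OF l] plus_fun_apply lsc_apply)
  have cl_br: "cl (k + m) (br y z) = br y (cl m z)"
    if "k \<in> Zn n" "m \<in> Zn n" "y \<in> dg k" "z \<in> dg m" for k m y z
  proof -
    have "c (sing (k + m) (br y z)) = lbr (sing k y) (c (sing m z))"
      using cc(4)[OF sing_L[of k y] sing_L[of m z]] that by (simp add: lbr_sing)
    also have "\<dots> = sing (\<mu> + (k + m)) (br y (cl m z))"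
      using that by (simp add: cl lbr_sing ac_simps)
    finally show ?thesis by (simp add: cl_def)
  qed
  have periodic: "cl (l + r) x = cl l x" if l: "l \<in> Zn n" and x: "x \<in> dg l" and r: "r \<in> Mlat" for l x r
  proof -
    have lr: "l + r \<in> Zn n" using Zn_add l Mlat_Zn r by blast
    have "x \<in> {x \<in> dg l. cl (l + r) x = cl l x}"
    proof (rule graded_perfect_induct[OF x l])
      show "subspace {x \<in> dg l. cl (l + r) x = cl l x}"
        using subsp_dg[of l] linear_on_zero[OF cl_lin[OF l] subsp_dg] linear_on_zero[OF cl_lin[OF lr] subsp_dg]
          linear_on_add[OF cl_lin[OF l]] linear_on_add[OF cl_lin[OF lr]]
          linear_on_scale[OF cl_lin[OF l]] linear_on_scale[OF cl_lin[OF lr]] dg_Mlat_add[OF r, of l]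
        by (simp add: subspace_def subsp_def)
      fix y z k assume k: "k \<in> Zn n" and y: "y \<in> dg k" and z: "z \<in> dg (l - k)"
      have lk: "l - k \<in> Zn n" using Zn_diff l k by blast
      have "cl (l + r) (br y z) = cl (k + r + (l - k)) (br y z)" by (simp add: algebra_simps)
      also have "\<dots> = br y (cl (l - k) z)"
        using cl_br[of "k + r" "l - k" y z] Zn_add[OF k Mlat_Zn[OF r]] lk y z dg_Mlat_add[OF r, of k] by simp
      also have "\<dots> = cl l (br y z)" using cl_br[OF k lk y z] by simp
      finally show "br y z \<in> {x \<in> dg l. cl (l + r) x = cl l x}" using dg_br[OF y z] by simp
    qed
    then show ?thesis by simp
  qed
  obtain B wt deg where B: "fin_basis sc B" "\<And>u. u \<in> B \<Longrightarrow> deg u \<in> Zn n" "\<And>u. u \<in> B \<Longrightarrow> u \<in> dg (deg u)"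
    "\<And>u. u \<in> B \<Longrightarrow> u \<noteq> 0"
    using homogeneous_basis by metis
  \<comment> \<open>The glued endomorphism. It uses one representative degree per basis vector;
    \<open>periodic\<close> makes it agree with every component \<open>cl l\<close>.\<close>
  obtain C where C: "lin C" "\<And>u. u \<in> B \<Longrightarrow> C u = cl (deg u) u"
    using linear_extension[OF B(1) vs, of "\<lambda>u. cl (deg u) u"] by blast
  have C0: "C 0 = 0" by (rule linear_on_zero[OF C(1)]) simp
  have C_dg: "C x = cl l x" if l: "l \<in> Zn n" and x: "x \<in> dg l" for l x
  proof (rule dg_sum_expansion[OF B(1,3) x C(1) cl_lin[OF l]])
    fix u assume u: "u \<in> B" "dcong (deg u) l"
    have "deg u - l \<in> Mlat" by (rule dcong_Mlat[OF u(2) B(2)[OF u(1)] l])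
    moreover have "u \<in> dg l" using B(3)[OF u(1)] dg_cong[OF u(2)] by simp
    ultimately have "cl (l + (deg u - l)) u = cl l u" by (intro periodic l)
    then show "C u = cl l u" using C(2)[OF u(1)] by simp
  qed
  have base: "C (br u v) = br u (C v)" if uv: "u \<in> B" "v \<in> B" for u v
    using C_dg[OF Zn_add[OF B(2)[OF uv(1)] B(2)[OF uv(2)]] dg_br[OF B(3)[OF uv(1)] B(3)[OF uv(2)]]]
      cl_br[OF B(2)[OF uv(1)] B(2)[OF uv(2)] B(3)[OF uv(1)] B(3)[OF uv(2)]] C(2)[OF uv(2)] by simp
  have left: "C (br u z) = br u (C z)" if u: "u \<in> B" for u z
    by (rule fin_basis_induct[OF B(1), where P = "\<lambda>z. C (br u z) = br u (C z)"])
       (auto simp: C0 b_add_right b_scale_right linear_on_add[OF C(1)] linear_on_scale[OF C(1)] base[OF u])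
  have "C (br y z) = br y (C z)" for y z
    by (rule fin_basis_induct[OF B(1), where P = "\<lambda>y. C (br y z) = br y (C z)"])
       (auto simp: C0 b_add_left b_scale_left linear_on_add[OF C(1)] linear_on_scale[OF C(1)] left)
  then obtain a where a: "\<And>x. C x = sc a x" using schur[OF ac C(1)] by blast
  have c_sing: "c (sing l x) = sing (\<mu> + l) (sc a x)" if "l \<in> Zn n" "x \<in> dg l" for l x
    using cl[OF that] C_dg[OF that] a by simp
  have "c = sd \<mu> (\<lambda>_. a)"
  proof
    fix f show "c f = sd \<mu> (\<lambda>_. a) f"
    proof (cases "f \<in> L")
      case True
      then show ?thesis
        by (rule L_linear_eqI[OF cc(3) sd_linear]) (simp add: c_sing sd_sing add.commute)
    qed (simp add: cc(1) sd_outside)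
  qed
  \<comment> \<open>A nonzero scalar would place a basis vector in the degrees \<open>deg u\<close>
    and \<open>\<mu> + deg u\<close> at once, which forces these to be congruent.\<close>
  moreover have "a = 0 \<or> \<mu> \<in> Mlat"
  proof (rule disjCI)
    assume \<mu>': "\<mu> \<notin> Mlat"
    have "B \<noteq> {}"
    proof
      assume "B = {}"
      then have "x = 0" for x :: 'a using coord_sum[OF B(1), of x] by simp
      then show False using nonabelian by metis
    qed
    then obtain u where u: "u \<in> B" by blast
    show "a = 0"
    proof (rule ccontr)
      assume "a \<noteq> 0"
      then have "sc a u \<noteq> 0" using B(4)[OF u] by simp
      moreover have "sc a u \<in> dg (\<mu> + deg u)"
        using cl_dg[OF B(2,3)[OF u]] C_dg[OF B(2,3)[OF u]] a by simp
      moreover have "sc a u \<in> dg (deg u)" using subsp_scale[OF subsp_dg B(3)[OF u]] .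
      ultimately have "dcong (\<mu> + deg u) (deg u)" using dg_unique by blast
      then show False using \<mu>' \<mu> by (simp add: dcong_def Mlat_def fun_apply)
    qed
  qed
  ultimately show ?thesis using that by blast
qed

lemma ex_nonzero_h: obtains t where "t \<in> \<h>" "t \<noteq> 0" "t \<in> dg 0" "t \<in> rs 0"
  using h_nonzero h_eq by blast

lemma sd_const_eq_0:
  assumes "sd \<mu> (\<lambda>_. a) = 0"
  shows "a = 0"
proof -
  obtain t where t: "t \<noteq> 0" "t \<in> dg 0" using ex_nonzero_h by blast
  have "sing \<mu> (sc a t) = (0 :: 'a endo) (sing 0 t)"
    using sd_sing[of 0 t \<mu> "\<lambda>_. a"] t assms by simp
  then have "sing \<mu> (sc a t) \<mu> = (0 :: 'a lp) \<mu>" by (simp only: zero_fun_apply)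
  then have "sc a t = 0" by (simp add: zero_fun_apply)
  then show ?thesis using t by simp
qed

lemma Gam_eq: "Gam n zeta G = Mlat"
proof safe
  fix \<mu> assume "\<mu> \<in> Gam n zeta G"
  then have \<mu>: "\<mu> \<in> Zn n" and ne: "Cent_deg n zeta G \<mu> \<noteq> {0}" by (auto simp: Gam_def)
  have "0 \<in> Cent_deg n zeta G \<mu>"
    by (rule Cent_degI) (auto simp: L_0 zero_fun_apply intro!: linear_onI exI[of _ 0] simp: Lsc_def fun_eq_iff)
  then obtain c where c: "c \<in> Cent_deg n zeta G \<mu>" "c \<noteq> 0" using ne by blast
  obtain a where "a = 0 \<or> \<mu> \<in> Mlat" "c = sd \<mu> (\<lambda>_. a)" using Cent_deg_scalar[OF \<mu> c(1)] .
  then show "\<mu> \<in> Mlat" using c(2) sd_zero[of \<mu>] by (auto simp: zero_fun_def)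
next
  fix \<mu> assume \<mu>: "\<mu> \<in> Mlat"
  have "sd \<mu> (\<lambda>_. 1) \<noteq> 0" using sd_const_eq_0[of \<mu> 1] by auto
  then show "\<mu> \<in> Gam n zeta G" using sh_Cent[OF \<mu>, of 1] Mlat_Zn[OF \<mu>] by (auto simp: Gam_def)
qed

text \<open>Centroid elements of degree \<open>\<mu>\<close> are scalar multiples of one shift, and
  the scalar can be moved into \<open>\<theta>\<close>. The generators therefore already form a
  subspace and the span adds nothing.\<close>

lemma SCdeg_eq:
  assumes \<mu>: "\<mu> \<in> Mlat"
  shows "SCdeg n zeta G \<mu> = {sd \<mu> \<theta> | \<theta>. \<theta> \<in> Th n \<and> \<theta> \<mu> = 0}" (is "_ = ?S")
proof -
  interpret E: vector_space "Esc G" by (rule vs_Esc)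
  have comp: "sd \<mu> (\<lambda>_. a) \<circ> dth n zeta G \<theta> = sd \<mu> (\<lambda>l. a * \<theta> l)" for a and \<theta> :: "(nat \<Rightarrow> int) \<Rightarrow> 'k"
  proof
    fix f
    show "(sd \<mu> (\<lambda>_. a) \<circ> dth n zeta G \<theta>) f = sd \<mu> (\<lambda>l. a * \<theta> l) f"
    proof (cases "f \<in> L")
      case True
      show ?thesis
      proof
        fix \<nu>
        show "(sd \<mu> (\<lambda>_. a) \<circ> dth n zeta G \<theta>) f \<nu> = sd \<mu> (\<lambda>l. a * \<theta> l) f \<nu>"
          using sd_L[OF Mlat_0 True, of \<theta>] True by (simp add: dth_eq_sd sd_apply)
      qed
    next
      case False
      then show ?thesis
        by (simp add: dth_eq_sd sd_outside linear_on_zero[OF sd_linear subsp_L])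
    qed
  qed
  have sub: "E.subspace ?S"
    unfolding E.subsp_iff_subspace[symmetric] subsp_def
  proof (intro conjI ballI allI)
    show "0 \<in> ?S" using sd_zero[of \<mu>] by (metis (mono_tags, lifting) CollectI Th_0 zero_fun_apply)
    fix x y a assume "x \<in> ?S" "y \<in> ?S"
    then show "x + y \<in> ?S" using Th_plus sd_plus by (fastforce simp: plus_fun_apply)
  next
    fix a x assume "x \<in> ?S"
    then obtain \<theta> where "x = sd \<mu> \<theta>" "\<theta> \<in> Th n" "\<theta> \<mu> = 0" by blast
    then show "Esc G a x \<in> ?S"
      using Th_lincomb[of \<theta> n \<theta> a 0] by (auto simp: sd_scale intro!: exI[of _ "\<lambda>l. a * \<theta> l"])
  qed
  have gens: "{c \<circ> dth n zeta G \<theta> | c \<theta>. c \<in> Cent_deg n zeta G \<mu> \<and> \<theta> \<in> Th n \<and> \<theta> \<mu> = 0} = ?S" (is "?G = _")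
  proof safe
    fix c and \<theta> :: "(nat \<Rightarrow> int) \<Rightarrow> 'k" assume c: "c \<in> Cent_deg n zeta G \<mu>" and \<theta>: "\<theta> \<in> Th n" "\<theta> \<mu> = 0"
    obtain a where "c = sd \<mu> (\<lambda>_. a)" using Cent_deg_scalar[OF Mlat_Zn[OF \<mu>] c] by metis
    then show "\<exists>\<eta>. c \<circ> dth n zeta G \<theta> = sd \<mu> \<eta> \<and> \<eta> \<in> Th n \<and> \<eta> \<mu> = 0"
      using comp Th_lincomb[of \<theta> n \<theta> a 0] \<theta> by (intro exI[of _ "\<lambda>l. a * \<theta> l"]) auto
  next
    fix \<theta> :: "(nat \<Rightarrow> int) \<Rightarrow> 'k" assume \<theta>: "\<theta> \<in> Th n" "\<theta> \<mu> = 0"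
    have "sd \<mu> \<theta> = sd \<mu> (\<lambda>_. 1) \<circ> dth n zeta G \<theta>" by (simp add: comp)
    then show "\<exists>c \<eta>. sd \<mu> \<theta> = c \<circ> dth n zeta G \<eta> \<and> c \<in> Cent_deg n zeta G \<mu> \<and> \<eta> \<in> Th n \<and> \<eta> \<mu> = 0"
      using sh_Cent[OF \<mu>] \<theta> by blast
  qed
  show ?thesis unfolding SCdeg_def gens E.lspan_eq_span using E.span_eq_iff[of ?S] sub by blast
qed

section \<open>Skew centroidal derivations\<close>

abbreviation SCD where "SCD \<equiv> SCDer n zeta G"

lemma subsp_SCD: "subsp (Esc G) SCD"
proof -
  interpret E: vector_space "Esc G" by (rule vs_Esc)
  show ?thesis by (simp add: SCDer_def E.lspan_eq_span E.subsp_iff_subspace)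
qed

lemma sd_SCdeg: "\<mu> \<in> Mlat \<Longrightarrow> \<theta> \<in> Th n \<Longrightarrow> \<theta> \<mu> = 0 \<Longrightarrow> sd \<mu> \<theta> \<in> SCdeg n zeta G \<mu>"
  using SCdeg_eq by blast

lemma SCdeg_SCD: "\<mu> \<in> Mlat \<Longrightarrow> SCdeg n zeta G \<mu> \<subseteq> SCD"
proof -
  interpret E: vector_space "Esc G" by (rule vs_Esc)
  show "\<mu> \<in> Mlat \<Longrightarrow> SCdeg n zeta G \<mu> \<subseteq> SCD"
    unfolding SCDer_def E.lspan_eq_span Gam_eq using E.span_superset by fastforce
qed

lemma sd_SCD: "\<mu> \<in> Mlat \<Longrightarrow> \<theta> \<in> Th n \<Longrightarrow> \<theta> \<mu> = 0 \<Longrightarrow> sd \<mu> \<theta> \<in> SCD"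
  using sd_SCdeg SCdeg_SCD by blast

lemma SCD_induct [consumes 1, case_names zero add sd]:
  assumes d: "d \<in> SCD" and "P 0" "\<And>d e. d \<in> SCD \<Longrightarrow> e \<in> SCD \<Longrightarrow> P d \<Longrightarrow> P e \<Longrightarrow> P (d + e)"
    and "\<And>\<mu> \<theta>. \<mu> \<in> Mlat \<Longrightarrow> \<theta> \<in> Th n \<Longrightarrow> \<theta> \<mu> = 0 \<Longrightarrow> P (sd \<mu> \<theta>)"
  shows "P d"
proof -
  interpret E: vector_space "Esc G" by (rule vs_Esc)
  have "d \<in> E.span (\<Union>\<mu>\<in>Mlat. SCdeg n zeta G \<mu>)"
    using d by (simp add: SCDer_def E.lspan_eq_span Gam_eq)
  then have "d \<in> SCD \<and> P d"
  proof (induction rule: E.span_induct_alt)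
    case base
    then show ?case using assms(2) subsp_0[OF subsp_SCD] by simp
  next
    case (step c x y)
    then obtain \<mu> \<theta> where x: "\<mu> \<in> Mlat" "\<theta> \<in> Th n" "\<theta> \<mu> = 0" "x = sd \<mu> \<theta>"
      using SCdeg_eq by blast
    have "(\<lambda>l. c * \<theta> l) \<in> Th n" using Th_lincomb[OF x(2,2), of c 0] by simp
    then have "Esc G c x \<in> SCD" "P (Esc G c x)"
      using x assms(4) sd_SCD by (simp_all add: sd_scale)
    then show ?case using step assms(3) subsp_add[OF subsp_SCD] by blast
  qed
  then show ?thesis by blast
qed

lemma SCD_outside: "d \<in> SCD \<Longrightarrow> x \<notin> L \<Longrightarrow> d x = 0"
  by (induction rule: SCD_induct) (simp_all add: sd_outside zero_fun_apply[of x] plus_fun_apply[of _ _ x])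

lemma SCD_L: "d \<in> SCD \<Longrightarrow> x \<in> L \<Longrightarrow> d x \<in> L"
  by (induction rule: SCD_induct) (simp_all add: sd_L L_0 L_add zero_fun_apply[of x] plus_fun_apply[of _ _ x])

lemma SCD_linear: "d \<in> SCD \<Longrightarrow> linear_on lsc lsc L d"
proof (induction rule: SCD_induct)
  case zero
  show ?case
    by (auto intro!: linear_onI simp: zero_fun_apply[where 'a = "'a lp"] Lsc_def zero_fun_def)
next
  case (add d e)
  interpret v: vector_space lsc by (rule vs_lsc)
  show ?case
    using add by (auto intro!: linear_onI simp: plus_fun_apply[where 'a = "'a lp"] linear_on_add linear_on_scale
      v.scale_right_distrib)
qed (rule sd_linear)

lemmas SCD_add = linear_on_add[OF SCD_linear]
  and SCD_0 = linear_on_zero[OF SCD_linear subsp_L]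
  and SCD_diff = linear_on_diff[OF SCD_linear vs_lsc vs_lsc subsp_L]

lemma SCD_derivation:
  "d \<in> SCD \<Longrightarrow> x \<in> L \<Longrightarrow> y \<in> L \<Longrightarrow> d (lbr x y) = lbr (d x) y + lbr x (d y)"
proof (induction d rule: SCD_induct)
  case zero
  then show ?case by (simp add: zero_fun_apply[where 'a = "'a lp"])
next
  case (add d e)
  then show ?case
    by (simp add: plus_fun_apply[where 'a = "'a lp"] lbr_add_left lbr_add_right SCD_L)
next
  case (sd \<mu> \<theta>)
  note lin = linear_on_zero[OF sd_linear subsp_L] linear_on_add[OF sd_linear] sd_L[OF sd(1)]
  from sd(4,5) show ?case
  proof (induction x rule: L_induct_deg)
    case (sing l x)
    note s = sing_L[OF sing(1,2)] and lx = sing(1,2)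
    from sing(3) show ?case
    proof (induction y rule: L_induct_deg)
      case (sing m y)
      show ?case using lx sing(1,2)
        by (simp add: lbr_sing sd_sing Zn_add dg_br Th_add[OF sd(2)] b_scale_left b_scale_right
            scale_left_distrib sing_add ac_simps)
    qed (simp_all add: lin lbr_add_right lbr_L s)
  qed (simp_all add: lin lbr_add_left lbr_add_right lbr_L)
qed

text \<open>The condition \<open>\<theta> \<mu> = 0\<close> is the reason: for
  \<open>l + m + \<mu> = 0\<close> it gives \<open>\<theta> l = - \<theta> m\<close>.\<close>

lemma SCD_skew: "d \<in> SCD \<Longrightarrow> x \<in> L \<Longrightarrow> y \<in> L \<Longrightarrow> form (d x) y = - form x (d y)"
proof (induction d rule: SCD_induct)
  case zero
  then show ?case by (simp add: zero_fun_apply[where 'a = "'a lp"])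
next
  case (add d e)
  then show ?case
    by (simp add: plus_fun_apply[where 'a = "'a lp"] form_add_left form_add_right SCD_L)
next
  case (sd \<mu> \<theta>)
  note lin = linear_on_zero[OF sd_linear subsp_L] linear_on_add[OF sd_linear] sd_L[OF sd(1)]
  from sd(4,5) show ?case
  proof (induction x rule: L_induct_deg)
    case (sing l x)
    note s = sing_L[OF sing(1,2)] and lx = sing(1,2)
    from sing(3) show ?case
    proof (induction y rule: L_induct_deg)
      case (sing m y)
      have "\<theta> l * kap x y = - (\<theta> m * kap x y)" if e: "l + (m + \<mu>) = 0"
      proof -
        have "\<theta> l + \<theta> m + \<theta> \<mu> = \<theta> (l + (m + \<mu>))" by (simp add: Th_add[OF sd(2)] add.assoc)
        then have "\<theta> l = - \<theta> m" using sd(3) e by (simp add: Th_at_0[OF sd(2)] eq_neg_iff_add_eq_0)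
        then show ?thesis by simp
      qed
      then show ?case using lx sing(1,2)
        by (simp add: sd_sing form_sing linear_on_scale[OF kap_linear_left] linear_on_scale[OF kap_linear_right]
            ac_simps)
    qed (simp_all add: lin form_add_right s)
  qed (simp_all add: lin form_add_left)
qed

text \<open>The Witt-type rule \<open>[t^\<mu> \<partial>_\<theta>, t^\<nu> \<partial>_\<eta>] =
  t^(\<mu>+\<nu>) (\<theta>(\<nu>) \<partial>_\<eta> - \<eta>(\<mu>) \<partial>_\<theta>)\<close>,
  with the functional in the shape of \<open>Th_lincomb\<close>.\<close>

lemma comm_sd:
  assumes \<mu>: "\<mu> \<in> Mlat" and \<nu>: "\<nu> \<in> Mlat" and \<theta>: "\<theta> \<in> Th n" and \<eta>: "\<eta> \<in> Th n"
  shows "comm (sd \<mu> \<theta>) (sd \<nu> \<eta>) = sd (\<mu> + \<nu>) (\<lambda>l. \<theta> \<nu> * \<eta> l + (- \<eta> \<mu>) * \<theta> l)"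
proof
  fix f
  show "comm (sd \<mu> \<theta>) (sd \<nu> \<eta>) f = sd (\<mu> + \<nu>) (\<lambda>l. \<theta> \<nu> * \<eta> l + (- \<eta> \<mu>) * \<theta> l) f"
  proof (cases "f \<in> L")
    case True
    show ?thesis
    proof
      fix \<kappa>
      define l where "l = \<kappa> - (\<mu> + \<nu>)"
      have k: "\<kappa> - \<mu> - \<nu> = l" "\<kappa> - \<nu> - \<mu> = l" "\<kappa> - \<mu> = l + \<nu>" "\<kappa> - \<nu> = l + \<mu>"
        by (simp_all add: l_def algebra_simps)
      show "comm (sd \<mu> \<theta>) (sd \<nu> \<eta>) f \<kappa> = sd (\<mu> + \<nu>) (\<lambda>l. \<theta> \<nu> * \<eta> l + (- \<eta> \<mu>) * \<theta> l) f \<kappa>"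
        by (simp add: comm_def minus_apply[of _ _ \<kappa>] sd_apply sd_L[OF \<mu> True] sd_L[OF \<nu> True] True k
            flip: l_def)
           (simp add: Th_add[OF \<theta>] Th_add[OF \<eta>] algebra_simps flip: scale_left_diff_distrib)
    qed
  next
    case False
    then show ?thesis by (simp add: comm_def sd_outside linear_on_zero[OF sd_linear subsp_L])
  qed
qed

lemma comm_add_left:
  assumes "d1 \<in> SCD" "d2 \<in> SCD" "e \<in> SCD"
  shows "comm (d1 + d2) e = comm d1 e + comm d2 e"
proof
  fix x
  show "comm (d1 + d2) e x = (comm d1 e + comm d2 e) x"
  proof (cases "x \<in> L")
    case True
    then show ?thesis using assms
      by (simp add: comm_def plus_fun_apply[where 'a = "'a lp"] SCD_add SCD_L)
  next
    case False
    then show ?thesis using assms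
      by (simp add: comm_def plus_fun_apply[where 'a = "'a lp"] SCD_outside SCD_0)
  qed
qed

lemma comm_anti: "comm e d = - comm d e"
  by (rule ext) (simp add: comm_def uminus_apply)

lemma comm_0_left: "e \<in> SCD \<Longrightarrow> comm 0 e = 0"
  by (rule ext) (simp add: comm_def zero_fun_apply[where 'a = "'a lp"] SCD_0)

lemma comm_add_right:
  assumes "d1 \<in> SCD" "d2 \<in> SCD" "e \<in> SCD"
  shows "comm e (d1 + d2) = comm e d1 + comm e d2"
  unfolding comm_anti[of e] comm_add_left[OF assms] by simp

lemma comm_0_right: "e \<in> SCD \<Longrightarrow> comm e 0 = 0"
  unfolding comm_anti[of e] by (simp add: comm_0_left)

lemma SCD_comm: "d \<in> SCD \<Longrightarrow> e \<in> SCD \<Longrightarrow> comm d e \<in> SCD"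
proof (induction d rule: SCD_induct)
  case (sd \<mu> \<theta>)
  note d = sd_SCD[OF sd(1-3)] and \<mu>\<theta> = sd(1-3)
  from sd(4) show ?case
  proof (induction e rule: SCD_induct)
    case (sd \<nu> \<eta>)
    let ?\<theta> = "\<lambda>l. \<theta> \<nu> * \<eta> l + (- \<eta> \<mu>) * \<theta> l"
    have "?\<theta> (\<mu> + \<nu>) = 0"
      using \<mu>\<theta>(3) sd(3) by (simp add: Th_add[OF \<mu>\<theta>(2)] Th_add[OF sd(2)] mult.commute)
    then show ?case
      unfolding comm_sd[OF \<mu>\<theta>(1) sd(1) \<mu>\<theta>(2) sd(2)]
      by (intro sd_SCD Mlat_add Th_lincomb \<mu>\<theta> sd)
  qed (simp_all add: comm_0_right comm_add_right d subsp_0[OF subsp_SCD] subsp_add[OF subsp_SCD])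
qed (simp_all add: comm_0_left comm_add_left subsp_0[OF subsp_SCD] subsp_add[OF subsp_SCD])

text \<open>This is the span of \<open>\<h>\<close> over the centroid.\<close>

definition CH :: "'a lp set" where
  "CH = {y \<in> L. \<forall>\<nu>. y \<nu> \<noteq> 0 \<longrightarrow> \<nu> \<in> Mlat \<and> y \<nu> \<in> \<h>}"

lemma CH_L: "y \<in> CH \<Longrightarrow> y \<in> L" by (simp add: CH_def)

lemma subsp_CH: "subsp lsc CH"
proof -
  have h0: "0 \<in> \<h>" by (rule subsp_0[OF subsp_h])
  have CH_iff: "y \<in> CH \<longleftrightarrow> y \<in> L \<and> (\<forall>\<nu>. y \<nu> \<in> \<h> \<and> (\<nu> \<notin> Mlat \<longrightarrow> y \<nu> = 0))" for y
  proof -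
    have "(v \<noteq> 0 \<longrightarrow> \<nu> \<in> Mlat \<and> v \<in> \<h>) \<longleftrightarrow> v \<in> \<h> \<and> (\<nu> \<notin> Mlat \<longrightarrow> v = 0)" for v \<nu>
      using h0 by (cases "v = 0") auto
    then show ?thesis by (simp add: CH_def)
  qed
  have "x + y \<in> CH" if "x \<in> CH" "y \<in> CH" for x y
    using that by (simp add: CH_iff L_add plus_fun_apply[of x y] subsp_add[OF subsp_h])
  then show ?thesis
    by (auto simp: subsp_def CH_iff h0 L_0 L_scale zero_fun_apply[where 'a = 'a] lsc_apply subsp_scale[OF subsp_h])
qed

lemma sing_CH: "\<nu> \<in> Mlat \<Longrightarrow> t \<in> \<h> \<Longrightarrow> sing \<nu> t \<in> CH"
  using h_fixed[of t] dg_Mlat[of \<nu>] by (auto simp: CH_def sing_apply sing_L Mlat_Zn split: if_splits)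

lemma CH_induct [consumes 1, case_names zero add sing]:
  assumes y: "y \<in> CH" and "P 0" "\<And>x y. x \<in> CH \<Longrightarrow> y \<in> CH \<Longrightarrow> P x \<Longrightarrow> P y \<Longrightarrow> P (x + y)"
    and "\<And>\<nu> t. \<nu> \<in> Mlat \<Longrightarrow> t \<in> \<h> \<Longrightarrow> P (sing \<nu> t)"
  shows "P y"
proof -
  note fin = L_finite[OF CH_L[OF y]]
  have "finite A \<Longrightarrow> A \<subseteq> {l. y l \<noteq> 0} \<Longrightarrow> (\<Sum>l\<in>A. sing l (y l)) \<in> CH \<and> P (\<Sum>l\<in>A. sing l (y l))" for A
  proof (induction A rule: finite_induct)
    case (insert a A)
    have "a \<in> Mlat" "y a \<in> \<h>" using insert.prems y by (auto simp: CH_def)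
    then show ?case using insert assms sing_CH subsp_add[OF subsp_CH] by simp
  qed (simp add: assms subsp_0[OF subsp_CH])
  from this[of "{l. y l \<noteq> 0}"] show ?thesis using sum_sing[OF fin] fin by simp
qed

lemma CH_abelian: "y \<in> CH \<Longrightarrow> z \<in> CH \<Longrightarrow> lbr y z = 0"
proof (induction y rule: CH_induct)
  case (sing \<nu> t)
  note s = CH_L[OF sing_CH[OF sing(1,2)]]
  from sing(3) show ?case
    by (induction z rule: CH_induct) (simp_all add: lbr_add_right s lbr_sing h_abelian sing(2))
qed (simp_all add: lbr_add_left CH_L)

lemma SCD_CH: "d \<in> SCD \<Longrightarrow> y \<in> CH \<Longrightarrow> d y \<in> CH"
proof (induction d rule: SCD_induct)
  case (sd \<mu> \<theta>)
  from sd(4) show ?case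
  proof (induction y rule: CH_induct)
    case (sing \<nu> t)
    have "t \<in> dg \<nu>" using h_fixed[OF sing(2)] dg_Mlat[OF sing(1)] by simp
    then show ?case
      using sing by (simp add: sd_sing Mlat_Zn sing_CH Mlat_add sd(1) subsp_scale[OF subsp_h])
  qed (simp_all add: linear_on_zero[OF sd_linear subsp_L] linear_on_add[OF sd_linear] CH_L
      subsp_0[OF subsp_CH] subsp_add[OF subsp_CH])
qed (simp_all add: zero_fun_apply[of y] plus_fun_apply[of _ _ y] subsp_0[OF subsp_CH] subsp_add[OF subsp_CH])

text \<open>The normal form of \<open>d\<close> as a sum of \<open>sd \<mu> (\<Theta> \<mu>)\<close>
  over \<open>\<mu>\<close>, stated through single coefficients so that each functional
  \<open>\<Theta> \<mu>\<close> can be tested on its own.\<close>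

lemma SCD_representation:
  assumes "d \<in> SCD"
  obtains \<Theta> where "\<And>\<mu>. \<Theta> \<mu> \<in> Th n"
    "\<And>l x \<nu>. l \<in> Zn n \<Longrightarrow> x \<in> dg l \<Longrightarrow> d (sing l x) \<nu> = sc (\<Theta> (\<nu> - l) l) x"
proof -
  have "\<exists>\<Theta>. (\<forall>\<mu>. \<Theta> \<mu> \<in> Th n) \<and>
      (\<forall>l x \<nu>. l \<in> Zn n \<longrightarrow> x \<in> dg l \<longrightarrow> d (sing l x) \<nu> = sc (\<Theta> (\<nu> - l) l) x)"
    using assms
  proof (induction rule: SCD_induct)
    case zero
    show ?case
      by (rule exI[of _ "\<lambda>_. 0"]) (intro conjI allI impI Th_0, simp add: zero_fun_apply)
  next
    case (add d e)
    then obtain \<Theta> \<Psi> where *: "\<forall>\<mu>. \<Theta> \<mu> \<in> Th n" "\<forall>\<mu>. \<Psi> \<mu> \<in> Th n"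
      "\<forall>l x \<nu>. l \<in> Zn n \<longrightarrow> x \<in> dg l \<longrightarrow> d (sing l x) \<nu> = sc (\<Theta> (\<nu> - l) l) x"
      "\<forall>l x \<nu>. l \<in> Zn n \<longrightarrow> x \<in> dg l \<longrightarrow> e (sing l x) \<nu> = sc (\<Psi> (\<nu> - l) l) x" by blast
    show ?case
      by (rule exI[of _ "\<lambda>\<mu>. \<Theta> \<mu> + \<Psi> \<mu>"])
         (use * in \<open>intro conjI allI impI Th_plus; simp add: plus_fun_apply scale_left_distrib\<close>)
  next
    case (sd \<mu> \<theta>)
    have "sd \<mu> \<theta> (sing l x) \<nu> = sc ((if \<nu> - l = \<mu> then \<theta> else 0) l) x"
      if "l \<in> Zn n" "x \<in> dg l" for l x \<nu>
    proof -
      have "\<nu> = l + \<mu> \<longleftrightarrow> \<nu> - l = \<mu>" by (auto simp: algebra_simps)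
      then show ?thesis unfolding sd_sing[OF that] by (simp add: sing_apply zero_fun_apply)
    qed
    then show ?case
      by (intro exI[of _ "\<lambda>\<nu>. if \<nu> = \<mu> then \<theta> else 0"]) (simp add: sd)
  qed
  then show ?thesis using that by blast
qed

text \<open>The lattice contains the multiples \<open>m_i e_i\<close> of the unit vectors, and
  \<open>m_i\<close> is invertible in characteristic 0.\<close>

lemma Th_eq_0_on_Mlat:
  assumes \<theta>: "\<theta> \<in> Th n" and z: "\<And>l. l \<in> Mlat \<Longrightarrow> \<theta> l = 0"
  shows "\<theta> = (0 :: (nat \<Rightarrow> int) \<Rightarrow> 'k)"
proof -
  obtain a where a: "\<And>l. \<theta> l = (\<Sum>i<n. a i * of_int (l i))" using \<theta> unfolding Th_def by blast
  have "a i = 0" if i: "i < n" for i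
  proof -
    let ?l = "\<lambda>j. if j = i then int (mord G i) else 0"
    have "?l \<in> Mlat" using i by (simp add: Mlat_def Zn_def)
    then have "(\<Sum>j<n. a j * of_int (?l j)) = 0" using z[of ?l] a[of ?l] by simp
    also have "(\<Sum>j<n. a j * of_int (?l j)) = (\<Sum>j<n. if j = i then a i * of_nat (mord G i) else 0)"
      by (rule sum.cong) auto
    also have "\<dots> = a i * of_nat (mord G i)" using i by simp
    finally show ?thesis using mord_pos[OF i] by simp
  qed
  then show ?thesis by (intro ext) (simp add: a zero_fun_apply)
qed

text \<open>Since \<open>CH\<close> is abelian, \<open>d\<close> kills all monomials
  \<open>t \<otimes> t^l\<close> with \<open>t\<close> in the Cartan subalgebra and \<open>l\<close>
  in the lattice. So the functionals of \<open>d\<close> vanish on the lattice, hence everywhere,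
  and then \<open>y\<close> is central. This directness is the source of the uniqueness in
  \<open>rel_unique\<close>.\<close>

lemma SCD_ad_CH:
  assumes d: "d \<in> SCD" and y: "y \<in> CH" and e: "\<And>x. x \<in> L \<Longrightarrow> d x = lbr y x"
  shows "d = 0" and "y = 0"
proof -
  obtain \<Theta> where \<Theta>: "\<And>\<mu>. \<Theta> \<mu> \<in> Th n"
    "\<And>l x \<nu>. l \<in> Zn n \<Longrightarrow> x \<in> dg l \<Longrightarrow> d (sing l x) \<nu> = sc (\<Theta> (\<nu> - l) l) x"
    using SCD_representation[OF d] by metis
  obtain t where t: "t \<in> \<h>" "t \<noteq> 0" "t \<in> dg 0" using ex_nonzero_h by blast
  have "\<Theta> \<mu> l = 0" if l: "l \<in> Mlat" for \<mu> l
  proof -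
    have "d (sing l t) = 0" using e[OF CH_L[OF sing_CH[OF l t(1)]]] CH_abelian[OF y sing_CH[OF l t(1)]] by simp
    then have "sc (\<Theta> (l + \<mu> - l) l) t = 0"
      using \<Theta>(2)[of l t "l + \<mu>"] Mlat_Zn[OF l] t(3) dg_Mlat[OF l] by (simp add: zero_fun_apply)
    then show ?thesis using t by simp
  qed
  then have \<Theta>0: "\<Theta> \<mu> = 0" for \<mu> using Th_eq_0_on_Mlat[OF \<Theta>(1)] by blast
  show d0: "d = 0"
  proof
    fix x
    show "d x = 0 x"
    proof (cases "x \<in> L")
      case True
      then show ?thesis
      proof (induction rule: L_induct_deg)
        case (sing l x)
        then show ?case by (intro ext) (simp add: \<Theta>(2) \<Theta>0 zero_fun_apply)
      qed (simp_all add: zero_fun_apply[where 'a = "'a lp"] SCD_0[OF d] SCD_add[OF d])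
    qed (simp add: SCD_outside[OF d] zero_fun_apply[where 'a = "'a lp"])
  qed
  show "y = 0"
    by (rule L_center[OF CH_L[OF y]]) (simp add: d0 zero_fun_apply[where 'a = "'a lp"] flip: e)
qed

text \<open>As for the centroid, invariance and perfectness make the homogeneous components of the form
  periodic, which reduces the claim to the simple algebra.\<close>

lemma L_form_unique:
  assumes l1: "\<And>y. y \<in> L \<Longrightarrow> linear_on lsc (*) L (\<lambda>x. \<beta> x y)"
    and l2: "\<And>x. x \<in> L \<Longrightarrow> linear_on lsc (*) L (\<beta> x)"
    and inv: "\<And>x y z. x \<in> L \<Longrightarrow> y \<in> L \<Longrightarrow> z \<in> L \<Longrightarrow> \<beta> (lbr x y) z = \<beta> x (lbr y z)"
    and gr: "\<And>l m x y. l \<in> Zn n \<Longrightarrow> m \<in> Zn n \<Longrightarrow> x \<in> dg l \<Longrightarrow> y \<in> dg m \<Longrightarrow> l + m \<noteq> 0 \<Longrightarrow>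
      \<beta> (sing l x) (sing m y) = 0"
  obtains a where "\<And>x y. x \<in> L \<Longrightarrow> y \<in> L \<Longrightarrow> \<beta> x y = a * form x y"
proof -
  define bl where "bl l x y = \<beta> (sing l x) (sing (- l) y)" for l x y
  have bl_lin1: "linear_on sc (*) (dg l) (\<lambda>x. bl l x y)" if "l \<in> Zn n" "y \<in> dg (- l)" for l y
    using that Zn_uminus[OF that(1)] unfolding bl_def
    by (intro linear_onI) (simp_all add: sing_add sing_scale linear_on_add[OF l1] linear_on_scale[OF l1] sing_L)
  have bl_lin2: "linear_on sc (*) (dg (- l)) (bl l x)" if "l \<in> Zn n" "x \<in> dg l" for l x
    using that Zn_uminus[OF that(1)] unfolding bl_def
    by (intro linear_onI) (simp_all add: sing_add sing_scale linear_on_add[OF l2] linear_on_scale[OF l2] sing_L)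
  have bl_br: "bl (k + m) (br p q) y = bl k p (br q y)"
    if "k \<in> Zn n" "m \<in> Zn n" "p \<in> dg k" "q \<in> dg m" "y \<in> dg (- (k + m))" for k m p q y
  proof -
    have "- (k + m) \<in> Zn n" using that Zn_uminus Zn_add by blast
    then show ?thesis
      using inv[OF sing_L[of k p] sing_L[of m q] sing_L[of "- (k + m)" y]] that
      by (simp add: bl_def lbr_sing)
  qed
  have periodic: "bl (l + r) x y = bl l x y"
    if l: "l \<in> Zn n" and x: "x \<in> dg l" and y: "y \<in> dg (- l)" and r: "r \<in> Mlat" for l x y r
  proof -
    have lr: "l + r \<in> Zn n" using Zn_add l Mlat_Zn r by blast
    have y': "y \<in> dg (- (l + r))" using y dg_Mlat_add[OF Mlat_uminus[OF r], of "- l"] by simp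
    have "x \<in> {x \<in> dg l. bl (l + r) x y = bl l x y}"
    proof (rule graded_perfect_induct[OF x l])
      note lin = bl_lin1[OF l y] bl_lin1[OF lr y']
      show "subspace {x \<in> dg l. bl (l + r) x y = bl l x y}"
        using subsp_dg[of l] linear_on_zero[OF lin(1) subsp_dg] linear_on_zero[OF lin(2) subsp_dg]
          linear_on_add[OF lin(1)] linear_on_add[OF lin(2)]
          linear_on_scale[OF lin(1)] linear_on_scale[OF lin(2)] dg_Mlat_add[OF r, of l]
        by (simp add: subspace_def subsp_def)
      fix p q k assume k: "k \<in> Zn n" and p: "p \<in> dg k" and q: "q \<in> dg (l - k)"
      have lk: "l - k \<in> Zn n" using Zn_diff l k by blast
      have "bl (l + r) (br p q) y = bl (k + (l - k + r)) (br p q) y" by (simp add: algebra_simps)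
      also have "\<dots> = bl k p (br q y)"
        by (rule bl_br) (use k p q lk Zn_add[OF lk Mlat_Zn[OF r]] dg_Mlat_add[OF r, of "l - k"] y' in
            \<open>simp_all add: algebra_simps\<close>)
      also have "\<dots> = bl l (br p q) y" using bl_br[OF k lk p q, of y] y by simp
      finally show "br p q \<in> {x \<in> dg l. bl (l + r) x y = bl l x y}" using dg_br[OF p q] by simp
    qed
    then show ?thesis by simp
  qed
  obtain B wt deg where B: "fin_basis sc B" "\<And>u. u \<in> B \<Longrightarrow> deg u \<in> Zn n" "\<And>u. u \<in> B \<Longrightarrow> u \<in> dg (deg u)"
    using homogeneous_basis by metis
  \<comment> \<open>Degree orthogonality is built in. For opposite classes the value is a component
    of \<open>\<beta>\<close>, and by \<open>periodic\<close> the representative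
    \<open>deg u\<close> may be replaced by any congruent degree.\<close>
  define b0 where "b0 u v = (if dcong (deg v) (- deg u) then bl (deg u) u v else 0)" for u v
  define bt where "bt x y = (\<Sum>u\<in>B. \<Sum>v\<in>B. coord sc B x u * coord sc B y v * b0 u v)" for x y
  have bt1: "linear_on sc (*) UNIV (\<lambda>x. bt x y)" for y
    by (rule linear_onI) (simp_all add: bt_def coord_add[OF B(1)] coord_scale[OF B(1)] algebra_simps
        sum.distrib sum_distrib_left)
  have bt2: "linear_on sc (*) UNIV (bt x)" for x
    by (rule linear_onI) (simp_all add: bt_def coord_add[OF B(1)] coord_scale[OF B(1)] algebra_simps
        sum.distrib sum_distrib_left)
  have fB: "finite B" using B(1) by (simp add: fin_basis_def)
  have bt_basis: "bt u v = b0 u v" if "u \<in> B" "v \<in> B" for u v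
  proof -
    have "bt u v = (\<Sum>x\<in>B. \<Sum>y\<in>B. if x = u then (if y = v then b0 u v else 0) else 0)"
      unfolding bt_def using that by (intro sum.cong refl) (simp add: coord_basis[OF B(1)])
    also have "\<dots> = (\<Sum>x\<in>B. if x = u then b0 u v else 0)"
      using fB that by (intro sum.cong refl) simp
    finally show ?thesis using fB that by simp
  qed
  have bt_dg: "bt x y = (if dcong m (- l) then bl l x y else 0)" (is "_ = ?c x y")
    if l: "l \<in> Zn n" and x: "x \<in> dg l" and y: "y \<in> dg m" for l m x y
  proof -
    have dgm: "dg m = dg (- l)" if "dcong m (- l)" by (rule dg_cong[OF that])
    have zero_lin: "linear_on sc (*) W (\<lambda>_. 0)" for W by (simp add: linear_on_def)
    have step: "bt u y = ?c u y" if u: "u \<in> B" "dcong (deg u) l" for u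
    proof (rule dg_sum_expansion[OF B(1,3) y bt2, where c = "?c u"])
      have ul: "u \<in> dg l" using B(3)[OF u(1)] dg_cong[OF u(2)] by simp
      show "linear_on sc (*) (dg m) (?c u)"
        using bl_lin2[OF l ul] zero_lin dgm by (cases "dcong m (- l)") simp_all
      fix v assume v: "v \<in> B" "dcong (deg v) m"
      have vm: "v \<in> dg m" using B(3)[OF v(1)] dg_cong[OF v(2)] by simp
      have "dcong (- deg u) (- l)" using u(2) by (simp add: dcong_def fun_apply dvd_diff_commute)
      then have cong: "dcong (deg v) (- deg u) \<longleftrightarrow> dcong m (- l)"
        using v(2) dcong_trans dcong_sym by blast
      have "bl (deg u) u v = bl l u v" if "dcong m (- l)"
        using periodic[OF l ul, of v "deg u - l"] vm dgm[OF that] dcong_Mlat[OF u(2) B(2)[OF u(1)] l] by simp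
      then show "bt u v = ?c u v" using cong by (simp add: bt_basis[OF u(1) v(1)] b0_def)
    qed
    show ?thesis
    proof (rule dg_sum_expansion[OF B(1,3) x bt1, where c = "\<lambda>x. ?c x y"])
      show "linear_on sc (*) (dg l) (\<lambda>x. ?c x y)"
        using bl_lin1[OF l] zero_lin y dgm by (cases "dcong m (- l)") simp_all
    qed (assumption | rule step)+
  qed
  have base: "bt (br u v) w = bt u (br v w)" if u: "u \<in> B" and v: "v \<in> B" and w: "w \<in> B" for u v w
  proof -
    have c: "dcong (deg w) (- (deg u + deg v)) \<longleftrightarrow> dcong (deg v + deg w) (- deg u)"
      by (simp add: dcong_def fun_apply algebra_simps)
    have "w \<in> dg (- (deg u + deg v))" if "dcong (deg w) (- (deg u + deg v))"
      using dg_cong[OF that] B(3)[OF w] by simp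
    then show ?thesis
      using bt_dg[OF Zn_add[OF B(2)[OF u] B(2)[OF v]] dg_br[OF B(3)[OF u] B(3)[OF v]] B(3)[OF w]]
        bt_dg[OF B(2)[OF u] B(3)[OF u] dg_br[OF B(3)[OF v] B(3)[OF w]]]
        bl_br[OF B(2)[OF u] B(2)[OF v] B(3)[OF u] B(3)[OF v], of w] c by auto
  qed
  note lin = linear_on_zero[OF bt1 subsp_UNIV] linear_on_zero[OF bt2 subsp_UNIV]
    linear_on_add[OF bt1] linear_on_add[OF bt2] linear_on_scale[OF bt1] linear_on_scale[OF bt2]
    b_add_left b_add_right b_scale_left b_scale_right
  have inv1: "bt (br u v) z = bt u (br v z)" if "u \<in> B" "v \<in> B" for u v z
    by (rule fin_basis_induct[OF B(1), where P = "\<lambda>z. bt (br u v) z = bt u (br v z)"])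
       (auto simp: lin base that)
  have inv2: "bt (br u y) z = bt u (br y z)" if "u \<in> B" for u y z
    by (rule fin_basis_induct[OF B(1), where P = "\<lambda>y. bt (br u y) z = bt u (br y z)"])
       (auto simp: lin inv1 that)
  have inv3: "bt (br x y) z = bt x (br y z)" for x y z
    by (rule fin_basis_induct[OF B(1), where P = "\<lambda>x. bt (br x y) z = bt x (br y z)"])
       (auto simp: lin inv2)
  obtain a where a: "\<And>x y. bt x y = a * kap x y"
    using invariant_form_unique[OF kap_nonzero ac bt1 bt2 inv3] by blast
  have "\<beta> x y = a * form x y" if x: "x \<in> L" and y: "y \<in> L" for x y
    using x y
  proof (induction x rule: L_induct_deg)
    case (sing l x)
    note s = sing_L[OF sing(1,2)] and lx = sing(1,2)
    from sing(3) show ?case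
    proof (induction y rule: L_induct_deg)
      case (sing m y)
      show ?case
      proof (cases "l + m = 0")
        case True
        then have m: "m = - l" by (simp add: eq_neg_iff_add_eq_0 add.commute)
        have "dcong m (- l)" by (simp add: m dcong_def)
        then have "\<beta> (sing l x) (sing m y) = bt x y"
          using bt_dg[OF lx sing(2)] by (simp add: bl_def m)
        then show ?thesis using True by (simp add: a form_sing)
      qed (use gr[OF lx(1) sing(1) lx(2) sing(2)] in \<open>simp add: form_sing\<close>)
    qed (simp_all add: linear_on_zero[OF l2[OF s] subsp_L] linear_on_add[OF l2[OF s]] form_add_right algebra_simps)
  qed (simp_all add: linear_on_zero[OF l1 subsp_L] linear_on_add[OF l1] form_add_left algebra_simps)
  then show ?thesis using that by blast
qed

section \<open>The support group of the grading by roots and degrees\<close>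

lemma dg_induct [consumes 1, case_names zero add root]:
  assumes x: "x \<in> dg l" and "P 0" "\<And>x y. x \<in> dg l \<Longrightarrow> y \<in> dg l \<Longrightarrow> P x \<Longrightarrow> P y \<Longrightarrow> P (x + y)"
    and "\<And>\<alpha> x. \<alpha> \<in> Qh G \<Longrightarrow> x \<in> rs \<alpha> \<Longrightarrow> x \<in> dg l \<Longrightarrow> P x"
  shows "P x"
proof -
  from dg_in_span[OF x] have "x \<in> dg l \<and> P x"
  proof (induction rule: span_induct_alt)
    case (step c x y)
    then obtain \<alpha> where \<alpha>: "\<alpha> \<in> Qh G" "sc c x \<in> rs \<alpha>" "sc c x \<in> dg l"
      using subsp_scale[OF subsp_rs] subsp_scale[OF subsp_dg] by blast
    then have "P (sc c x)" by (rule assms(4))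
    then show ?case using step \<alpha> assms(3) subsp_add[OF subsp_dg] by blast
  qed (simp add: assms subsp_0[OF subsp_dg])
  then show ?thesis by simp
qed

lemma Qh_0: "0 \<in> Qh G"
  unfolding Qh_def by (rule gen_zero)

lemma Qh_diff: "\<alpha> \<in> Qh G \<Longrightarrow> \<beta> \<in> Qh G \<Longrightarrow> \<alpha> - \<beta> \<in> Qh G"
  unfolding Qh_def by (rule gen_diff)

lemma Lgr_eq:
  assumes "l \<in> Zn n"
  shows "Lgr n zeta G \<alpha> l = sing l ` (rs \<alpha> \<inter> dg l)"
proof
  show "Lgr n zeta G \<alpha> l \<subseteq> sing l ` (rs \<alpha> \<inter> dg l)"
  proof
    fix f assume f: "f \<in> Lgr n zeta G \<alpha> l"
    then have "f = sing l (f l)" by (intro ext) (simp add: Lgr_def sing_apply)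
    then show "f \<in> sing l ` (rs \<alpha> \<inter> dg l)" using f by (auto simp: Lgr_def)
  qed
  show "sing l ` (rs \<alpha> \<inter> dg l) \<subseteq> Lgr n zeta G \<alpha> l"
    using sing_L[OF assms] by (auto simp: Lgr_def) (simp_all add: sing_apply)
qed

lemma sing_eq_0_iff [simp]: "sing l x = 0 \<longleftrightarrow> x = (0::'a)"
proof
  assume "sing l x = 0"
  from fun_cong[OF this, of l] show "x = 0" by (simp add: zero_fun_apply)
qed simp

lemma LsuppI:
  assumes "\<alpha> \<in> Qh G" "l \<in> Zn n" "x \<in> rs \<alpha>" "x \<in> dg l" "x \<noteq> 0"
  shows "(\<alpha>, l) \<in> Lsupp n zeta G"
proof -
  have 1: "sing l x \<in> Lgr n zeta G \<alpha> l" using assms by (simp add: Lgr_eq)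
  have 2: "sing l x \<noteq> 0" using assms(5) by simp
  have "Lgr n zeta G \<alpha> l \<noteq> {0}"
  proof
    assume "Lgr n zeta G \<alpha> l = {0}"
    then have "sing l x \<in> {0}" using 1 by (simp only:)
    then show False using 2 by (simp only: singleton_iff)
  qed
  then show ?thesis using assms(1,2) by (simp only: Lsupp_def mem_Collect_eq case_prod_conv simp_thms)
qed


abbreviation A where "A \<equiv> gen_grp (Lsupp n zeta G)"

lemma A_sub: "(\<alpha>, l) \<in> A \<Longrightarrow> \<alpha> \<in> Qh G \<and> l \<in> Zn n"
proof -
  have "x \<in> A \<Longrightarrow> fst x \<in> Qh G \<and> snd x \<in> Zn n" for x
  proof (induction rule: gen_grp.induct)
    case gen_zero
    show ?case using Qh_0 by simp
  next
    case (gen_base x)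
    then show ?case by (auto simp: Lsupp_def)
  next
    case (gen_diff x y)
    then show ?case using Qh_diff Zn_diff by simp
  qed
  then show "(\<alpha>, l) \<in> A \<Longrightarrow> \<alpha> \<in> Qh G \<and> l \<in> Zn n" by fastforce
qed

text \<open>A nonzero Cartan element times the monomial of degree \<open>\<mu>\<close> has root zero
  and degree \<open>\<mu>\<close>.\<close>

lemma Mlat_A: "\<mu> \<in> Mlat \<Longrightarrow> (0, \<mu>) \<in> A"
proof -
  assume \<mu>: "\<mu> \<in> Mlat"
  obtain t where t: "t \<in> dg 0" "t \<in> rs 0" "t \<noteq> 0" by (rule ex_nonzero_h)
  then show ?thesis
    using LsuppI[OF Qh_0 Mlat_Zn[OF \<mu>] t(2) _ t(3)] dg_Mlat[OF \<mu>] gen_base by blast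
qed

text \<open>A nonzero root vector has a homogeneous basis vector of the same root in its expansion,
  which supplies a degree; differences of pairs then reach the whole root lattice.\<close>

lemma Qh_A:
  assumes "\<alpha> \<in> Qh G"
  obtains l where "(\<alpha>, l) \<in> A"
proof -
  have "\<exists>l. (\<alpha>, l) \<in> A"
    using assms unfolding Qh_def
  proof (induction rule: gen_grp.induct)
    case gen_zero
    show ?case using Mlat_A[OF Mlat_0] by blast
  next
    case (gen_base \<alpha>)
    then have \<alpha>: "\<alpha> \<in> weights G" by simp
    then obtain x where x: "x \<in> rs \<alpha>" "x \<noteq> 0"
      using subsp_0[OF subsp_rs, of \<alpha>] by (auto simp: weights_def)
    obtain B wt deg where B: "fin_basis sc B"
      "\<And>u. u \<in> B \<Longrightarrow> u \<noteq> 0" "\<And>u. u \<in> B \<Longrightarrow> wt u \<in> weights G" "\<And>u. u \<in> B \<Longrightarrow> deg u \<in> Zn n"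
      "\<And>u. u \<in> B \<Longrightarrow> u \<in> rs (wt u)" "\<And>u. u \<in> B \<Longrightarrow> u \<in> dg (deg u)"
      using homogeneous_basis by metis
    have "\<exists>u\<in>B. coord sc B x u \<noteq> 0"
    proof (rule ccontr)
      assume "\<not> ?thesis"
      then have "(\<Sum>u\<in>B. sc (coord sc B x u) u) = 0" by (intro sum.neutral) simp
      then show False using x(2) by (simp add: coord_sum[OF B(1)])
    qed
    then obtain u where u: "u \<in> B" "coord sc B x u \<noteq> 0" by blast
    have "wt u = \<alpha>" by (rule coord_wt[OF B(1,3,5) x(1) weights_normal[OF \<alpha>] u])
    then have "(\<alpha>, deg u) \<in> Lsupp n zeta G"
      using LsuppI[OF weights_Qh[OF \<alpha>] B(4)[OF u(1)] _ B(6)[OF u(1)] B(2)[OF u(1)]] B(5)[OF u(1)] by simp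
    then show ?case using gen_grp.gen_base by blast
  next
    case (gen_diff x y)
    then obtain l m where "(x, l) \<in> A" "(y, m) \<in> A" by blast
    then have "(x, l) - (y, m) \<in> A" by (rule gen_grp.gen_diff)
    then show ?case by auto
  qed
  then show ?thesis using that by blast
qed

text \<open>The extension takes the value \<open>f (e i 1) / m_i\<close> at the \<open>i\<close>-th
  unit vector, where \<open>e i 1\<close> is \<open>m_i\<close> times that vector; the division is
  possible in characteristic 0.\<close>

lemma Mlat_functional:
  fixes f :: "(nat \<Rightarrow> int) \<Rightarrow> 'k"
  assumes add: "\<And>\<mu> \<nu>. \<mu> \<in> Mlat \<Longrightarrow> \<nu> \<in> Mlat \<Longrightarrow> f (\<mu> + \<nu>) = f \<mu> + f \<nu>"
  obtains \<theta> where "\<theta> \<in> Th n" "\<And>\<mu>. \<mu> \<in> Mlat \<Longrightarrow> \<theta> \<mu> = f \<mu>"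
proof -
  define e where "e i c = (\<lambda>j. if j = i then c * int (mord G i) else 0)" for i c
  have e_M: "e i c \<in> Mlat" if "i < n" for i c using that by (simp add: e_def Mlat_def Zn_def)
  have e_add: "e i (c + d) = e i c + e i d" for i c d
    by (rule ext) (simp add: e_def plus_fun_apply algebra_simps)
  have f0: "f 0 = 0" using add[OF Mlat_0 Mlat_0] by simp
  have e0: "e i 0 = 0" for i by (rule ext) (simp add: e_def zero_fun_apply)
  have f_nat: "f (e i (int c)) = of_nat c * f (e i 1)" if "i < n" for i c
  proof (induction c)
    case (Suc c)
    have "e i (int (Suc c)) = e i (int c) + e i 1" by (simp add: add.commute flip: e_add)
    then show ?case using Suc add[OF e_M[OF that] e_M[OF that]] by (simp add: algebra_simps)
  qed (simp add: e0 f0)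
  have f_int: "f (e i c) = of_int c * f (e i 1)" if i: "i < n" for i c
  proof (cases "c \<ge> 0")
    case True
    then show ?thesis using f_nat[OF i, of "nat c"] by simp
  next
    case False
    have "f (e i c) + f (e i (- c)) = 0"
      using add[OF e_M[OF i] e_M[OF i], of c "- c"] e_add[of i c "- c"] by (simp add: e0 f0)
    moreover have "f (e i (- c)) = - (of_int c * f (e i 1))"
      using f_nat[OF i, of "nat (- c)"] False by simp
    ultimately show ?thesis by simp
  qed
  define \<theta> where "\<theta> l = (\<Sum>i<n. (f (e i 1) / of_nat (mord G i)) * of_int (l i))" for l :: "nat \<Rightarrow> int"
  have \<theta>: "\<theta> \<in> Th n" 
    unfolding Th_def \<theta>_def
    by (intro CollectI exI[of _ "\<lambda>i. f (e i 1) / of_nat (mord G i)"] allI refl)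
  have \<theta>e: "\<theta> (e i c) = f (e i c)" if i: "i < n" for i c
  proof -
    have "\<theta> (e i c) = (\<Sum>j<n. if j = i then of_int c * f (e i 1) else 0)"
      unfolding \<theta>_def
    proof (rule sum.cong[OF refl])
      fix j
      show "f (e j 1) / of_nat (mord G j) * of_int (e i c j) = (if j = i then of_int c * f (e i 1) else 0)"
      proof (cases "j = i")
        case True
        have "e i c i = c * int (mord G i)" by (simp only: e_def simp_thms if_True)
        moreover have "(of_nat (mord G i) :: 'k) \<noteq> 0" using mord_pos[OF i] by simp
        ultimately show ?thesis using True by simp
      next
        case False
        then have "e i c j = 0" by (simp only: e_def simp_thms if_False)
        then show ?thesis using False by simp
      qed
    qed
    then show ?thesis using i f_int[OF i, of c] by simp
  qed
  \<comment> \<open>Induction on a bound \<open>k\<close> for the support: subtracting the right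
    multiple of the last generator clears the last coordinate.\<close>
  have "\<forall>\<mu>\<in>Mlat. (\<forall>j\<ge>k. \<mu> j = 0) \<longrightarrow> \<theta> \<mu> = f \<mu>" if "k \<le> n" for k
    using that
  proof (induction k)
    case 0
    show ?case
    proof (intro ballI impI)
      fix \<mu> :: "nat \<Rightarrow> int" assume "\<forall>j\<ge>0. \<mu> j = 0"
      then have "\<mu> = 0" by (intro ext) (simp add: zero_fun_apply)
      then show "\<theta> \<mu> = f \<mu>" using f0 Th_at_0[OF \<theta>] by simp
    qed
  next
    case (Suc k)
    then have k: "k < n" by simp
    show ?case
    proof (intro ballI impI)
      fix \<mu> assume \<mu>: "\<mu> \<in> Mlat" "\<forall>j\<ge>Suc k. \<mu> j = 0"
      let ?e = "e k (\<mu> k div int (mord G k))"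
      have ek: "?e k = \<mu> k" using \<mu>(1) k by (simp add: e_def Mlat_def)
      have m: "\<mu> - ?e \<in> Mlat" by (rule Mlat_diff[OF \<mu>(1) e_M[OF k]])
      have "\<forall>j\<ge>k. (\<mu> - ?e) j = 0"
      proof (intro allI impI)
        fix j assume "j \<ge> k"
        then show "(\<mu> - ?e) j = 0"
          using ek \<mu>(2) by (cases "j = k") (simp_all add: minus_apply, simp add: e_def)
      qed
      then have "\<theta> (\<mu> - ?e) = f (\<mu> - ?e)" using Suc m by simp
      then show "\<theta> \<mu> = f \<mu>"
        using Th_add[OF \<theta>, of "\<mu> - ?e" ?e] add[OF m e_M[OF k, of "\<mu> k div int (mord G k)"]] \<theta>e[OF k] by simp
    qed
  qed
  from this[of n] have "\<theta> \<mu> = f \<mu>" if "\<mu> \<in> Mlat" for \<mu> using that Mlat_Zn[OF that] by (auto simp: Zn_def)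
  then show ?thesis using that \<theta> by blast
qed

text \<open>Finite index of the lattice with one uniform multiplier, which lets additive identities
  on the lattice be pulled back to \<open>Zn\<close>.\<close>

lemma ex_Mlat_multiple:
  obtains N :: nat where "N > 0" "\<And>l. l \<in> Zn n \<Longrightarrow> (\<lambda>i. int N * l i) \<in> Mlat"
proof (rule that[of "\<Prod>i<n. mord G i"])
  show "(\<Prod>i<n. mord G i) > 0" using mord_pos by (simp add: prod_pos)
  show "(\<lambda>i. int (\<Prod>i<n. mord G i) * l i) \<in> Mlat" if "l \<in> Zn n" for l
    using that unfolding Mlat_def Zn_def
    by (auto intro!: dvd_mult2 dvd_prodI simp flip: int_dvd_int_iff)
qed

text \<open>Excludes the scale factor 0 in \<open>form_scalar\<close>. A pair of basis vectors with
  nonzero Killing value has opposite degree classes, so it can be lifted to opposite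
  degrees.\<close>

lemma form_nonzero: "\<exists>x\<in>L. \<exists>y\<in>L. form x y \<noteq> 0"
proof -
  obtain B wt deg where B: "fin_basis sc B" "\<And>u. u \<in> B \<Longrightarrow> deg u \<in> Zn n" "\<And>u. u \<in> B \<Longrightarrow> u \<in> dg (deg u)"
    using homogeneous_basis by metis
  note lin = linear_on_zero[OF kap_linear_left subsp_UNIV] linear_on_zero[OF kap_linear_right subsp_UNIV]
    linear_on_add[OF kap_linear_left] linear_on_add[OF kap_linear_right]
    linear_on_scale[OF kap_linear_left] linear_on_scale[OF kap_linear_right]
  have "\<exists>u\<in>B. \<exists>v\<in>B. kap u v \<noteq> 0"
  proof (rule ccontr)
    assume *: "\<not> ?thesis"
    have 1: "kap u y = 0" if "u \<in> B" for u y
      by (rule fin_basis_induct[OF B(1), where P = "\<lambda>y. kap u y = 0"]) (use * that in \<open>auto simp: lin\<close>)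
    have "kap x y = 0" for x y
      by (rule fin_basis_induct[OF B(1), where P = "\<lambda>x. kap x y = 0"]) (auto simp: lin 1)
    then show False using kap_nonzero by blast
  qed
  then obtain u v where uv: "u \<in> B" "v \<in> B" "kap u v \<noteq> 0" by blast
  have "v \<in> dg (- deg u)"
    using dg_cong[OF kap_dg_orth[OF B(3)[OF uv(1)] B(3)[OF uv(2)] uv(3)]] B(3)[OF uv(2)] by simp
  then have "sing (deg u) u \<in> L" "sing (- deg u) v \<in> L"
    using sing_L B(2,3)[OF uv(1)] Zn_uminus by blast+
  moreover have "form (sing (deg u) u) (sing (- deg u) v) \<noteq> 0" using uv(3) by (simp add: form_sing)
  ultimately show ?thesis by blast
qed

end

section \<open>Transport along a support-isomorphism\<close>

locale multiloop_pair = M: multiloop n zeta G + M': multiloop n zeta G'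
  for n :: nat and zeta :: "nat \<Rightarrow> 'k::field_char_0"
    and G :: "('k, 'a::ab_group_add) mldatum" and G' :: "('k, 'b::ab_group_add) mldatum" +
  fixes \<phi> :: "'a lp \<Rightarrow> 'b lp"
    and \<psi> :: "('a \<Rightarrow> 'k) \<times> (nat \<Rightarrow> int) \<Rightarrow> ('b \<Rightarrow> 'k) \<times> (nat \<Rightarrow> int)"
  assumes phi_iso: "lie_iso (Lsc G) (Lbr G) (Lcar n zeta G) (Lsc G') (Lbr G') (Lcar n zeta G') \<phi>"
    and psi_bij: "bij_betw \<psi> (gen_grp (Lsupp n zeta G)) (gen_grp (Lsupp n zeta G'))"
    and psi_add: "\<And>x y. x \<in> gen_grp (Lsupp n zeta G) \<Longrightarrow> y \<in> gen_grp (Lsupp n zeta G) \<Longrightarrow>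
      \<psi> (x + y) = \<psi> x + \<psi> y"
    and phi_Lgr: "\<And>\<alpha> l. (\<alpha>, l) \<in> gen_grp (Lsupp n zeta G) \<Longrightarrow>
      \<phi> ` Lgr n zeta G \<alpha> l = Lgr n zeta G' (fst (\<psi> (\<alpha>, l))) (snd (\<psi> (\<alpha>, l)))"
begin

lemma phi_bij: "bij_betw \<phi> M.L M'.L"
  and phi_lin: "linear_on M.lsc M'.lsc M.L \<phi>"
  and phi_br: "x \<in> M.L \<Longrightarrow> y \<in> M.L \<Longrightarrow> \<phi> (M.lbr x y) = M'.lbr (\<phi> x) (\<phi> y)"
  using phi_iso by (auto simp: lie_iso_def)

lemma phi_L: "x \<in> M.L \<Longrightarrow> \<phi> x \<in> M'.L"
  using phi_bij by (auto simp: bij_betw_def)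

lemmas phi_add = linear_on_add[OF phi_lin] and phi_scale = linear_on_scale[OF phi_lin]
  and phi_0 = linear_on_zero[OF phi_lin M.subsp_L]
  and phi_diff = linear_on_diff[OF phi_lin M.vs_lsc M'.vs_lsc M.subsp_L]

abbreviation \<phi>i where "\<phi>i \<equiv> inv_into M.L \<phi>"
abbreviation \<psi>i where "\<psi>i \<equiv> inv_into M.A \<psi>"

lemma phi_inv: "x \<in> M.L \<Longrightarrow> \<phi>i (\<phi> x) = x"
  and phi_inv': "y \<in> M'.L \<Longrightarrow> \<phi> (\<phi>i y) = y"
  and phi_inv_L: "y \<in> M'.L \<Longrightarrow> \<phi>i y \<in> M.L"
  using phi_bij by (auto simp: bij_betw_def inv_into_f_f f_inv_into_f inv_into_into)

lemma phi_eq_0: "x \<in> M.L \<Longrightarrow> \<phi> x = 0 \<Longrightarrow> x = 0"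
  using phi_inv[of x] phi_inv[OF M.L_0] phi_0 by simp

lemma psi_inv: "x \<in> M.A \<Longrightarrow> \<psi>i (\<psi> x) = x"
  and psi_inv': "y \<in> M'.A \<Longrightarrow> \<psi> (\<psi>i y) = y"
  and psi_inv_A: "y \<in> M'.A \<Longrightarrow> \<psi>i y \<in> M.A"
  and psi_A: "x \<in> M.A \<Longrightarrow> \<psi> x \<in> M'.A"
  using psi_bij by (auto simp: bij_betw_def inv_into_f_f f_inv_into_f inv_into_into)

lemma psi_0: "\<psi> 0 = 0"
  using psi_add[OF gen_zero gen_zero] by simp

lemma phi_sing:
  assumes "(\<alpha>, l) \<in> M.A" "x \<in> M.rs \<alpha>" "x \<in> M.dg l"
  obtains x' where "\<phi> (sing l x) = sing (snd (\<psi> (\<alpha>, l))) x'"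
    "x' \<in> M'.rs (fst (\<psi> (\<alpha>, l)))" "x' \<in> M'.dg (snd (\<psi> (\<alpha>, l)))"
proof -
  have l: "l \<in> Zn n" "snd (\<psi> (\<alpha>, l)) \<in> Zn n"
    using M.A_sub[OF assms(1)] M'.A_sub[of "fst (\<psi> (\<alpha>, l))"] psi_A[OF assms(1)] by auto
  have "sing l x \<in> Lgr n zeta G \<alpha> l" using assms by (simp add: M.Lgr_eq[OF l(1)])
  then have "\<phi> (sing l x) \<in> Lgr n zeta G' (fst (\<psi> (\<alpha>, l))) (snd (\<psi> (\<alpha>, l)))"
    using phi_Lgr[OF assms(1)] by blast
  then show ?thesis unfolding M'.Lgr_eq[OF l(2)] using that by blast
qed

lemma phi_sing_surj:
  assumes "(\<alpha>', l') \<in> M'.A" "x' \<in> M'.rs \<alpha>'" "x' \<in> M'.dg l'"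
  obtains \<alpha> l x where "(\<alpha>, l) \<in> M.A" "\<psi> (\<alpha>, l) = (\<alpha>', l')" "x \<in> M.rs \<alpha>" "x \<in> M.dg l"
    "\<phi> (sing l x) = sing l' x'"
proof -
  obtain \<alpha> l where al: "\<psi>i (\<alpha>', l') = (\<alpha>, l)" by (cases "\<psi>i (\<alpha>', l')")
  have A: "(\<alpha>, l) \<in> M.A" "\<psi> (\<alpha>, l) = (\<alpha>', l')"
    using psi_inv_A[OF assms(1)] psi_inv'[OF assms(1)] al by auto
  have l: "l \<in> Zn n" "l' \<in> Zn n" using M.A_sub[OF A(1)] M'.A_sub[OF assms(1)] by auto
  have "sing l' x' \<in> Lgr n zeta G' \<alpha>' l'" using assms by (simp add: M'.Lgr_eq[OF l(2)])
  then have "sing l' x' \<in> \<phi> ` Lgr n zeta G \<alpha> l" using phi_Lgr[OF A(1)] A(2) by simp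
  then obtain x where "x \<in> M.rs \<alpha>" "x \<in> M.dg l" "sing l' x' = \<phi> (sing l x)"
    unfolding M.Lgr_eq[OF l(1)] by blast
  then show ?thesis using that A by metis
qed

text \<open>The hypotheses are symmetric, so every fact about \<open>\<phi>\<close> and
  \<open>\<psi>\<close> is also available for the inverses; this is how \<open>q\<close> and
  \<open>Psi\<close> arise.\<close>

lemma inverse_pair: "multiloop_pair n zeta G' G \<phi>i \<psi>i"
proof (intro multiloop_pair.intro multiloop_pair_axioms.intro)
  show "multiloop n zeta G'" "multiloop n zeta G" by unfold_locales
  have add: "\<phi>i (x + y) = \<phi>i x + \<phi>i y" if "x \<in> M'.L" "y \<in> M'.L" for x y
    using phi_inv[OF M.L_add[OF phi_inv_L[OF that(1)] phi_inv_L[OF that(2)]]] that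
    by (simp add: phi_add phi_inv_L phi_inv')
  have scale: "\<phi>i (M'.lsc a x) = M.lsc a (\<phi>i x)" if "x \<in> M'.L" for a x
    using phi_inv[OF M.L_scale[OF phi_inv_L[OF that]], of a] that
    by (simp add: phi_scale phi_inv_L phi_inv')
  have br: "\<phi>i (M'.lbr x y) = M.lbr (\<phi>i x) (\<phi>i y)" if "x \<in> M'.L" "y \<in> M'.L" for x y
    using phi_inv[OF M.lbr_L[OF phi_inv_L[OF that(1)] phi_inv_L[OF that(2)]]] that
    by (simp add: phi_br phi_inv_L phi_inv')
  show "lie_iso M'.lsc M'.lbr M'.L M.lsc M.lbr M.L \<phi>i"
    using bij_betw_inv_into[OF phi_bij] add scale br by (auto simp: lie_iso_def intro!: linear_onI)
  show "bij_betw \<psi>i M'.A M.A" by (rule bij_betw_inv_into[OF psi_bij])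
  show "\<psi>i (x + y) = \<psi>i x + \<psi>i y" if "x \<in> M'.A" "y \<in> M'.A" for x y
    using psi_inv[OF gen_grp_add[OF psi_inv_A[OF that(1)] psi_inv_A[OF that(2)]]] that
    by (simp add: psi_add psi_inv_A psi_inv')
  show "\<phi>i ` Lgr n zeta G' \<alpha> l = Lgr n zeta G (fst (\<psi>i (\<alpha>, l))) (snd (\<psi>i (\<alpha>, l)))"
    if "(\<alpha>, l) \<in> M'.A" for \<alpha> l
  proof -
    obtain \<beta> m where bm: "\<psi>i (\<alpha>, l) = (\<beta>, m)" by (cases "\<psi>i (\<alpha>, l)")
    have A: "(\<beta>, m) \<in> M.A" "\<psi> (\<beta>, m) = (\<alpha>, l)"
      using psi_inv_A[OF that] psi_inv'[OF that] bm by auto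
    have sub: "Lgr n zeta G \<beta> m \<subseteq> M.L" by (auto simp: Lgr_def)
    have "\<phi>i ` Lgr n zeta G' \<alpha> l = \<phi>i ` \<phi> ` Lgr n zeta G \<beta> m" using phi_Lgr[OF A(1)] A(2) by simp
    also have "\<dots> = (\<lambda>x. x) ` Lgr n zeta G \<beta> m"
      unfolding image_image by (rule image_cong[OF refl]) (use sub phi_inv in blast)
    finally show ?thesis using bm by simp
  qed
qed

section \<open>The isomorphism of the centroid lattices\<close>

definition p :: "(nat \<Rightarrow> int) \<Rightarrow> nat \<Rightarrow> int" where
  "p \<mu> = snd (\<psi> (0, \<mu>))"

text \<open>Since \<open>\<psi>\<close> fixes \<open>(0, 0)\<close>, each \<open>y\<close> of the
  second Cartan subalgebra, placed in degree 0, comes from the first one in degree 0. There it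
  commutes with the monomial \<open>sing \<mu> t\<close>, so \<open>y\<close> commutes with the
  nonzero root vector \<open>t'\<close>, and the root \<open>\<alpha>'\<close> vanishes at
  \<open>y\<close>.\<close>

lemma psi_Mlat_root:
  assumes \<mu>: "\<mu> \<in> M.Mlat"
  shows "\<psi> (0, \<mu>) = (0, p \<mu>)"
proof -
  obtain \<alpha>' l' where al: "\<psi> (0, \<mu>) = (\<alpha>', l')" by (cases "\<psi> (0, \<mu>)")
  note A = M.Mlat_A[OF \<mu>]
  have A': "(\<alpha>', l') \<in> M'.A" using psi_A[OF A] al by simp
  obtain t where t: "t \<in> M.\<h>" "t \<noteq> 0" "t \<in> M.dg 0" "t \<in> M.rs 0" by (rule M.ex_nonzero_h)
  have t\<mu>: "t \<in> M.dg \<mu>" using t(3) M.dg_Mlat[OF \<mu>] by simp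
  obtain t' where t': "\<phi> (sing \<mu> t) = sing l' t'" "t' \<in> M'.rs \<alpha>'"
    using phi_sing[OF A t(4) t\<mu>] al by auto
  have sL: "sing \<mu> t \<in> M.L" by (rule M.sing_L[OF M.Mlat_Zn[OF \<mu>] t\<mu>])
  have "t' \<noteq> 0"
  proof
    assume "t' = 0"
    then have "sing \<mu> t = 0" using t' by (intro phi_eq_0[OF sL]) simp
    then show False using t(2) by simp
  qed
  have "\<alpha>' y = 0" for y
  proof (cases "y \<in> M'.\<h>")
    case True
    have "(0, 0) \<in> M'.A" using M'.Mlat_A[OF M'.Mlat_0] .
    moreover have "y \<in> M'.rs 0" "y \<in> M'.dg 0" using True M'.h_eq by auto
    ultimately obtain \<beta> m x where x: "(\<beta>, m) \<in> M.A" "\<psi> (\<beta>, m) = (0, 0)" "x \<in> M.rs \<beta>" "x \<in> M.dg m"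
      "\<phi> (sing m x) = sing 0 y" by (rule phi_sing_surj)
    have "(\<beta>, m) = 0" using psi_inv[OF x(1)] psi_inv[OF gen_zero] x(2) psi_0 by (simp add: zero_prod_def)
    then have bm: "\<beta> = 0" "m = 0" by (auto simp: zero_prod_def)
    then have "x \<in> M.\<h>" using x M.h_eq by blast
    then have "M.lbr (sing m x) (sing \<mu> t) = 0" using t(1) by (simp add: M.lbr_sing M.h_abelian)
    moreover have "sing m x \<in> M.L" using x(4) bm M.sing_L[OF Zn_0] by simp
    ultimately have "M'.lbr (sing 0 y) (sing l' t') = 0"
      using phi_br[OF _ sL, of "sing m x"] by (simp add: phi_0 x(5) t'(1))
    then have "M'.br y t' = 0" by (simp add: M'.lbr_sing)
    then show ?thesis using t'(2) True \<open>t' \<noteq> 0\<close> by (simp add: rootsp_def)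
  next
    case False
    then show ?thesis using M'.Qh_normal M'.A_sub[OF A'] by (simp add: M'.normal_def)
  qed
  then have "\<alpha>' = 0" by (intro ext) (simp add: zero_fun_apply)
  then show ?thesis using al by (simp add: p_def)
qed

lemma p_add: "\<mu> \<in> M.Mlat \<Longrightarrow> \<nu> \<in> M.Mlat \<Longrightarrow> p (\<mu> + \<nu>) = p \<mu> + p \<nu>"
  using psi_add[OF M.Mlat_A M.Mlat_A, of \<mu> \<nu>] psi_Mlat_root[of \<mu>] psi_Mlat_root[of \<nu>]
    psi_Mlat_root[OF M.Mlat_add, of \<mu> \<nu>] by simp

text \<open>The conjugate \<open>c\<close> of the shift by \<open>\<mu>\<close> commutes with all
  \<open>ad x\<close> and is homogeneous of degree \<open>p \<mu>\<close>, hence a scalar multiple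
  of one shift. It is nonzero because \<open>\<phi>\<close> is injective, and this forces
  \<open>p \<mu>\<close> into the second lattice.\<close>

lemma centroid_transport:
  assumes \<mu>: "\<mu> \<in> M.Mlat"
  obtains a where "p \<mu> \<in> M'.Mlat"
    "\<And>x. x \<in> M.L \<Longrightarrow> \<phi> (M.sd \<mu> (\<lambda>_. 1) x) = M'.sd (p \<mu>) (\<lambda>_. a) (\<phi> x)"
proof -
  define c where "c x = (if x \<in> M'.L then \<phi> (M.sd \<mu> (\<lambda>_. 1) (\<phi>i x)) else 0)" for x
  interpret I: multiloop_pair n zeta G' G \<phi>i \<psi>i by (rule inverse_pair)
  have c_lin: "linear_on M'.lsc M'.lsc M'.L c"
    by (rule linear_onI)
       (simp_all add: c_def M'.L_add M'.L_scale I.phi_add I.phi_scale phi_add phi_scale phi_inv_L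
         linear_on_add[OF M.sd_linear] linear_on_scale[OF M.sd_linear] M.sd_L[OF \<mu>])
  have c_phi: "c (\<phi> x) = \<phi> (M.sd \<mu> (\<lambda>_. 1) x)" if "x \<in> M.L" for x
    using that by (simp add: c_def phi_L phi_inv)
  have p\<mu>: "p \<mu> \<in> Zn n"
    using M'.A_sub[of 0 "p \<mu>"] psi_A[OF M.Mlat_A[OF \<mu>]] psi_Mlat_root[OF \<mu>] by simp
  have "c \<in> Cent_deg n zeta G' (p \<mu>)"
  proof (rule M'.Cent_degI)
    show "c x = 0" if "x \<notin> M'.L" for x using that by (simp add: c_def)
    show "c x \<in> M'.L" if "x \<in> M'.L" for x using that by (simp add: c_def phi_L M.sd_L[OF \<mu>] phi_inv_L)
    show "c (M'.lbr x y) = M'.lbr x (c y)" if xy: "x \<in> M'.L" "y \<in> M'.L" for x y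
    proof -
      have "c (M'.lbr x y) = \<phi> (M.sd \<mu> (\<lambda>_. 1) (M.lbr (\<phi>i x) (\<phi>i y)))"
        using xy by (simp add: c_def M'.lbr_L I.phi_br)
      also have "\<dots> = \<phi> (M.lbr (\<phi>i x) (M.sd \<mu> (\<lambda>_. 1) (\<phi>i y)))"
        using M.Cent_degD(4)[OF M.sh_Cent[OF \<mu>, of 1] phi_inv_L[OF xy(1)] phi_inv_L[OF xy(2)]] by simp
      also have "\<dots> = M'.lbr x (c y)"
        using xy by (simp add: phi_br phi_inv_L M.sd_L[OF \<mu>] phi_inv' c_def)
      finally show ?thesis .
    qed
    show "\<exists>y. c (sing l x) = sing (p \<mu> + l) y" if l: "l \<in> Zn n" and x: "x \<in> M'.dg l" for l x
      using x
    proof (induction x rule: M'.dg_induct)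
      case zero
      show ?case using linear_on_zero[OF c_lin M'.subsp_L] by (intro exI[of _ 0]) simp
    next
      case (add x y)
      then obtain u v where "c (sing l x) = sing (p \<mu> + l) u" "c (sing l y) = sing (p \<mu> + l) v" by blast
      then have "c (sing l (x + y)) = sing (p \<mu> + l) (u + v)"
        using linear_on_add[OF c_lin M'.sing_L[OF l add(1)] M'.sing_L[OF l add(2)]] by (simp add: sing_add)
      then show ?case by blast
    next
      case (root \<alpha>' x')
      show ?case
      proof (cases "x' = 0")
        case True
        then show ?thesis using linear_on_zero[OF c_lin M'.subsp_L] by (intro exI[of _ 0]) simp
      next
        case False
        have A': "(\<alpha>', l) \<in> M'.A" by (rule gen_base, rule M'.LsuppI[OF root(1) l root(2,3) False])
        obtain \<alpha> m x where x: "(\<alpha>, m) \<in> M.A" "\<psi> (\<alpha>, m) = (\<alpha>', l)" "x \<in> M.rs \<alpha>" "x \<in> M.dg m"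
          "\<phi> (sing m x) = sing l x'" by (rule phi_sing_surj[OF A' root(2,3)])
        have m: "m \<in> Zn n" using M.A_sub[OF x(1)] by simp
        have "(\<alpha>, m) + (0, \<mu>) \<in> M.A" by (rule gen_grp_add[OF x(1) M.Mlat_A[OF \<mu>]])
        then have A: "(\<alpha>, m + \<mu>) \<in> M.A" by simp
        \<comment> \<open>Since \<open>\<psi> (0, \<mu>)\<close> has root zero, the degree moves by
          \<open>p \<mu>\<close> whatever the root is.\<close>
        have "\<psi> (\<alpha>, m + \<mu>) = (\<alpha>', l + p \<mu>)"
          using psi_add[OF x(1) M.Mlat_A[OF \<mu>]] x(2) psi_Mlat_root[OF \<mu>] by simp
        moreover have "x \<in> M.dg (m + \<mu>)" using x(4) M.dg_Mlat_add[OF \<mu>] by simp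
        ultimately obtain y where y: "\<phi> (sing (m + \<mu>) x) = sing (l + p \<mu>) y"
          using phi_sing[OF A x(3)] by auto
        have "c (sing l x') = \<phi> (M.sd \<mu> (\<lambda>_. 1) (sing m x))"
          using c_phi[OF M.sing_L[OF m x(4)]] x(5) by simp
        also have "\<dots> = sing (p \<mu> + l) y" by (simp add: M.sd_sing[OF m x(4)] y) (simp add: add.commute)
        finally show ?thesis by blast
      qed
    qed
  qed (rule c_lin)
  then obtain a where a: "a = 0 \<or> p \<mu> \<in> M'.Mlat" "c = M'.sd (p \<mu>) (\<lambda>_. a)"
    using M'.Cent_deg_scalar[OF p\<mu>] by metis
  have "a \<noteq> 0"
  proof
    assume "a = 0"
    then have "c = 0" using a(2) M'.sd_zero[of "p \<mu>"] by (simp add: zero_fun_def)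
    obtain t where t: "t \<in> M.\<h>" "t \<noteq> 0" "t \<in> M.dg 0" "t \<in> M.rs 0" by (rule M.ex_nonzero_h)
    have t\<mu>: "t \<in> M.dg \<mu>" using t(3) M.dg_Mlat[OF \<mu>] by simp
    have tL: "sing 0 t \<in> M.L" "sing \<mu> t \<in> M.L" using M.sing_L[OF Zn_0 t(3)] M.sing_L[OF M.Mlat_Zn[OF \<mu>] t\<mu>] by auto
    have "\<phi> (sing \<mu> t) = 0"
      using c_phi[OF tL(1)] \<open>c = 0\<close> by (simp add: M.sd_sing[OF Zn_0 t(3)] zero_fun_apply[of "\<phi> (sing 0 t)"])
    then have "sing \<mu> t = 0" by (rule phi_eq_0[OF tL(2)])
    then show False using t(2) by simp
  qed
  then show ?thesis using that[of a] a c_phi by auto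
qed

lemma p_Mlat: "\<mu> \<in> M.Mlat \<Longrightarrow> p \<mu> \<in> M'.Mlat"
  using centroid_transport by metis

lemma phi_CH: "y \<in> M.CH \<Longrightarrow> \<phi> y \<in> M'.CH"
proof (induction y rule: M.CH_induct)
  case zero
  show ?case using phi_0 subsp_0[OF M'.subsp_CH] by simp
next
  case (add x y)
  then show ?case using phi_add[OF M.CH_L M.CH_L] subsp_add[OF M'.subsp_CH] by simp
next
  case (sing \<nu> t)
  have "t \<in> M.rs 0" "t \<in> M.dg \<nu>" using sing(2) M.h_eq M.dg_Mlat[OF sing(1)] by auto
  then obtain t' where t': "\<phi> (sing \<nu> t) = sing (p \<nu>) t'" "t' \<in> M'.rs 0" "t' \<in> M'.dg (p \<nu>)"
    using phi_sing[OF M.Mlat_A[OF sing(1)]] psi_Mlat_root[OF sing(1)] by auto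
  then have "t' \<in> M'.\<h>" using M'.h_eq M'.dg_Mlat[OF p_Mlat[OF sing(1)]] by blast
  then show ?case using M'.sing_CH[OF p_Mlat[OF sing(1)]] t'(1) by simp
qed

text \<open>The pulled-back form is graded for the original degrees even though
  \<open>\<phi>\<close> need not respect them: a nonzero value on root vectors forces both the roots
  and the degrees of the images to be opposite, so \<open>\<psi>\<close> of the sum is zero, and
  injectivity of \<open>\<psi>\<close> makes the sum zero.\<close>

lemma form_scalar:
  obtains a where "a \<noteq> 0" "\<And>x y. x \<in> M.L \<Longrightarrow> y \<in> M.L \<Longrightarrow> M'.form (\<phi> x) (\<phi> y) = a * M.form x y"
proof -
  let ?b = "\<lambda>x y. M'.form (\<phi> x) (\<phi> y)"
  have l1: "linear_on M.lsc (*) M.L (\<lambda>x. ?b x y)" if "y \<in> M.L" for y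
    by (rule linear_onI) (simp_all add: that phi_add phi_scale phi_L M'.form_add_left M'.form_scale_left)
  have l2: "linear_on M.lsc (*) M.L (?b x)" if "x \<in> M.L" for x
    by (rule linear_onI) (simp_all add: that phi_add phi_scale phi_L M'.form_add_right M'.form_scale_right)
  have gr_root: "?b (sing l x) (sing m y) = 0"
    if x: "\<alpha> \<in> Qh G" "l \<in> Zn n" "x \<in> M.rs \<alpha>" "x \<in> M.dg l"
      and y: "\<beta> \<in> Qh G" "m \<in> Zn n" "y \<in> M.rs \<beta>" "y \<in> M.dg m" and lm: "l + m \<noteq> 0" for \<alpha> \<beta> l m x y
  proof (cases "x = 0 \<or> y = 0")
    case True
    then show ?thesis by (auto simp: phi_0)
  next
    case False
    have A: "(\<alpha>, l) \<in> M.A" "(\<beta>, m) \<in> M.A"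
      using M.LsuppI[OF x] M.LsuppI[OF y] False gen_base by blast+
    obtain \<alpha>' l' where al: "\<psi> (\<alpha>, l) = (\<alpha>', l')" by (cases "\<psi> (\<alpha>, l)")
    obtain \<beta>' m' where bm: "\<psi> (\<beta>, m) = (\<beta>', m')" by (cases "\<psi> (\<beta>, m)")
    obtain x' where x': "\<phi> (sing l x) = sing l' x'" "x' \<in> M'.rs \<alpha>'"
      using phi_sing[OF A(1) x(3,4)] al by auto
    obtain y' where y': "\<phi> (sing m y) = sing m' y'" "y' \<in> M'.rs \<beta>'"
      using phi_sing[OF A(2) y(3,4)] bm by auto
    have n: "M'.normal \<alpha>'" "M'.normal \<beta>'"
      using psi_A[OF A(1)] psi_A[OF A(2)] M'.A_sub M'.Qh_normal al bm by force+
    show ?thesis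
    proof (rule ccontr)
      assume "?b (sing l x) (sing m y) \<noteq> 0"
      then have nz: "l' + m' = 0" "M'.kap x' y' \<noteq> 0"
        unfolding x'(1) y'(1) M'.form_sing by (auto split: if_splits)
      have "\<alpha>' + \<beta>' = 0" by (rule M'.kap_rs_orth[OF x'(2) y'(2) n nz(2)])
      then have "\<psi> ((\<alpha>, l) + (\<beta>, m)) = 0"
        unfolding psi_add[OF A] al bm using nz(1) by (simp add: zero_prod_def)
      then have "(\<alpha>, l) + (\<beta>, m) = 0"
        using psi_inv[OF gen_grp_add[OF A]] psi_inv[OF gen_zero] psi_0 by metis
      then show False using lm by (simp add: zero_prod_def)
    qed
  qed
  have gr: "?b (sing l x) (sing m y) = 0"
    if l: "l \<in> Zn n" and m: "m \<in> Zn n" and x: "x \<in> M.dg l" and y: "y \<in> M.dg m" and lm: "l + m \<noteq> 0" for l m x y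
    using x
  proof (induction x rule: M.dg_induct)
    case (root \<alpha> x)
    note x = root
    note lin = l2[OF M.sing_L[OF l x(3)]]
    from y show ?case
    proof (induction y rule: M.dg_induct)
      case (add y z)
      then show ?case
        using linear_on_add[OF lin M.sing_L[OF m add(1)] M.sing_L[OF m add(2)]] by (simp add: sing_add)
    next
      case (root \<beta> y)
      show ?case by (rule gr_root[OF x(1) l x(2,3) root(1) m root(2,3) lm])
    qed (simp add: phi_0)
  next
    case (add x z)
    then show ?case
      using linear_on_add[OF l1[OF M.sing_L[OF m y]] M.sing_L[OF l add(1)] M.sing_L[OF l add(2)]]
      by (simp add: sing_add)
  qed (simp add: phi_0)
  have inv: "?b (M.lbr x y) z = ?b x (M.lbr y z)" if "x \<in> M.L" "y \<in> M.L" "z \<in> M.L" for x y z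
    using that by (simp add: phi_br phi_L M'.form_invariant)
  obtain a where a: "\<And>x y. x \<in> M.L \<Longrightarrow> y \<in> M.L \<Longrightarrow> ?b x y = a * M.form x y"
    using M.L_form_unique[OF l1 l2 inv gr] by blast
  have "a \<noteq> 0"
  proof
    assume "a = 0"
    obtain x y where xy: "x \<in> M'.L" "y \<in> M'.L" "M'.form x y \<noteq> 0" using M'.form_nonzero by blast
    then show False using a[OF phi_inv_L phi_inv_L, of x y] \<open>a = 0\<close> by (simp add: phi_inv')
  qed
  then show ?thesis using that a by blast
qed

abbreviation q where "q \<equiv> multiloop_pair.p \<psi>i"

lemma q_p: "\<mu> \<in> M.Mlat \<Longrightarrow> q (p \<mu>) = \<mu>"
  using psi_inv[OF M.Mlat_A, of \<mu>] psi_Mlat_root[of \<mu>]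
    multiloop_pair.p_def[OF inverse_pair, of "p \<mu>"] by simp

lemma q_Mlat: "\<nu> \<in> M'.Mlat \<Longrightarrow> q \<nu> \<in> M.Mlat"
  by (rule multiloop_pair.p_Mlat[OF inverse_pair])

lemma p_q: "\<nu> \<in> M'.Mlat \<Longrightarrow> p (q \<nu>) = \<nu>"
  using multiloop_pair.psi_Mlat_root[OF inverse_pair, of \<nu>] psi_inv'[OF M'.Mlat_A, of \<nu>]
  by (simp add: p_def)

lemma p_0: "p 0 = 0"
  using psi_0 by (simp add: p_def zero_prod_def)

text \<open>The two functionals are matched on the lattices; what happens on the rest of the support
  group is measured in \<open>toral_correction\<close>.\<close>

lemma Th_transport:
  assumes "\<theta> \<in> Th n"
  obtains \<theta>' :: "(nat \<Rightarrow> int) \<Rightarrow> 'k" where "\<theta>' \<in> Th n" "\<And>\<mu>. \<mu> \<in> M.Mlat \<Longrightarrow> \<theta>' (p \<mu>) = \<theta> \<mu>"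
proof -
  have "\<theta> (q (\<mu> + \<nu>)) = \<theta> (q \<mu>) + \<theta> (q \<nu>)" if "\<mu> \<in> M'.Mlat" "\<nu> \<in> M'.Mlat" for \<mu> \<nu>
    using multiloop_pair.p_add[OF inverse_pair that] Th_add[OF assms] by simp
  then obtain \<theta>' where \<theta>': "\<theta>' \<in> Th n" "\<And>\<mu>. \<mu> \<in> M'.Mlat \<Longrightarrow> \<theta>' \<mu> = \<theta> (q \<mu>)"
    using M'.Mlat_functional[of "\<lambda>\<mu>. \<theta> (q \<mu>)"] by blast
  then show ?thesis using that[of \<theta>'] p_Mlat q_p by simp
qed

text \<open>The degree derivation attached to \<open>\<theta>\<close> is carried by \<open>\<phi>\<close> to the one attached to \<open>\<theta>'\<close> up to
  an operator that acts on each root space by a scalar depending additively on the root alone;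
  such an operator is \<open>ad t\<close> with \<open>t\<close> in the Cartan subalgebra.\<close>

lemma toral_correction:
  fixes \<theta>' :: "(nat \<Rightarrow> int) \<Rightarrow> 'k"
  assumes \<theta>: "\<theta> \<in> Th n" and \<theta>': "\<theta>' \<in> Th n" and e: "\<And>\<mu>. \<mu> \<in> M.Mlat \<Longrightarrow> \<theta>' (p \<mu>) = \<theta> \<mu>"
  obtains t where "t \<in> M'.\<h>"
    "\<And>\<alpha> l \<alpha>' l'. (\<alpha>, l) \<in> M.A \<Longrightarrow> \<psi> (\<alpha>, l) = (\<alpha>', l') \<Longrightarrow> \<alpha>' \<in> weights G' \<Longrightarrow> \<alpha>' t = \<theta> l - \<theta>' l'"
proof -
  define g where "g y = \<theta> (snd (\<psi>i y)) - \<theta>' (snd y)" for y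
  have g_add: "g (y + z) = g y + g z" if "y \<in> M'.A" "z \<in> M'.A" for y z
    using multiloop_pair.psi_add[OF inverse_pair that] by (simp add: g_def Th_add[OF \<theta>] Th_add[OF \<theta>'])
  \<comment> \<open>A multiple of \<open>\<nu>\<close> by some \<open>N > 0\<close> lies in the
    lattice, where \<open>\<theta>\<close> and \<open>\<theta>'\<close> correspond, so
    \<open>N * g (0, \<nu>) = 0\<close>. Hence \<open>g\<close> depends on the root alone.\<close>
  have g_0: "g (0, \<nu>) = 0" if \<nu>: "(0, \<nu>) \<in> M'.A" for \<nu>
  proof -
    have mult: "(0, \<lambda>i. int k * \<nu> i) \<in> M'.A \<and> g (0, \<lambda>i. int k * \<nu> i) = of_nat k * g (0, \<nu>)" for k
    proof (induction k)
      case 0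
      have "(0, \<lambda>i. int 0 * \<nu> i) = (0 :: ('b \<Rightarrow> 'k) \<times> (nat \<Rightarrow> int))"
        by (simp add: zero_prod_def zero_fun_def)
      moreover have "(0 :: ('b \<Rightarrow> 'k) \<times> (nat \<Rightarrow> int)) \<in> M'.A" by (rule gen_zero)
      moreover have "g 0 = 0" using g_add[OF gen_zero gen_zero] by simp
      ultimately show ?case by simp
    next
      case (Suc k)
      have "(0, \<lambda>i. int (Suc k) * \<nu> i) = (0, \<lambda>i. int k * \<nu> i) + (0 :: 'b \<Rightarrow> 'k, \<nu>)"
        by (auto simp: fun_eq_iff plus_fun_apply algebra_simps)
      moreover have A: "(0, \<lambda>i. int k * \<nu> i) \<in> M'.A" using Suc by blast
      ultimately show ?case
        using Suc gen_grp_add[OF A \<nu>] g_add[OF A \<nu>] by (simp only: simp_thms) (simp add: algebra_simps)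
    qed
    obtain N :: nat where N: "N > 0" "\<And>l. l \<in> Zn n \<Longrightarrow> (\<lambda>i. int N * l i) \<in> M'.Mlat"
      using M'.ex_Mlat_multiple by blast
    let ?\<kappa> = "\<lambda>i. int N * \<nu> i"
    have \<kappa>: "?\<kappa> \<in> M'.Mlat" using N(2) M'.A_sub[OF \<nu>] by blast
    have "g (0, ?\<kappa>) = \<theta> (q ?\<kappa>) - \<theta>' ?\<kappa>"
      by (simp add: g_def multiloop_pair.p_def[OF inverse_pair])
    also have "\<dots> = 0" using e[OF q_Mlat[OF \<kappa>]] p_q[OF \<kappa>] by simp
    finally show ?thesis using mult[of N] N(1) by simp
  qed
  \<comment> \<open>The choice of degree is immaterial: two choices differ by an element of root
    zero, where \<open>g\<close> vanishes.\<close>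
  define F where "F \<alpha> = g (\<alpha>, SOME l. (\<alpha>, l) \<in> M'.A)" for \<alpha>
  have F: "F \<alpha> = g (\<alpha>, l)" if A: "(\<alpha>, l) \<in> M'.A" for \<alpha> l
  proof -
    define m where "m = (SOME l. (\<alpha>, l) \<in> M'.A)"
    have m: "(\<alpha>, m) \<in> M'.A" unfolding m_def by (rule someI[of _ l]) (rule A)
    have "(\<alpha>, l) - (\<alpha>, m) \<in> M'.A" by (rule gen_diff[OF A m])
    then have d: "(0, l - m) \<in> M'.A" by simp
    have "g (\<alpha>, l) = g ((0, l - m) + (\<alpha>, m))" by simp
    also have "\<dots> = g (\<alpha>, m)" using g_add[OF d m] g_0[OF d] by simp
    finally show ?thesis by (simp add: F_def m_def)
  qed
  have F_add: "F (\<alpha> + \<beta>) = F \<alpha> + F \<beta>" if ab: "\<alpha> \<in> Qh G'" "\<beta> \<in> Qh G'" for \<alpha> \<beta>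
  proof -
    obtain l where l: "(\<alpha>, l) \<in> M'.A" by (rule M'.Qh_A[OF ab(1)])
    obtain m where m: "(\<beta>, m) \<in> M'.A" by (rule M'.Qh_A[OF ab(2)])
    note A = l m
    have "(\<alpha>, l) + (\<beta>, m) \<in> M'.A" by (rule gen_grp_add[OF A])
    then have "(\<alpha> + \<beta>, l + m) \<in> M'.A" by simp
    from F[OF this] F[OF A(1)] F[OF A(2)] show ?thesis using g_add[OF A] by simp
  qed
  obtain t where t: "t \<in> M'.\<h>" "\<And>\<alpha>. \<alpha> \<in> weights G' \<Longrightarrow> \<alpha> t = F \<alpha>"
    using M'.toral_element[OF F_add] by blast
  have "\<alpha>' t = \<theta> l - \<theta>' l'"
    if A: "(\<alpha>, l) \<in> M.A" "\<psi> (\<alpha>, l) = (\<alpha>', l')" "\<alpha>' \<in> weights G'" for \<alpha> l \<alpha>' l'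
  proof -
    have "(\<alpha>', l') \<in> M'.A" using psi_A[OF A(1)] A(2) by simp
    then have "\<alpha>' t = g (\<alpha>', l')" using t(2)[OF A(3)] F by simp
    also have "\<dots> = \<theta> l - \<theta>' l'" using psi_inv[OF A(1)] A(2) by (simp add: g_def)
    finally show ?thesis .
  qed
  then show ?thesis using that t(1) by blast
qed

text \<open>Let \<open>a\<close> be the scalar of the transported shift and
  \<open>\<eta> = a \<theta>'\<close>. On a root vector with image of root \<open>\<alpha>'\<close>
  and degree \<open>l'\<close>, the relation \<open>\<alpha>' t = \<theta> l - \<theta>' l'\<close>
  reads \<open>\<eta> l' = a \<theta> l - a \<alpha>' t\<close>, so the correcting Cartan element is
  \<open>- a t\<close>.\<close>

lemma generator_transport:
  assumes \<mu>: "\<mu> \<in> M.Mlat" and \<theta>: "\<theta> \<in> Th n" and \<theta>\<mu>: "\<theta> \<mu> = 0"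
  obtains \<eta> t where "\<eta> \<in> Th n" "\<eta> (p \<mu>) = 0" "t \<in> M'.\<h>"
    "\<And>x. x \<in> M.L \<Longrightarrow>
      M'.sd (p \<mu>) \<eta> (\<phi> x) = \<phi> (M.sd \<mu> \<theta> x) + M'.lbr (sing (p \<mu>) t) (\<phi> x)"
    "\<And>\<nu>. \<mu> = 0 \<Longrightarrow> \<nu> \<in> M.Mlat \<Longrightarrow> \<eta> (p \<nu>) = \<theta> \<nu>"
proof -
  obtain a where p\<mu>: "p \<mu> \<in> M'.Mlat"
    and a: "\<And>x. x \<in> M.L \<Longrightarrow> \<phi> (M.sd \<mu> (\<lambda>_. 1) x) = M'.sd (p \<mu>) (\<lambda>_. a) (\<phi> x)"
    using centroid_transport[OF \<mu>] by blast
  obtain \<theta>' :: "(nat \<Rightarrow> int) \<Rightarrow> 'k"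
    where \<theta>': "\<theta>' \<in> Th n" "\<And>\<mu>. \<mu> \<in> M.Mlat \<Longrightarrow> \<theta>' (p \<mu>) = \<theta> \<mu>"
    using Th_transport[OF \<theta>] by blast
  obtain t where t: "t \<in> M'.\<h>"
    "\<And>\<alpha> l \<alpha>' l'. (\<alpha>, l) \<in> M.A \<Longrightarrow> \<psi> (\<alpha>, l) = (\<alpha>', l') \<Longrightarrow> \<alpha>' \<in> weights G' \<Longrightarrow> \<alpha>' t = \<theta> l - \<theta>' l'"
    using toral_correction[OF \<theta> \<theta>'] by blast
  define \<eta> where "\<eta> l = a * \<theta>' l" for l
  define y where "y = sing (p \<mu>) (M'.sc (- a) t)"
  have \<eta>: "\<eta> \<in> Th n" using Th_lincomb[OF \<theta>'(1,1), of a 0] by (simp add: \<eta>_def[abs_def])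
  have ath: "M'.sc (- a) t \<in> M'.\<h>" by (rule subsp_scale[OF M'.subsp_h t(1)])
  have y: "y \<in> M'.CH" unfolding y_def by (rule M'.sing_CH[OF p\<mu> ath])
  note yL = M'.CH_L[OF y]
  have eq: "M'.sd (p \<mu>) \<eta> (\<phi> x) = \<phi> (M.sd \<mu> \<theta> x) + M'.lbr y (\<phi> x)" if x: "x \<in> M.L" for x
  proof (rule M.L_linear_eqI[where f = "\<lambda>x. M'.sd (p \<mu>) \<eta> (\<phi> x)"
        and g = "\<lambda>x. \<phi> (M.sd \<mu> \<theta> x) + M'.lbr y (\<phi> x)", OF _ _ x])
    show "linear_on M.lsc M'.lsc M.L (\<lambda>x. M'.sd (p \<mu>) \<eta> (\<phi> x))"
      by (rule linear_onI)
         (simp_all add: phi_add phi_scale phi_L linear_on_add[OF M'.sd_linear] linear_on_scale[OF M'.sd_linear])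
    interpret v: vector_space M'.lsc by (rule M'.vs_lsc)
    show "linear_on M.lsc M'.lsc M.L (\<lambda>x. \<phi> (M.sd \<mu> \<theta> x) + M'.lbr y (\<phi> x))"
      by (rule linear_onI)
         (simp_all add: phi_add phi_scale phi_L linear_on_add[OF M.sd_linear] linear_on_scale[OF M.sd_linear]
           M.sd_L[OF \<mu>] M'.lbr_add_right M'.lbr_scale_right yL v.scale_right_distrib)
    fix \<alpha> l x assume x: "\<alpha> \<in> Qh G" "l \<in> Zn n" "x \<in> M.rs \<alpha>" "x \<in> M.dg l"
    show "M'.sd (p \<mu>) \<eta> (\<phi> (sing l x)) = \<phi> (M.sd \<mu> \<theta> (sing l x)) + M'.lbr y (\<phi> (sing l x))"
    proof (cases "x = 0")
      case True
      then show ?thesis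
        by (simp add: phi_0 linear_on_zero[OF M'.sd_linear M'.subsp_L] linear_on_zero[OF M.sd_linear M.subsp_L])
    next
      case False
      have A: "(\<alpha>, l) \<in> M.A" by (rule gen_base, rule M.LsuppI[OF x False])
      obtain \<alpha>' l' where al: "\<psi> (\<alpha>, l) = (\<alpha>', l')" by (cases "\<psi> (\<alpha>, l)")
      have A': "\<alpha>' \<in> Qh G'" "l' \<in> Zn n" using psi_A[OF A] al M'.A_sub by auto
      obtain x' where x': "\<phi> (sing l x) = sing l' x'" "x' \<in> M'.rs \<alpha>'" "x' \<in> M'.dg l'"
        using phi_sing[OF A x(3,4)] al by auto
      have xL: "sing l x \<in> M.L" by (rule M.sing_L[OF x(2,4)])
      have "x' \<noteq> 0"
      proof
        assume "x' = 0"
        then have "sing l x = 0" using x' by (intro phi_eq_0[OF xL]) simp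
        then show False using False by simp
      qed
      then have "\<alpha>' \<in> weights G'" using M'.normal_weight[OF M'.Qh_normal[OF A'(1)] x'(2)] by simp
      then have \<alpha>'t: "\<alpha>' t = \<theta> l - \<theta>' l'" by (rule t(2)[OF A al])
      have "M.sd \<mu> \<theta> (sing l x) = M.lsc (\<theta> l) (M.sd \<mu> (\<lambda>_. 1) (sing l x))"
        by (simp add: M.sd_sing[OF x(2,4)] flip: M.sing_scale)
      then have 1: "\<phi> (M.sd \<mu> \<theta> (sing l x)) = M'.lsc (\<theta> l) (M'.sd (p \<mu>) (\<lambda>_. a) (sing l' x'))"
        using xL by (simp add: phi_scale M.sd_L[OF \<mu>] a x'(1))
      have 2: "M'.br t x' = M'.sc (\<alpha>' t) x'" using x'(2) t(1) by (simp add: rootsp_def)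
      have "M'.sd (p \<mu>) \<eta> (sing l' x') = sing (l' + p \<mu>) (M'.sc (a * \<theta>' l') x')"
        by (simp add: M'.sd_sing[OF A'(2) x'(3)] \<eta>_def)
      also have "\<dots> = sing (l' + p \<mu>) (M'.sc (\<theta> l * a) x') + sing (p \<mu> + l') (M'.br (M'.sc (- a) t) x')"
        unfolding add.commute[of "p \<mu>" l'] sing_add[symmetric]
        by (simp add: M'.b_scale_left M'.b_minus_left 2 \<alpha>'t algebra_simps flip: M'.scale_left_distrib M'.scale_left_diff_distrib)
      also have "\<dots> = \<phi> (M.sd \<mu> \<theta> (sing l x)) + M'.lbr y (sing l' x')"
        unfolding 1 by (simp add: M'.sd_sing[OF A'(2) x'(3)] y_def M'.lbr_sing flip: M'.sing_scale)
      finally show ?thesis by (simp add: x'(1))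
    qed
  qed
  \<comment> \<open>In degree 0 the shift is the identity, so its conjugate is the identity too and
    \<open>a = 1\<close>.\<close>
  have "\<eta> (p \<nu>) = \<theta> \<nu>" if \<mu>0: "\<mu> = 0" and \<nu>: "\<nu> \<in> M.Mlat" for \<nu>
  proof -
    obtain s where s: "s \<in> M.\<h>" "s \<noteq> 0" "s \<in> M.dg 0" "s \<in> M.rs 0" by (rule M.ex_nonzero_h)
    note sL = M.sing_L[OF Zn_0 s(3)]
    obtain s' where s': "\<phi> (sing 0 s) = sing 0 s'" "s' \<in> M'.dg 0"
      using phi_sing[OF M.Mlat_A[OF M.Mlat_0] s(4,3)] psi_Mlat_root[OF M.Mlat_0] p_0 by auto
    have "s' \<noteq> 0"
    proof
      assume "s' = 0"
      then have "sing 0 s = 0" using s' by (intro phi_eq_0[OF sL]) simp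
      then show False using s(2) by simp
    qed
    moreover have "sing 0 s' = sing 0 (M'.sc a s')"
      using a[OF sL] \<mu>0 by (simp add: M.sd_sing[OF Zn_0 s(3)] s'(1) p_0 M'.sd_sing[OF Zn_0 s'(2)])
    then have "s' = M'.sc a s'" by (metis sing_same)
    ultimately have "a = 1" by (metis M'.scale_one M'.scale_right_imp_eq)
    then show ?thesis using \<theta>'(2)[OF \<nu>] by (simp add: \<eta>_def)
  qed
  moreover have "\<eta> (p \<mu>) = 0" using \<theta>'(2)[OF \<mu>] \<theta>\<mu> by (simp add: \<eta>_def)
  ultimately show ?thesis using that[of \<eta> "M'.sc (- a) t"] \<eta> ath eq by (simp add: y_def)
qed

section \<open>The correspondence of skew centroidal derivations\<close>

definition rel :: "'a endo \<Rightarrow> 'b endo \<Rightarrow> 'b lp \<Rightarrow> bool" where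
  "rel d e y \<longleftrightarrow> e \<in> M'.SCD \<and> y \<in> M'.CH \<and> (\<forall>x\<in>M.L. e (\<phi> x) = \<phi> (d x) + M'.lbr y (\<phi> x))"

lemma relD:
  assumes "rel d e y"
  shows "e \<in> M'.SCD" "y \<in> M'.CH" "y \<in> M'.L" "x \<in> M.L \<Longrightarrow> e (\<phi> x) = \<phi> (d x) + M'.lbr y (\<phi> x)"
  using assms M'.CH_L by (auto simp: rel_def)

text \<open>The difference of two solutions is a skew centroidal derivation equal to
  \<open>ad\<close> of an element of \<open>CH\<close>. Because of this, existence can be shown by
  induction over generators, and each algebraic law of \<open>Phi\<close> and \<open>Y\<close>
  follows by exhibiting one related pair.\<close>

lemma rel_unique:
  assumes "rel d e y" "rel d f z"
  shows "e = f" "y = z"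
proof -
  note 1 = relD[OF assms(1)] and 2 = relD[OF assms(2)]
  have ef: "e - f \<in> M'.SCD" by (rule subsp_diff[OF M'.vs_Esc M'.subsp_SCD 1(1) 2(1)])
  have yz: "y - z \<in> M'.CH" by (rule subsp_diff[OF M'.vs_lsc M'.subsp_CH 1(2) 2(2)])
  have eq: "(e - f) x = M'.lbr (y - z) x" if "x \<in> M'.L" for x
    using 1(4)[OF phi_inv_L[OF that]] 2(4)[OF phi_inv_L[OF that]] that
    by (simp add: phi_inv' minus_apply[of e f x] M'.lbr_diff_left 1(3) 2(3))
  show "e = f" "y = z" using M'.SCD_ad_CH[OF ef yz eq] by simp_all
qed

lemma rel_add:
  assumes d: "d1 \<in> M.SCD" "d2 \<in> M.SCD" and r: "rel d1 e1 y1" "rel d2 e2 y2"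
  shows "rel (d1 + d2) (e1 + e2) (y1 + y2)"
  unfolding rel_def
proof (intro conjI ballI)
  note 1 = relD[OF r(1)] and 2 = relD[OF r(2)]
  show "e1 + e2 \<in> M'.SCD" by (rule subsp_add[OF M'.subsp_SCD 1(1) 2(1)])
  show "y1 + y2 \<in> M'.CH" by (rule subsp_add[OF M'.subsp_CH 1(2) 2(2)])
  fix x assume x: "x \<in> M.L"
  show "(e1 + e2) (\<phi> x) = \<phi> ((d1 + d2) x) + M'.lbr (y1 + y2) (\<phi> x)"
    using 1(4)[OF x] 2(4)[OF x] x
    by (simp add: plus_fun_apply[of e1 e2 "\<phi> x"] plus_fun_apply[of d1 d2 x] phi_add M.SCD_L d
        M'.lbr_add_left 1(3) 2(3))
qed

lemma rel_scale:
  assumes d: "d \<in> M.SCD" and r: "rel d e y"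
  shows "rel (Esc G a d) (Esc G' a e) (M'.lsc a y)"
  unfolding rel_def
proof (intro conjI ballI)
  note 1 = relD[OF r]
  interpret v: vector_space M'.lsc by (rule M'.vs_lsc)
  show "Esc G' a e \<in> M'.SCD" by (rule subsp_scale[OF M'.subsp_SCD 1(1)])
  show "M'.lsc a y \<in> M'.CH" by (rule subsp_scale[OF M'.subsp_CH 1(2)])
  fix x assume x: "x \<in> M.L"
  show "Esc G' a e (\<phi> x) = \<phi> (Esc G a d x) + M'.lbr (M'.lsc a y) (\<phi> x)"
    using 1(4)[OF x] x
    by (simp add: Esc_def phi_scale M.SCD_L d M'.lbr_scale_left 1(3) v.scale_right_distrib)
qed

lemma rel_total:
  assumes "d \<in> M.SCD"
  shows "\<exists>e y. rel d e y"
  using assms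
proof (induction rule: M.SCD_induct)
  case zero
  show ?case
    unfolding rel_def
    by (intro exI[of _ 0] conjI ballI subsp_0[OF M'.subsp_SCD] subsp_0[OF M'.subsp_CH])
       (simp add: phi_0 zero_fun_apply[where 'a = "'a lp"] zero_fun_apply[where 'a = "'b lp"])
next
  case (add d1 d2)
  then obtain e1 y1 e2 y2 where "rel d1 e1 y1" "rel d2 e2 y2" by (elim exE)
  then have "rel (d1 + d2) (e1 + e2) (y1 + y2)" by (rule rel_add[OF add(1,2)])
  then show ?case by (intro exI)
next
  case (sd \<mu> \<theta>)
  obtain \<eta> t where *: "\<eta> \<in> Th n" "\<eta> (p \<mu>) = 0" "t \<in> M'.\<h>"
    "\<And>x. x \<in> M.L \<Longrightarrow> M'.sd (p \<mu>) \<eta> (\<phi> x) = \<phi> (M.sd \<mu> \<theta> x) + M'.lbr (sing (p \<mu>) t) (\<phi> x)"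
    using generator_transport[OF sd] by metis
  then have "rel (M.sd \<mu> \<theta>) (M'.sd (p \<mu>) \<eta>) (sing (p \<mu>) t)"
    using M'.sd_SCD[OF p_Mlat[OF sd(1)]] M'.sing_CH[OF p_Mlat[OF sd(1)]] by (simp add: rel_def)
  then show ?case by (intro exI)
qed

text \<open>In \<open>e1 (e2 (\<phi> x))\<close> the mixed terms
  \<open>[y1, \<phi> (d2 x)] + [y2, \<phi> (d1 x)]\<close> are symmetric in the two indices, and
  \<open>ad y1\<close> and \<open>ad y2\<close> commute because \<open>CH\<close> is abelian. What
  remains after antisymmetrising is \<open>ad (e1 y2 - e2 y1)\<close>.\<close>

lemma rel_comm:
  assumes d: "d1 \<in> M.SCD" "d2 \<in> M.SCD" and r: "rel d1 e1 y1" "rel d2 e2 y2"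
  shows "rel (comm d1 d2) (comm e1 e2) (e1 y2 - e2 y1)"
  unfolding rel_def
proof (intro conjI ballI)
  note 1 = relD[OF r(1)] and 2 = relD[OF r(2)]
  show "comm e1 e2 \<in> M'.SCD" by (rule M'.SCD_comm[OF 1(1) 2(1)])
  show "e1 y2 - e2 y1 \<in> M'.CH"
    by (rule subsp_diff[OF M'.vs_lsc M'.subsp_CH M'.SCD_CH[OF 1(1) 2(2)] M'.SCD_CH[OF 2(1) 1(2)]])
  fix x assume x: "x \<in> M.L"
  have dx: "d1 x \<in> M.L" "d2 x \<in> M.L" using M.SCD_L d x by auto
  note L = phi_L[OF x] phi_L[OF dx(1)] phi_L[OF dx(2)] 1(3) 2(3) M'.lbr_L M'.SCD_L[OF 1(1)] M'.SCD_L[OF 2(1)]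
  have ee: "e1 (e2 (\<phi> x)) = \<phi> (d1 (d2 x)) + M'.lbr y1 (\<phi> (d2 x)) + M'.lbr (e1 y2) (\<phi> x)
      + M'.lbr y2 (\<phi> (d1 x)) + M'.lbr y2 (M'.lbr y1 (\<phi> x))"
    if "rel d1 e1 y1" "rel d2 e2 y2" "d1 x \<in> M.L" "d2 x \<in> M.L" for d1 d2 e1 e2 y1 y2
  proof -
    note 1 = relD[OF that(1)] and 2 = relD[OF that(2)]
    note L = phi_L[OF x] phi_L[OF that(3)] phi_L[OF that(4)] 1(3) 2(3) M'.lbr_L
    have "e1 (e2 (\<phi> x)) = e1 (\<phi> (d2 x)) + e1 (M'.lbr y2 (\<phi> x))"
      by (simp add: 2(4)[OF x] M'.SCD_add[OF 1(1)] L)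
    also have "e1 (M'.lbr y2 (\<phi> x)) = M'.lbr (e1 y2) (\<phi> x) + M'.lbr y2 (e1 (\<phi> x))"
      by (rule M'.SCD_derivation[OF 1(1) 2(3) phi_L[OF x]])
    also have "e1 (\<phi> x) = \<phi> (d1 x) + M'.lbr y1 (\<phi> x)" by (rule 1(4)[OF x])
    finally show ?thesis by (simp add: 1(4)[OF that(4)] M'.lbr_add_right L add.assoc)
  qed
  have c: "M'.lbr y2 (M'.lbr y1 (\<phi> x)) = M'.lbr y1 (M'.lbr y2 (\<phi> x))"
    using M'.lbr_jacobi[OF 2(3) 1(3) phi_L[OF x]] M'.CH_abelian[OF 2(2) 1(2)] by simp
  have "comm e1 e2 (\<phi> x) = \<phi> (d1 (d2 x)) - \<phi> (d2 (d1 x)) + (M'.lbr (e1 y2) (\<phi> x) - M'.lbr (e2 y1) (\<phi> x))"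
    unfolding comm_def ee[OF r dx] ee[OF r(2,1) dx(2,1)] c by (simp add: algebra_simps)
  then show "comm e1 e2 (\<phi> x) = \<phi> (comm d1 d2 x) + M'.lbr (e1 y2 - e2 y1) (\<phi> x)"
    using d dx by (simp add: comm_def phi_diff M.SCD_L M'.lbr_diff_left L)
qed

text \<open>Solving the defining relation for \<open>d\<close> moves the correction to the other
  side, whence the sign. This makes \<open>Psi\<close> a left inverse of \<open>Phi\<close>.\<close>

lemma rel_inverse:
  assumes d: "d \<in> M.SCD" and r: "rel d e y"
  shows "multiloop_pair.rel n zeta G' G \<phi>i e d (- \<phi>i y)"
proof -
  interpret I: multiloop_pair n zeta G' G \<phi>i \<psi>i by (rule inverse_pair)
  note 1 = relD[OF r]
  show ?thesis
    unfolding I.rel_def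
  proof (intro conjI ballI)
    show "d \<in> M.SCD" by fact
    have y: "\<phi>i y \<in> M.CH" by (rule I.phi_CH[OF 1(2)])
    show "- \<phi>i y \<in> M.CH" by (rule subsp_minus[OF M.vs_lsc M.subsp_CH y])
    fix x assume x: "x \<in> M'.L"
    note dx = M.SCD_L[OF d phi_inv_L[OF x]]
    have "e x = \<phi> (d (\<phi>i x)) + M'.lbr y x" using 1(4)[OF phi_inv_L[OF x]] x by (simp add: phi_inv')
    then have "\<phi>i (e x) = d (\<phi>i x) + M.lbr (\<phi>i y) (\<phi>i x)"
      using x by (simp add: I.phi_add phi_L dx M'.lbr_L 1(3) phi_inv I.phi_br)
    then show "d (\<phi>i x) = \<phi>i (e x) + M.lbr (- \<phi>i y) (\<phi>i x)"
      using M.lbr_minus_left[OF M.CH_L[OF y]] by simp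
  qed
qed

definition Phi :: "'a endo \<Rightarrow> 'b endo" where
  "Phi d = (THE e. \<exists>y. rel d e y)"

definition Y :: "'a endo \<Rightarrow> 'b lp" where
  "Y d = (THE y. rel d (Phi d) y)"

lemma Phi_eqI:
  assumes "rel d e y"
  shows "Phi d = e" "Y d = y"
proof -
  show *: "Phi d = e"
    unfolding Phi_def
  proof (rule the_equality)
    show "\<exists>y. rel d e y" using assms by blast
    show "f = e" if "\<exists>z. rel d f z" for f using that by (elim exE) (rule rel_unique(1)[OF _ assms])
  qed
  show "Y d = y"
    unfolding Y_def *
  proof (rule the_equality)
    show "rel d e y" by (rule assms)
    show "z = y" if "rel d e z" for z by (rule rel_unique(2)[OF that assms])
  qed
qed

lemma rel_Phi:
  assumes "d \<in> M.SCD"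
  shows "rel d (Phi d) (Y d)"
proof -
  obtain e y where r: "rel d e y" using rel_total[OF assms] by (elim exE)
  show ?thesis unfolding Phi_eqI[OF r] by (rule r)
qed

lemmas Phi_SCD = relD(1)[OF rel_Phi] and Y_CH = relD(2)[OF rel_Phi] and Y_L = relD(3)[OF rel_Phi]
  and Phi_phi = relD(4)[OF rel_Phi]

lemma Phi_add: "d \<in> M.SCD \<Longrightarrow> e \<in> M.SCD \<Longrightarrow> Phi (d + e) = Phi d + Phi e"
  and Y_add: "d \<in> M.SCD \<Longrightarrow> e \<in> M.SCD \<Longrightarrow> Y (d + e) = Y d + Y e"
  using Phi_eqI[OF rel_add[OF _ _ rel_Phi rel_Phi]] by auto

lemma Phi_scale: "d \<in> M.SCD \<Longrightarrow> Phi (Esc G a d) = Esc G' a (Phi d)"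
  and Y_scale: "d \<in> M.SCD \<Longrightarrow> Y (Esc G a d) = M'.lsc a (Y d)"
  using Phi_eqI[OF rel_scale[OF _ rel_Phi]] by auto

lemma Phi_comm: "d \<in> M.SCD \<Longrightarrow> e \<in> M.SCD \<Longrightarrow> Phi (comm d e) = comm (Phi d) (Phi e)"
  and Y_comm: "d \<in> M.SCD \<Longrightarrow> e \<in> M.SCD \<Longrightarrow> Y (comm d e) = Phi d (Y e) - Phi e (Y d)"
  using Phi_eqI[OF rel_comm[OF _ _ rel_Phi rel_Phi]] by auto

lemma Phi_SCdeg:
  assumes \<mu>: "\<mu> \<in> M.Mlat" and d: "d \<in> SCdeg n zeta G \<mu>"
  shows "Phi d \<in> SCdeg n zeta G' (p \<mu>)" and "\<exists>t\<in>M'.\<h>. Y d = sing (p \<mu>) t"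
proof -
  obtain \<theta> where \<theta>: "d = M.sd \<mu> \<theta>" "\<theta> \<in> Th n" "\<theta> \<mu> = 0" using d M.SCdeg_eq[OF \<mu>] by blast
  obtain \<eta> t where *: "\<eta> \<in> Th n" "\<eta> (p \<mu>) = 0" "t \<in> M'.\<h>"
    "\<And>x. x \<in> M.L \<Longrightarrow> M'.sd (p \<mu>) \<eta> (\<phi> x) = \<phi> (M.sd \<mu> \<theta> x) + M'.lbr (sing (p \<mu>) t) (\<phi> x)"
    using generator_transport[OF \<mu> \<theta>(2,3)] by metis
  then have "rel d (M'.sd (p \<mu>) \<eta>) (sing (p \<mu>) t)"
    using M'.sd_SCD[OF p_Mlat[OF \<mu>]] M'.sing_CH[OF p_Mlat[OF \<mu>]] by (simp add: rel_def \<theta>(1))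
  from Phi_eqI[OF this] show "Phi d \<in> SCdeg n zeta G' (p \<mu>)" "\<exists>t\<in>M'.\<h>. Y d = sing (p \<mu>) t"
    using M'.sd_SCdeg[OF p_Mlat[OF \<mu>] *(1,2)] *(3) by auto
qed

text \<open>The clause on the lattice carries the injectivity of the evaluation map from
  \<open>D\<close> to its image, in \<open>D_ok_image\<close>.\<close>

lemma Phi_dth:
  assumes \<theta>: "\<theta> \<in> Th n"
  shows "\<exists>\<theta>'\<in>Th n. Phi (dth n zeta G \<theta>) = dth n zeta G' \<theta>' \<and> (\<forall>\<mu>\<in>M.Mlat. \<theta>' (p \<mu>) = \<theta> \<mu>)"
proof -
  obtain \<eta> t where *: "\<eta> \<in> Th n" "\<eta> (p 0) = 0" "t \<in> M'.\<h>"
    "\<And>x. x \<in> M.L \<Longrightarrow> M'.sd (p 0) \<eta> (\<phi> x) = \<phi> (M.sd 0 \<theta> x) + M'.lbr (sing (p 0) t) (\<phi> x)"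
    "\<And>\<nu>. \<nu> \<in> M.Mlat \<Longrightarrow> \<eta> (p \<nu>) = \<theta> \<nu>"
    using generator_transport[OF M.Mlat_0 \<theta> Th_at_0[OF \<theta>]] by metis
  then have "rel (M.sd 0 \<theta>) (M'.sd 0 \<eta>) (sing 0 t)"
    using M'.sd_SCD[OF M'.Mlat_0 *(1)] M'.sing_CH[OF M'.Mlat_0] by (simp add: rel_def p_0)
  from Phi_eqI(1)[OF this] show ?thesis using * by (auto simp: M.dth_eq_sd M'.dth_eq_sd)
qed

abbreviation Psi where "Psi \<equiv> multiloop_pair.Phi n zeta G' G \<phi>i"

lemma Psi_Phi: "d \<in> M.SCD \<Longrightarrow> Psi (Phi d) = d"
  by (rule multiloop_pair.Phi_eqI(1)[OF inverse_pair rel_inverse[OF _ rel_Phi]])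


text \<open>\<open>Psi_Phi\<close> for the inverse pair would speak of the inverse of
  \<open>\<phi>i\<close>, which is not \<open>\<phi>\<close> by definition; so the related pair is
  exhibited for \<open>\<phi>\<close> itself.\<close>

lemma Phi_Psi:
  assumes e: "e \<in> M'.SCD"
  shows "Phi (Psi e) = e"
proof -
  interpret I: multiloop_pair n zeta G' G \<phi>i \<psi>i by (rule inverse_pair)
  have "rel (Psi e) e (- \<phi> (I.Y e))"
    unfolding rel_def
  proof (intro conjI ballI e)
    have y: "\<phi> (I.Y e) \<in> M'.CH" by (rule phi_CH[OF I.Y_CH[OF e]])
    show "- \<phi> (I.Y e) \<in> M'.CH" by (rule subsp_minus[OF M'.vs_lsc M'.subsp_CH y])
    fix x assume x: "x \<in> M.L"
    have "Psi e x = \<phi>i (e (\<phi> x)) + M.lbr (I.Y e) x"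
      using I.Phi_phi[OF e phi_L[OF x]] x by (simp add: phi_inv)
    then have "\<phi> (Psi e x) = e (\<phi> x) + M'.lbr (\<phi> (I.Y e)) (\<phi> x)"
      using x by (simp add: phi_add phi_inv_L M'.SCD_L[OF e] phi_L M.lbr_L I.Y_L[OF e] phi_inv' phi_br)
    then show "e (\<phi> x) = \<phi> (Psi e x) + M'.lbr (- \<phi> (I.Y e)) (\<phi> x)"
      using M'.lbr_minus_left[OF M'.CH_L[OF y]] by simp
  qed
  then show ?thesis by (rule Phi_eqI(1))
qed

lemma Phi_SCdeg_iff:
  assumes \<mu>: "\<mu> \<in> M.Mlat" and d: "d \<in> M.SCD"
  shows "Phi d \<in> SCdeg n zeta G' (p \<mu>) \<longleftrightarrow> d \<in> SCdeg n zeta G \<mu>"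
  using Phi_SCdeg(1)[OF \<mu>] multiloop_pair.Phi_SCdeg(1)[OF inverse_pair p_Mlat[OF \<mu>], of "Phi d"]
    Psi_Phi[OF d] q_p[OF \<mu>] by auto

end

section \<open>Transport of the pairs \<open>(D, \<tau>)\<close>, from properties that hold in both
  directions\<close>

locale transport = M: multiloop n zeta G + M': multiloop n zeta G'
  for n :: nat and zeta :: "nat \<Rightarrow> 'k::field_char_0"
    and G :: "('k, 'a::ab_group_add) mldatum" and G' :: "('k, 'b::ab_group_add) mldatum" +
  fixes Phi :: "'a endo \<Rightarrow> 'b endo" and Psi :: "'b endo \<Rightarrow> 'a endo"
    and p :: "(nat \<Rightarrow> int) \<Rightarrow> nat \<Rightarrow> int" and a :: 'k
  assumes Phi_SCD: "d \<in> SCDer n zeta G \<Longrightarrow> Phi d \<in> SCDer n zeta G'"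
    and Psi_Phi: "d \<in> SCDer n zeta G \<Longrightarrow> Psi (Phi d) = d"
    and Phi_add: "d \<in> SCDer n zeta G \<Longrightarrow> e \<in> SCDer n zeta G \<Longrightarrow> Phi (d + e) = Phi d + Phi e"
    and Phi_scale: "d \<in> SCDer n zeta G \<Longrightarrow> Phi (Esc G k d) = Esc G' k (Phi d)"
    and Phi_comm: "d \<in> SCDer n zeta G \<Longrightarrow> e \<in> SCDer n zeta G \<Longrightarrow> Phi (comm d e) = comm (Phi d) (Phi e)"
    and p_Mlat: "\<mu> \<in> M.Mlat \<Longrightarrow> p \<mu> \<in> M'.Mlat"
    and p_surj: "\<nu> \<in> M'.Mlat \<Longrightarrow> \<exists>\<mu>\<in>M.Mlat. p \<mu> = \<nu>"
    and p_add: "\<mu> \<in> M.Mlat \<Longrightarrow> \<nu> \<in> M.Mlat \<Longrightarrow> p (\<mu> + \<nu>) = p \<mu> + p \<nu>"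
    and Phi_SCdeg_iff: "\<mu> \<in> M.Mlat \<Longrightarrow> d \<in> SCDer n zeta G \<Longrightarrow>
      Phi d \<in> SCdeg n zeta G' (p \<mu>) \<longleftrightarrow> d \<in> SCdeg n zeta G \<mu>"
    and Phi_dth: "\<theta> \<in> Th n \<Longrightarrow>
      \<exists>\<theta>'\<in>Th n. Phi (dth n zeta G \<theta>) = dth n zeta G' \<theta>' \<and> (\<forall>\<mu>\<in>M.Mlat. \<theta>' (p \<mu>) = \<theta> \<mu>)"
begin

lemma p_0: "p 0 = 0"
  using p_add[OF M.Mlat_0 M.Mlat_0] by simp

lemma p_uminus: "\<mu> \<in> M.Mlat \<Longrightarrow> p (- \<mu>) = - p \<mu>"
  using p_add[OF _ M.Mlat_uminus, of \<mu> \<mu>] p_0 by (simp add: eq_neg_iff_add_eq_0 add.commute)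

lemma Phi_0: "Phi 0 = 0"
  using Phi_add[OF subsp_0[OF M.subsp_SCD] subsp_0[OF M.subsp_SCD]] by simp

lemma Ddeg_image:
  assumes "D \<subseteq> M.SCD" "\<mu> \<in> M.Mlat"
  shows "Ddeg n zeta G' (Phi ` D) (p \<mu>) = Phi ` Ddeg n zeta G D \<mu>"
  using Phi_SCdeg_iff[OF assms(2)] assms(1) unfolding Ddeg_def by blast

lemma Gam_image: "Gam n zeta G' = p ` Gam n zeta G"
  unfolding M.Gam_eq M'.Gam_eq using p_Mlat p_surj by blast

lemma subsp_image:
  assumes "D \<subseteq> M.SCD" "subsp (Esc G) D"
  shows "subsp (Esc G') (Phi ` D)"
  unfolding subsp_def
proof (intro conjI ballI allI)
  show "0 \<in> Phi ` D" using subsp_0[OF assms(2)] Phi_0 by (metis image_eqI)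
next
  fix x y assume "x \<in> Phi ` D" "y \<in> Phi ` D"
  then obtain d e where d: "x = Phi d" "d \<in> D" "y = Phi e" "e \<in> D" by blast
  then have "x + y = Phi (d + e)"
    using Phi_add[OF subsetD[OF assms(1) d(2)] subsetD[OF assms(1) d(4)]] by simp
  then show "x + y \<in> Phi ` D" using subsp_add[OF assms(2) d(2,4)] by blast
next
  fix k x assume "x \<in> Phi ` D"
  then obtain d where d: "x = Phi d" "d \<in> D" by blast
  then have "Esc G' k x = Phi (Esc G k d)" using Phi_scale[OF subsetD[OF assms(1) d(2)]] by simp
  then show "Esc G' k x \<in> Phi ` D" using subsp_scale[OF assms(2) d(2)] by blast
qed

lemma lspan_image_subset:
  assumes "S \<subseteq> M.SCD"
  shows "Phi ` lspan (Esc G) S \<subseteq> lspan (Esc G') (Phi ` S)"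
proof
  interpret E: vector_space "Esc G" by (rule M.vs_Esc)
  interpret E': vector_space "Esc G'" by (rule M'.vs_Esc)
  have SCD: "E.span S \<subseteq> M.SCD"
    by (rule E.span_minimal[OF assms]) (use M.subsp_SCD in \<open>simp add: E.subsp_iff_subspace\<close>)
  fix y assume "y \<in> Phi ` lspan (Esc G) S"
  then obtain d where d: "y = Phi d" "d \<in> E.span S" unfolding E.lspan_eq_span by blast
  from d(2) have "Phi d \<in> E'.span (Phi ` S) \<and> d \<in> M.SCD"
  proof (induction rule: E.span_induct_alt)
    case base
    show ?case using Phi_0 E'.span_zero subsp_0[OF M.subsp_SCD] by metis
  next
    case (step c x y)
    have x: "x \<in> M.SCD" using step(1) assms by blast
    note cx = subsp_scale[OF M.subsp_SCD x, of c]
    have "Phi (Esc G c x + y) = Esc G' c (Phi x) + Phi y"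
      using Phi_add[OF cx] Phi_scale[OF x] step(2) by simp
    moreover have "Phi x \<in> Phi ` S" using step(1) by blast
    ultimately show ?case
      using step(2) subsp_add[OF M.subsp_SCD cx] E'.span_add[OF E'.span_scale[OF E'.span_base]] by metis
  qed
  then show "y \<in> lspan (Esc G') (Phi ` S)" using d(1) by (simp add: E'.lspan_eq_span)
qed

lemma D_okD:
  assumes "D_ok n zeta G D"
  shows "D \<subseteq> M.SCD" "subsp (Esc G) D" "d1 \<in> D \<Longrightarrow> d2 \<in> D \<Longrightarrow> comm d1 d2 \<in> D"
    "D = lspan (Esc G) (\<Union>\<mu>\<in>Gam n zeta G. Ddeg n zeta G D \<mu>)"
    "l \<in> Zn n \<Longrightarrow> l \<noteq> 0 \<Longrightarrow> \<exists>\<theta>\<in>Th n. dth n zeta G \<theta> \<in> Ddeg n zeta G D 0 \<and> \<theta> l \<noteq> 0"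
proof -
  note * = assms[unfolded D_ok_def]
  show "D \<subseteq> M.SCD" by (rule *[THEN conjunct1])
  show "subsp (Esc G) D" by (rule *[THEN conjunct2, THEN conjunct1])
  show "d1 \<in> D \<Longrightarrow> d2 \<in> D \<Longrightarrow> comm d1 d2 \<in> D"
    using *[THEN conjunct2, THEN conjunct2, THEN conjunct1] by blast
  show "D = lspan (Esc G) (\<Union>\<mu>\<in>Gam n zeta G. Ddeg n zeta G D \<mu>)"
    by (rule *[THEN conjunct2, THEN conjunct2, THEN conjunct2, THEN conjunct1])
  show "l \<in> Zn n \<Longrightarrow> l \<noteq> 0 \<Longrightarrow> \<exists>\<theta>\<in>Th n. dth n zeta G \<theta> \<in> Ddeg n zeta G D 0 \<and> \<theta> l \<noteq> 0"
    using *[THEN conjunct2, THEN conjunct2, THEN conjunct2, THEN conjunct2] by blast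
qed

lemma D_ok_image:
  assumes D: "D_ok n zeta G D"
  shows "D_ok n zeta G' (Phi ` D)"
proof -
  note 1 = D_okD[OF D]
  note sub = subsp_image[OF 1(1,2)]
  have c1: "Phi ` D \<subseteq> M'.SCD" using 1(1) Phi_SCD by blast
  have c2: "comm e1 e2 \<in> Phi ` D" if e: "e1 \<in> Phi ` D" "e2 \<in> Phi ` D" for e1 e2
  proof -
    obtain d1 d2 where d: "e1 = Phi d1" "d1 \<in> D" "e2 = Phi d2" "d2 \<in> D" using e by blast
    then have "comm e1 e2 = Phi (comm d1 d2)"
      using Phi_comm[OF subsetD[OF 1(1) d(2)] subsetD[OF 1(1) d(4)]] by simp
    then show ?thesis using 1(3)[OF d(2,4)] by blast
  qed
  have un: "Phi ` (\<Union>\<mu>\<in>Gam n zeta G. Ddeg n zeta G D \<mu>) = (\<Union>\<nu>\<in>Gam n zeta G'. Ddeg n zeta G' (Phi ` D) \<nu>)"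
    unfolding Gam_image image_UN M.Gam_eq using Ddeg_image[OF 1(1)] by simp
  have c3: "Phi ` D = lspan (Esc G') (\<Union>\<nu>\<in>Gam n zeta G'. Ddeg n zeta G' (Phi ` D) \<nu>)"
  proof
    have "(\<Union>\<mu>\<in>Gam n zeta G. Ddeg n zeta G D \<mu>) \<subseteq> M.SCD" using 1(1) by (auto simp: Ddeg_def)
    from lspan_image_subset[OF this]
    show "Phi ` D \<subseteq> lspan (Esc G') (\<Union>\<nu>\<in>Gam n zeta G'. Ddeg n zeta G' (Phi ` D) \<nu>)"
      unfolding un by (simp flip: 1(4))
    interpret E': vector_space "Esc G'" by (rule M'.vs_Esc)
    show "lspan (Esc G') (\<Union>\<nu>\<in>Gam n zeta G'. Ddeg n zeta G' (Phi ` D) \<nu>) \<subseteq> Phi ` D"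
      unfolding E'.lspan_eq_span
      by (rule E'.span_minimal) (use sub in \<open>auto simp: Ddeg_def E'.subsp_iff_subspace\<close>)
  qed
  \<comment> \<open>\<open>\<theta>'\<close> is tied to \<open>\<theta>\<close> on the lattices, so
    \<open>l\<close> is replaced by a multiple \<open>N l\<close> in the lattice, pulled back to
    \<open>\<mu>\<close>, and separated from 0 there.\<close>
  have c4: "\<exists>\<theta>\<in>Th n. dth n zeta G' \<theta> \<in> Ddeg n zeta G' (Phi ` D) 0 \<and> \<theta> l \<noteq> 0"
    if l: "l \<in> Zn n" "l \<noteq> 0" for l
  proof -
    obtain N :: nat where N: "N > 0" "\<And>l. l \<in> Zn n \<Longrightarrow> (\<lambda>i. int N * l i) \<in> M'.Mlat"
      using M'.ex_Mlat_multiple by blast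
    let ?l = "\<lambda>i. int N * l i"
    obtain \<mu> where \<mu>: "\<mu> \<in> M.Mlat" "p \<mu> = ?l" using p_surj[OF N(2)[OF l(1)]] by blast
    have "\<mu> \<noteq> 0"
    proof
      assume "\<mu> = 0"
      then have "?l i = 0" for i using \<mu>(2) p_0 by (metis zero_fun_apply)
      then have "l = 0" using N(1) by (intro ext) (simp add: zero_fun_apply)
      then show False using l(2) by simp
    qed
    then obtain \<theta> where \<theta>: "\<theta> \<in> Th n" "dth n zeta G \<theta> \<in> Ddeg n zeta G D 0" "\<theta> \<mu> \<noteq> 0"
      using 1(5)[OF M.Mlat_Zn[OF \<mu>(1)]] by blast
    obtain \<theta>' where \<theta>': "\<theta>' \<in> Th n" "Phi (dth n zeta G \<theta>) = dth n zeta G' \<theta>'"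
      "\<forall>\<mu>\<in>M.Mlat. \<theta>' (p \<mu>) = \<theta> \<mu>" using Phi_dth[OF \<theta>(1)] by blast
    have "dth n zeta G' \<theta>' \<in> Ddeg n zeta G' (Phi ` D) 0"
      using Ddeg_image[OF 1(1) M.Mlat_0] \<theta>(2) \<theta>'(2) p_0 by (metis image_eqI)
    moreover have "\<theta>' ?l \<noteq> 0" using \<theta>'(3) \<mu> \<theta>(3) by metis
    then have "\<theta>' l \<noteq> 0"
      using \<theta>'(1) by (auto simp: Th_def sum_distrib_left[symmetric] mult.left_commute[of _ "of_nat N"])
    ultimately show ?thesis using \<theta>'(1) by blast
  qed
  show ?thesis unfolding D_ok_def using c1 sub c2 c3 c4 by blast
qed

text \<open>The factor \<open>a\<close> is meant to be the one by which the form on \<open>L\<close>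
  is scaled; with it the pairing between functionals and derivations scales in the same way. Through
  \<open>trC\<close> the cocycle receives the same factor.\<close>

definition trC :: "'a endo set \<Rightarrow> ('a endo \<Rightarrow> 'k) \<Rightarrow> 'b endo \<Rightarrow> 'k" where
  "trC D c = (\<lambda>e. if e \<in> Phi ` D then a * c (Psi e) else 0)"

definition trT :: "'a endo set \<Rightarrow> ('a endo \<Rightarrow> 'a endo \<Rightarrow> 'a endo \<Rightarrow> 'k) \<Rightarrow> 'b endo \<Rightarrow> 'b endo \<Rightarrow> 'b endo \<Rightarrow> 'k" where
  "trT D \<tau> = (\<lambda>e f. if e \<in> Phi ` D \<and> f \<in> Phi ` D then trC D (\<tau> (Psi e) (Psi f)) else 0)"

lemma trC_Phi: "D \<subseteq> M.SCD \<Longrightarrow> d \<in> D \<Longrightarrow> trC D c (Phi d) = a * c d"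
  using Psi_Phi by (auto simp: trC_def)

lemma trC_outside: "e \<notin> Phi ` D \<Longrightarrow> trC D c e = 0"
  by (simp add: trC_def)

lemma trC_add: "trC D (c + c') = trC D c + trC D c'"
  and trC_diff: "trC D (c - c') = trC D c - trC D c'"
  and trC_0: "trC D 0 = 0"
  and trC_scale: "trC D (\<lambda>d. k * c d) = (\<lambda>e. k * trC D c e)"
  by (auto simp: trC_def fun_eq_iff fun_apply algebra_simps)

lemma trT_Phi:
  assumes "D \<subseteq> M.SCD" "d1 \<in> D" "d2 \<in> D"
  shows "trT D \<tau> (Phi d1) (Phi d2) = trC D (\<tau> d1 d2)"
proof -
  have "Psi (Phi d1) = d1" "Psi (Phi d2) = d2" using assms Psi_Phi by blast+
  then show ?thesis using assms by (simp add: trT_def)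
qed

lemma CcarD:
  assumes "c \<in> Ccar n zeta G D"
  shows "d \<notin> D \<Longrightarrow> c d = 0" "linear_on (Esc G) (*) D c"
    "finite {\<mu> \<in> Gam n zeta G. \<exists>d\<in>Ddeg n zeta G D \<mu>. c d \<noteq> 0}"
  using assms by (auto simp: Ccar_def)

lemma Ccar_image:
  assumes D: "D_ok n zeta G D" and c: "c \<in> Ccar n zeta G D"
  shows "trC D c \<in> Ccar n zeta G' (Phi ` D)"
proof -
  note 1 = D_okD[OF D] and 2 = CcarD[OF c]
  have "linear_on (Esc G') (*) (Phi ` D) (trC D c)"
  proof (rule linear_onI)
    fix x y assume "x \<in> Phi ` D" "y \<in> Phi ` D"
    then obtain d e where d: "x = Phi d" "d \<in> D" "y = Phi e" "e \<in> D" by blast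
    have "trC D c (Phi d + Phi e) = trC D c (Phi (d + e))"
      using Phi_add[OF subsetD[OF 1(1) d(2)] subsetD[OF 1(1) d(4)]] by simp
    then show "trC D c (x + y) = trC D c x + trC D c y"
      using d linear_on_add[OF 2(2) d(2,4)] subsp_add[OF 1(2) d(2,4)]
      by (simp add: trC_Phi[OF 1(1)] algebra_simps)
  next
    fix k x assume "x \<in> Phi ` D"
    then obtain d where d: "x = Phi d" "d \<in> D" by blast
    have "trC D c (Esc G' k (Phi d)) = trC D c (Phi (Esc G k d))"
      using Phi_scale[OF subsetD[OF 1(1) d(2)]] by simp
    then show "trC D c (Esc G' k x) = k * trC D c x"
      using d linear_on_scale[OF 2(2) d(2), of k] subsp_scale[OF 1(2) d(2), of k]
      by (simp add: trC_Phi[OF 1(1)] algebra_simps)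
  qed
  moreover have "finite {\<nu> \<in> Gam n zeta G'. \<exists>e\<in>Ddeg n zeta G' (Phi ` D) \<nu>. trC D c e \<noteq> 0}"
  proof (rule finite_subset)
    show "{\<nu> \<in> Gam n zeta G'. \<exists>e\<in>Ddeg n zeta G' (Phi ` D) \<nu>. trC D c e \<noteq> 0}
        \<subseteq> p ` {\<mu> \<in> Gam n zeta G. \<exists>d\<in>Ddeg n zeta G D \<mu>. c d \<noteq> 0}"
    proof
      fix \<nu> assume "\<nu> \<in> {\<nu> \<in> Gam n zeta G'. \<exists>e\<in>Ddeg n zeta G' (Phi ` D) \<nu>. trC D c e \<noteq> 0}"
      then obtain \<mu> e where \<mu>: "\<mu> \<in> M.Mlat" "\<nu> = p \<mu>" "e \<in> Ddeg n zeta G' (Phi ` D) \<nu>" "trC D c e \<noteq> 0"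
        unfolding Gam_image M.Gam_eq by blast
      then obtain d where d: "d \<in> Ddeg n zeta G D \<mu>" "e = Phi d" using Ddeg_image[OF 1(1) \<mu>(1)] by blast
      have "d \<in> D" using d(1) by (simp add: Ddeg_def)
      then have "c d \<noteq> 0" using \<mu>(4) d(2) by (simp add: trC_Phi[OF 1(1)])
      then show "\<nu> \<in> p ` {\<mu> \<in> Gam n zeta G. \<exists>d\<in>Ddeg n zeta G D \<mu>. c d \<noteq> 0}"
        using \<mu>(1,2) d(1) by (auto simp: M.Gam_eq)
    qed
  qed (use 2(3) in simp)
  ultimately show ?thesis using trC_outside[of _ D c] by (auto simp: Ccar_def)
qed

lemma Cdeg_image:
  assumes D: "D_ok n zeta G D" and \<mu>: "\<mu> \<in> M.Mlat" and c: "c \<in> Cdeg n zeta G D \<mu>"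
  shows "trC D c \<in> Cdeg n zeta G' (Phi ` D) (p \<mu>)"
proof -
  note 1 = D_okD[OF D]
  have c': "c \<in> Ccar n zeta G D" using c by (simp add: Cdeg_def)
  have "trC D c e = 0" if \<nu>: "\<nu> \<in> Gam n zeta G'" "\<nu> \<noteq> - p \<mu>" "e \<in> Ddeg n zeta G' (Phi ` D) \<nu>" for \<nu> e
  proof -
    obtain \<kappa> where \<kappa>: "\<kappa> \<in> M.Mlat" "\<nu> = p \<kappa>" using \<nu>(1) unfolding Gam_image M.Gam_eq by blast
    obtain d where d: "d \<in> Ddeg n zeta G D \<kappa>" "e = Phi d" using \<nu>(3) \<kappa> Ddeg_image[OF 1(1) \<kappa>(1)] by blast
    have "\<kappa> \<noteq> - \<mu>" using \<nu>(2) \<kappa>(2) p_uminus[OF \<mu>] by auto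
    then have "c d = 0" using c \<kappa>(1) d(1) by (auto simp: Cdeg_def M.Gam_eq)
    moreover have "d \<in> D" using d(1) by (simp add: Ddeg_def)
    ultimately show ?thesis using d(2) by (simp add: trC_Phi[OF 1(1)])
  qed
  then show ?thesis using Ccar_image[OF D c'] by (simp add: Cdeg_def)
qed

lemma act_image:
  assumes D: "D_ok n zeta G D" and d: "d \<in> D"
  shows "act (Phi ` D) (Phi d) (trC D c) = trC D (act D d c)"
proof
  note 1 = D_okD[OF D]
  fix f
  show "act (Phi ` D) (Phi d) (trC D c) f = trC D (act D d c) f"
  proof (cases "f \<in> Phi ` D")
    case True
    then obtain e where e: "f = Phi e" "e \<in> D" by blast
    have "trC D c (comm (Phi d) (Phi e)) = trC D c (Phi (comm d e))"
      using Phi_comm[OF subsetD[OF 1(1) d] subsetD[OF 1(1) e(2)]] by simp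
    then show ?thesis using e 1(3)[OF d e(2)] by (simp add: act_def trC_Phi[OF 1(1)])
  next
    case False
    then show ?thesis by (simp add: act_def trC_outside)
  qed
qed

lemma tau_ok_image:
  assumes D: "D_ok n zeta G D" and t: "tau_ok n zeta G D \<tau>"
  shows "tau_ok n zeta G' (Phi ` D) (trT D \<tau>)"
proof -
  note 1 = D_okD[OF D]
  note T = trT_Phi[OF 1(1)]
  have S: "d \<in> M.SCD" if "d \<in> D" for d using 1(1) that by blast
  note c1 = t[unfolded tau_ok_def M.Gam_eq, THEN conjunct2]
  note c2 = c1[THEN conjunct2] note c3 = c2[THEN conjunct2] note c4 = c3[THEN conjunct2]
  note c5 = c4[THEN conjunct2] note c6 = c5[THEN conjunct2] note c7 = c6[THEN conjunct2]
  have t2: "\<And>d1 d2. d1 \<in> D \<Longrightarrow> d2 \<in> D \<Longrightarrow> \<tau> d1 d2 \<in> Ccar n zeta G D"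
    and t3: "\<And>d1 d2 d3. d1 \<in> D \<Longrightarrow> d2 \<in> D \<Longrightarrow> d3 \<in> D \<Longrightarrow> \<tau> (d1 + d2) d3 = \<tau> d1 d3 + \<tau> d2 d3"
    and t4: "\<And>k d1 d2. d1 \<in> D \<Longrightarrow> d2 \<in> D \<Longrightarrow> \<tau> (Esc G k d1) d2 = (\<lambda>d. k * \<tau> d1 d2 d)"
    and t5: "\<And>d. d \<in> D \<Longrightarrow> \<tau> d d = 0"
    and t6: "\<And>x y z. x \<in> D \<Longrightarrow> y \<in> D \<Longrightarrow> z \<in> D \<Longrightarrow>
        act D x (\<tau> y z) - act D y (\<tau> x z) + act D z (\<tau> x y)
        - \<tau> (comm x y) z + \<tau> (comm x z) y - \<tau> (comm y z) x = 0"
    and t7: "\<And>\<mu>1 \<mu>2 d1 d2. \<mu>1 \<in> M.Mlat \<Longrightarrow> \<mu>2 \<in> M.Mlat \<Longrightarrow> d1 \<in> Ddeg n zeta G D \<mu>1 \<Longrightarrow>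
        d2 \<in> Ddeg n zeta G D \<mu>2 \<Longrightarrow> \<tau> d1 d2 \<in> Cdeg n zeta G D (\<mu>1 + \<mu>2)"
    and t8: "\<And>d1 d2 d3. d1 \<in> D \<Longrightarrow> d2 \<in> D \<Longrightarrow> d3 \<in> D \<Longrightarrow> \<tau> d1 d2 d3 = \<tau> d2 d3 d1"
    and t9: "\<And>d1 d2. d1 \<in> D \<Longrightarrow> d2 \<in> Ddeg n zeta G D 0 \<Longrightarrow> \<tau> d1 d2 = 0"
    by (rule c1[THEN conjunct1, rule_format] c2[THEN conjunct1, rule_format] c3[THEN conjunct1, rule_format]
        c4[THEN conjunct1, rule_format] c5[THEN conjunct1, rule_format] c6[THEN conjunct1, rule_format]
        c7[THEN conjunct1, rule_format] c7[THEN conjunct2, rule_format]; assumption)+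
  have comm: "comm (Phi x) (Phi y) = Phi (comm x y)" if "x \<in> D" "y \<in> D" for x y
    using Phi_comm[OF S S] that by simp
  show ?thesis
    unfolding tau_ok_def
  proof (intro conjI ballI allI impI; (elim imageE)?)
    show "trT D \<tau> d1 d2 = 0" if "d1 \<notin> Phi ` D \<or> d2 \<notin> Phi ` D" for d1 d2
      using that by (auto simp: trT_def)
    show "trT D \<tau> e1 e2 \<in> Ccar n zeta G' (Phi ` D)" if "e1 = Phi d1" "d1 \<in> D" "e2 = Phi d2" "d2 \<in> D"
      for e1 e2 d1 d2 using that Ccar_image[OF D t2] by (simp add: T)
    show "trT D \<tau> (e1 + e2) e3 = trT D \<tau> e1 e3 + trT D \<tau> e2 e3"
      if "e1 = Phi d1" "d1 \<in> D" "e2 = Phi d2" "d2 \<in> D" "e3 = Phi d3" "d3 \<in> D" for e1 e2 e3 d1 d2 d3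
      using that t3 subsp_add[OF 1(2)] by (simp add: T trC_add flip: Phi_add[OF S S])
    show "trT D \<tau> (Esc G' k e1) e2 = (\<lambda>d. k * trT D \<tau> e1 e2 d)"
      if "e1 = Phi d1" "d1 \<in> D" "e2 = Phi d2" "d2 \<in> D" for k e1 e2 d1 d2
      using that t4 subsp_scale[OF 1(2)] by (simp add: T trC_scale flip: Phi_scale[OF S])
    show "trT D \<tau> e e = 0" if "e = Phi d" "d \<in> D" for e d
      using that t5 by (simp add: T trC_0)
    show "act (Phi ` D) x (trT D \<tau> y z) - act (Phi ` D) y (trT D \<tau> x z) + act (Phi ` D) z (trT D \<tau> x y)
        - trT D \<tau> (comm x y) z + trT D \<tau> (comm x z) y - trT D \<tau> (comm y z) x = 0"
      if "x = Phi u" "u \<in> D" "y = Phi v" "v \<in> D" "z = Phi w" "w \<in> D" for x y z u v w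
      using that t6[OF that(2,4,6)] 1(3)
      by (simp add: comm T act_image[OF D] trC_0 flip: trC_add trC_diff)
    show "trT D \<tau> e1 e2 \<in> Cdeg n zeta G' (Phi ` D) (\<nu>1 + \<nu>2)"
      if nu: "\<nu>1 \<in> Gam n zeta G'" "\<nu>2 \<in> Gam n zeta G'" "e1 \<in> Ddeg n zeta G' (Phi ` D) \<nu>1"
        "e2 \<in> Ddeg n zeta G' (Phi ` D) \<nu>2" for \<nu>1 \<nu>2 e1 e2
    proof -
      obtain \<mu>1 where m1: "\<mu>1 \<in> M.Mlat" "\<nu>1 = p \<mu>1" using nu(1) unfolding Gam_image M.Gam_eq by blast
      obtain \<mu>2 where m2: "\<mu>2 \<in> M.Mlat" "\<nu>2 = p \<mu>2" using nu(2) unfolding Gam_image M.Gam_eq by blast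
      obtain d1 where d1: "d1 \<in> Ddeg n zeta G D \<mu>1" "e1 = Phi d1"
        using nu(3) m1 Ddeg_image[OF 1(1) m1(1)] by blast
      obtain d2 where d2: "d2 \<in> Ddeg n zeta G D \<mu>2" "e2 = Phi d2"
        using nu(4) m2 Ddeg_image[OF 1(1) m2(1)] by blast
      have "d1 \<in> D" "d2 \<in> D" using d1(1) d2(1) by (auto simp: Ddeg_def)
      then show ?thesis
        using Cdeg_image[OF D M.Mlat_add[OF m1(1) m2(1)] t7[OF m1(1) m2(1) d1(1) d2(1)]]
        by (simp add: T d1(2) d2(2) m1(2) m2(2) p_add[OF m1(1) m2(1)])
    qed
    show "trT D \<tau> e1 e2 e3 = trT D \<tau> e2 e3 e1"
      if "e1 = Phi d1" "d1 \<in> D" "e2 = Phi d2" "d2 \<in> D" "e3 = Phi d3" "d3 \<in> D" for e1 e2 e3 d1 d2 d3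
      using that t8[OF that(2,4,6)] by (simp add: T trC_Phi[OF 1(1)])
    show "trT D \<tau> e1 e2 = 0" if e: "e2 \<in> Ddeg n zeta G' (Phi ` D) 0" "e1 = Phi d1" "d1 \<in> D" for e1 e2 d1
    proof -
      obtain d2 where d2: "d2 \<in> Ddeg n zeta G D 0" "e2 = Phi d2"
        using e(1) Ddeg_image[OF 1(1) M.Mlat_0] p_0 by force
      then have "d2 \<in> D" by (simp add: Ddeg_def)
      then show ?thesis using e t9[OF e(3) d2(1)] by (simp add: T d2(2) trC_0)
    qed
  qed
qed

definition trP where
  "trP P = (Phi ` fst P, trT (fst P) (snd P))"

lemma Pset_image: "P \<in> Pset n zeta G \<Longrightarrow> trP P \<in> Pset n zeta G'"
  using D_ok_image tau_ok_image by (auto simp: Pset_def trP_def)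

end

section \<open>Isomorphism of the extended affine Lie algebras\<close>

locale transport_pair = T: transport n zeta G G' Phi Psi p a + J: transport n zeta G' G Psi Phi q b
  for n :: nat and zeta :: "nat \<Rightarrow> 'k::field_char_0"
    and G :: "('k, 'a::ab_group_add) mldatum" and G' :: "('k, 'b::ab_group_add) mldatum"
    and Phi Psi p q and a b :: 'k +
  assumes ab: "a * b = 1"
begin

lemma Psi_image: "D \<subseteq> SCDer n zeta G \<Longrightarrow> Psi ` Phi ` D = D"
  using T.Psi_Phi by (force simp: image_image)

lemma trC_inverse:
  assumes D: "D \<subseteq> SCDer n zeta G" and c: "\<And>d. d \<notin> D \<Longrightarrow> c d = 0"
  shows "J.trC (Phi ` D) (T.trC D c) = c"
proof
  fix d
  show "J.trC (Phi ` D) (T.trC D c) d = c d"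
  proof (cases "d \<in> D")
    case True
    then show ?thesis using T.trC_Phi[OF D True, of c] ab by (simp add: J.trC_def Psi_image[OF D] mult.commute)
  next
    case False
    then show ?thesis using c by (simp add: J.trC_def Psi_image[OF D])
  qed
qed

text \<open>The cocycles agree as functions on all endomorphisms, because \<open>tau_ok\<close> and
  \<open>Ccar\<close> fix the value 0 outside \<open>D\<close>.\<close>

lemma trP_inverse:
  assumes P: "P \<in> Pset n zeta G"
  shows "J.trP (T.trP P) = P"
proof -
  obtain D \<tau> where P': "P = (D, \<tau>)" by (cases P)
  have D: "D_ok n zeta G D" and t: "tau_ok n zeta G D \<tau>" using P by (auto simp: Pset_def P')
  note sub = T.D_okD(1)[OF D]
  have "J.trT (Phi ` D) (T.trT D \<tau>) d e = \<tau> d e" for d e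
  proof (cases "d \<in> D \<and> e \<in> D")
    case True
    then have "\<tau> d e \<in> Ccar n zeta G D" using t by (simp add: tau_ok_def)
    from T.CcarD(1)[OF this] trC_inverse[OF sub, of "\<tau> d e"] show ?thesis
      using True T.trT_Phi[OF sub, of d e \<tau>] by (simp add: J.trT_def Psi_image[OF sub])
  next
    case False
    then have "\<tau> d e = 0" using t by (auto simp: tau_ok_def)
    then show ?thesis using False by (auto simp: J.trT_def Psi_image[OF sub])
  qed
  then show ?thesis by (simp add: P' T.trP_def J.trP_def Psi_image[OF sub] fun_eq_iff)
qed

end

section \<open>Closure properties of the graded dual and an identity for the shifted form\<close>

context multiloop
begin

lemma Ccar_add:
  assumes "c \<in> Ccar n zeta G D" "c' \<in> Ccar n zeta G D"
  shows "c + c' \<in> Ccar n zeta G D"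
proof -
  have "finite {\<mu> \<in> Gam n zeta G. \<exists>d\<in>Ddeg n zeta G D \<mu>. (c + c') d \<noteq> 0}"
  proof (rule finite_subset)
    show "{\<mu> \<in> Gam n zeta G. \<exists>d\<in>Ddeg n zeta G D \<mu>. (c + c') d \<noteq> 0}
        \<subseteq> {\<mu> \<in> Gam n zeta G. \<exists>d\<in>Ddeg n zeta G D \<mu>. c d \<noteq> 0}
        \<union> {\<mu> \<in> Gam n zeta G. \<exists>d\<in>Ddeg n zeta G D \<mu>. c' d \<noteq> 0}"
      by (auto simp: plus_fun_apply)
  qed (use assms in \<open>simp add: Ccar_def\<close>)
  moreover have "linear_on (Esc G) (*) D (c + c')"
    using assms by (simp add: Ccar_def linear_on_def plus_fun_apply[of c c'] algebra_simps)
  ultimately show ?thesis using assms by (simp add: Ccar_def plus_fun_apply)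
qed

lemma Ccar_minus:
  assumes "c \<in> Ccar n zeta G D"
  shows "- c \<in> Ccar n zeta G D"
proof -
  have "linear_on (Esc G) (*) D (- c)"
    using assms by (simp add: Ccar_def linear_on_def uminus_apply[of c])
  then show ?thesis using assms by (simp add: Ccar_def uminus_apply)
qed

lemma Ccar_diff: "c \<in> Ccar n zeta G D \<Longrightarrow> c' \<in> Ccar n zeta G D \<Longrightarrow> c - c' \<in> Ccar n zeta G D"
  using Ccar_add[OF _ Ccar_minus, of c D c'] by simp

lemma Cdeg_add: "c \<in> Cdeg n zeta G D \<mu> \<Longrightarrow> c' \<in> Cdeg n zeta G D \<mu> \<Longrightarrow> c + c' \<in> Cdeg n zeta G D \<mu>"
  and Cdeg_diff: "c \<in> Cdeg n zeta G D \<mu> \<Longrightarrow> c' \<in> Cdeg n zeta G D \<mu> \<Longrightarrow> c - c' \<in> Cdeg n zeta G D \<mu>"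
  by (simp_all add: Cdeg_def Ccar_add Ccar_diff plus_fun_apply minus_apply)

lemma form_sing_right:
  assumes z: "z \<in> L" and s: "m \<in> Zn n" "t \<in> dg m"
  shows "form z (sing m t) = kap (z (- m)) t"
proof -
  have "form (sing m t) z = (\<Sum>l\<in>{m}. kap (sing m t l) (z (- l)))"
    by (rule form_eq) (auto simp: sing_apply)
  then show ?thesis using form_sym[OF z sing_L[OF s]] by (simp add: kap_sym)
qed

lemma Hsub_iff:
  "(x, c, d) \<in> Hsub n zeta G D \<longleftrightarrow>
    (\<exists>t\<in>\<h>. x = sing 0 t) \<and> c \<in> Cdeg n zeta G D 0 \<and> d \<in> Ddeg n zeta G D 0"
proof -
  have "x \<in> L \<and> (\<forall>\<nu>. \<nu> \<noteq> 0 \<longrightarrow> x \<nu> = 0) \<and> x 0 \<in> \<h> \<longleftrightarrow> (\<exists>t\<in>\<h>. x = sing 0 t)"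
  proof safe
    assume "\<forall>\<nu>. \<nu> \<noteq> 0 \<longrightarrow> x \<nu> = 0" "x 0 \<in> \<h>"
    moreover from this have "x = sing 0 (x 0)" by (intro ext) (simp add: sing_apply)
    ultimately show "\<exists>t\<in>\<h>. x = sing 0 t" by blast
  qed (use sing_L[OF Zn_0 h_fixed] in \<open>simp_all add: sing_apply\<close>)
  then show ?thesis by (auto simp: Hsub_def)
qed

text \<open>Preservation of the bracket by \<open>chi\<close>, in the functional component evaluated
  at the third derivation, amounts to this identity, with \<open>x1\<close>, \<open>x2\<close> in
  the image of \<open>\<phi>\<close>, each \<open>d\<close> a value of \<open>Phi\<close> and each
  \<open>y\<close> the matching value of \<open>Y\<close>. It follows by expanding, using skewness
  of the derivations, invariance of the form and commutativity of \<open>CH\<close>.\<close>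

lemma bracket_correction_identity:
  assumes d: "d1 \<in> SCD" "d2 \<in> SCD" "d3 \<in> SCD" and x: "x1 \<in> L" "x2 \<in> L"
    and y: "y1 \<in> CH" "y2 \<in> CH" "y3 \<in> CH"
  shows "form (d3 x1 - lbr y3 x1) x2 + form (lbr x1 x2 + (d1 x2 - lbr y1 x2) - (d2 x1 - lbr y2 x1)) y3
      - form (d1 y2 - d2 y1) y3 / 2
    = form (d3 (x1 - y1)) (x2 - y2)
      - (form x2 (d1 y3 - d3 y1) - form y2 (d1 y3 - d3 y1) / 2)
      + (form x1 (d2 y3 - d3 y2) - form y1 (d2 y3 - d3 y2) / 2)"
proof -
  note yL = CH_L[OF y(1)] CH_L[OF y(2)] CH_L[OF y(3)]
  note dL = SCD_L[OF d(1)] SCD_L[OF d(2)] SCD_L[OF d(3)]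
  have e1: "form (lbr y3 x1) x2 = form (lbr x1 x2) y3"
    using form_invariant[OF yL(3) x] form_sym[OF yL(3) lbr_L[OF x]] by simp
  \<comment> \<open>\<open>[CH, L]\<close> is orthogonal to \<open>CH\<close>: by invariance the
    value is \<open>- (x | [z, y3])\<close>, and \<open>CH\<close> is abelian.\<close>
  have e2: "form (lbr z x) y3 = 0" if "z \<in> CH" "x \<in> L" for z x
  proof -
    note zL = CH_L[OF that(1)]
    have "form (lbr z x) y3 = - form x (lbr z y3)"
      using lbr_anti[OF that(2) zL] form_minus_left[OF yL(3) lbr_L[OF that(2) zL]]
        form_invariant[OF that(2) zL yL(3)] by simp
    then show ?thesis using CH_abelian[OF that(1) y(3)] by simp
  qed
  have s: "form (d1 x2) y3 = - form x2 (d1 y3)" "form (d2 x1) y3 = - form x1 (d2 y3)"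
    "form (d3 x1) y2 = - form x1 (d3 y2)" "form (d1 y2) y3 = - form y2 (d1 y3)"
    "form (d2 y1) y3 = - form y1 (d2 y3)" "form (d3 y1) y2 = - form y1 (d3 y2)"
    "form (d3 y1) x2 = form x2 (d3 y1)" "form y2 (d3 y1) = - form y1 (d3 y2)"
    using SCD_skew[OF d(1)] SCD_skew[OF d(2)] SCD_skew[OF d(3)] x yL dL
      form_sym[of "d3 y1" x2] form_sym[of "d3 y1" y2] by auto
  have l: "form (d3 x1 - lbr y3 x1) x2 = form (d3 x1) x2 - form (lbr y3 x1) x2"
    "form (lbr x1 x2 + (d1 x2 - lbr y1 x2) - (d2 x1 - lbr y2 x1)) y3
      = form (lbr x1 x2) y3 + (form (d1 x2) y3 - form (lbr y1 x2) y3) - (form (d2 x1) y3 - form (lbr y2 x1) y3)"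
    "form (d1 y2 - d2 y1) y3 = form (d1 y2) y3 - form (d2 y1) y3"
    "form (d3 (x1 - y1)) (x2 - y2) = form (d3 x1) x2 - form (d3 x1) y2 - (form (d3 y1) x2 - form (d3 y1) y2)"
    "form x2 (d1 y3 - d3 y1) = form x2 (d1 y3) - form x2 (d3 y1)"
    "form y2 (d1 y3 - d3 y1) = form y2 (d1 y3) - form y2 (d3 y1)"
    "form x1 (d2 y3 - d3 y2) = form x1 (d2 y3) - form x1 (d3 y2)"
    "form y1 (d2 y3 - d3 y2) = form y1 (d2 y3) - form y1 (d3 y2)"
    by (simp_all add: form_diff_left form_diff_right form_add_left SCD_diff d x yL dL lbr_L L_add L_diff)
  show ?thesis
    unfolding l e1 e2[OF y(1) x(2)] e2[OF y(2) x(1)] s by (simp add: field_simps)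
qed

end

section \<open>The bijection of pairs and the isomorphism \<open>chi\<close>\<close>

context multiloop_pair
begin

text \<open>A fixed choice of the factor from \<open>form_scalar\<close>, so that one constant
  serves all pairs \<open>(D, \<tau>)\<close>.\<close>

definition ratio :: 'k where
  "ratio = (SOME a. a \<noteq> 0 \<and> (\<forall>x\<in>M.L. \<forall>y\<in>M.L. M'.form (\<phi> x) (\<phi> y) = a * M.form x y))"

lemma ratio_nonzero: "ratio \<noteq> 0"
  and form_phi: "x \<in> M.L \<Longrightarrow> y \<in> M.L \<Longrightarrow> M'.form (\<phi> x) (\<phi> y) = ratio * M.form x y"
proof -
  obtain a where "a \<noteq> 0" "\<And>x y. x \<in> M.L \<Longrightarrow> y \<in> M.L \<Longrightarrow> M'.form (\<phi> x) (\<phi> y) = a * M.form x y"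
    using form_scalar by metis
  then have "\<exists>a. a \<noteq> 0 \<and> (\<forall>x\<in>M.L. \<forall>y\<in>M.L. M'.form (\<phi> x) (\<phi> y) = a * M.form x y)" by blast
  note r = someI_ex[OF this, folded ratio_def]
  show "ratio \<noteq> 0" by (rule r[THEN conjunct1])
  show "x \<in> M.L \<Longrightarrow> y \<in> M.L \<Longrightarrow> M'.form (\<phi> x) (\<phi> y) = ratio * M.form x y"
    using r[THEN conjunct2] by blast
qed

lemma transport_Phi: "transport n zeta G G' Phi Psi p"
proof unfold_locales
  show "\<exists>\<mu>\<in>M.Mlat. p \<mu> = \<nu>" if "\<nu> \<in> M'.Mlat" for \<nu> using p_q[OF that] q_Mlat[OF that] by blast
qed (fact Phi_SCD Psi_Phi Phi_add Phi_scale Phi_comm p_Mlat p_add Phi_SCdeg_iff Phi_dth)+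

lemma transport_Psi: "transport n zeta G' G Psi Phi q"
proof -
  interpret I: multiloop_pair n zeta G' G \<phi>i \<psi>i by (rule inverse_pair)
  show ?thesis
  proof unfold_locales
    show "Phi (Psi e) = e" if "e \<in> M'.SCD" for e by (rule Phi_Psi[OF that])
    show "\<exists>\<mu>\<in>M'.Mlat. q \<mu> = \<nu>" if "\<nu> \<in> M.Mlat" for \<nu> using q_p[OF that] p_Mlat[OF that] by blast
  qed (fact I.Phi_SCD I.Phi_add I.Phi_scale I.Phi_comm I.p_Mlat I.p_add I.Phi_SCdeg_iff I.Phi_dth)+
qed

interpretation TP: transport_pair n zeta G G' Phi Psi p q ratio "1 / ratio"
  using transport_Phi transport_Psi ratio_nonzero
  by (simp add: transport_pair_def transport_pair_axioms_def)

interpretation PT: transport_pair n zeta G' G Psi Phi q p "1 / ratio" ratio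
  using transport_Phi transport_Psi ratio_nonzero
  by (simp add: transport_pair_def transport_pair_axioms_def)

lemma trP_bij: "bij_betw TP.T.trP (Pset n zeta G) (Pset n zeta G')"
  by (rule bij_betw_byWitness[where f' = TP.J.trP])
     (use TP.trP_inverse PT.trP_inverse TP.T.Pset_image TP.J.Pset_image in auto)

lemma phi_h: "t \<in> M.\<h> \<Longrightarrow> \<exists>t'\<in>M'.\<h>. \<phi> (sing 0 t) = sing 0 t'"
proof -
  assume "t \<in> M.\<h>"
  then have t: "t \<in> M.rs 0" "t \<in> M.dg 0" using M.h_eq by auto
  have A: "(0, 0) \<in> M.A" by (rule M.Mlat_A[OF M.Mlat_0])
  have "\<psi> (0, 0) = (0, 0)" using psi_0 by (simp add: zero_prod_def)
  then show ?thesis using phi_sing[OF A t] M'.h_eq by auto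
qed

text \<open>Compensates the terms \<open>(z | Y d)\<close> that enter the form when the
  \<open>L\<close>-component is shifted by \<open>Y\<close>.\<close>

definition corr :: "'a endo set \<Rightarrow> 'b lp \<Rightarrow> 'b endo \<Rightarrow> 'k" where
  "corr D z = (\<lambda>e. if e \<in> Phi ` D then M'.form z (Y (Psi e)) else 0)"

lemma corr_Phi: "D \<subseteq> M.SCD \<Longrightarrow> d \<in> D \<Longrightarrow> corr D z (Phi d) = M'.form z (Y d)"
  using Psi_Phi by (auto simp: corr_def)

lemma corr_outside: "e \<notin> Phi ` D \<Longrightarrow> corr D z e = 0"
  by (simp add: corr_def)

lemma corr_add:
  assumes "D \<subseteq> M.SCD" "z \<in> M'.L" "w \<in> M'.L"
  shows "corr D (z + w) = corr D z + corr D w"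
  by (rule ext) (use assms in \<open>simp add: corr_def plus_fun_apply M'.form_add_left\<close>)

lemma corr_scale:
  assumes D: "D \<subseteq> M.SCD" and z: "z \<in> M'.L"
  shows "corr D (M'.lsc k z) = (\<lambda>e. k * corr D z e)"
proof
  fix e
  show "corr D (M'.lsc k z) e = k * corr D z e"
  proof (cases "e \<in> Phi ` D")
    case True
    then obtain d where d: "e = Phi d" "d \<in> D" by blast
    then show ?thesis using M'.form_scale_left[OF z Y_L[OF subsetD[OF D d(2)]]] by (simp add: corr_Phi[OF D])
  qed (simp add: corr_outside)
qed

text \<open>If \<open>Phi d\<close> has degree \<open>\<nu>\<close>, then \<open>Y d\<close> is a
  monomial of degree \<open>\<nu>\<close>, and the form pairs opposite degrees. The finite support
  of \<open>z\<close> thus puts \<open>corr D z\<close> into the graded dual.\<close>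

lemma corr_degree:
  assumes D: "D \<subseteq> M.SCD" and z: "z \<in> M'.L" and \<nu>: "\<nu> \<in> M'.Mlat" and e: "e \<in> Ddeg n zeta G' (Phi ` D) \<nu>"
    and nz: "corr D z e \<noteq> 0"
  shows "z (- \<nu>) \<noteq> 0"
proof -
  have \<mu>: "q \<nu> \<in> M.Mlat" "p (q \<nu>) = \<nu>" using q_Mlat[OF \<nu>] p_q[OF \<nu>] by auto
  obtain d where d: "e = Phi d" "d \<in> Ddeg n zeta G D (q \<nu>)"
    using e TP.T.Ddeg_image[OF D \<mu>(1)] unfolding \<mu>(2) by blast
  have dD: "d \<in> D" "d \<in> SCdeg n zeta G (q \<nu>)" using d(2) by (auto simp: Ddeg_def)
  obtain t where t: "t \<in> M'.\<h>" "Y d = sing \<nu> t" using Phi_SCdeg(2)[OF \<mu>(1) dD(2)] \<mu>(2) by auto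
  have "t \<in> M'.dg \<nu>" using M'.h_fixed[OF t(1)] M'.dg_Mlat[OF \<nu>] by simp
  then have "corr D z e = M'.kap (z (- \<nu>)) t"
    using M'.form_sing_right[OF z M'.Mlat_Zn[OF \<nu>]] by (simp add: d(1) corr_Phi[OF D dD(1)] t(2))
  then show ?thesis using nz linear_on_zero[OF M'.kap_linear_left] by auto
qed

lemma corr_Ccar:
  assumes D: "D_ok n zeta G D" and z: "z \<in> M'.L"
  shows "corr D z \<in> Ccar n zeta G' (Phi ` D)"
proof -
  note 1 = TP.T.D_okD[OF D]
  have S: "d \<in> M.SCD" if "d \<in> D" for d using 1(1) that by blast
  have "linear_on (Esc G') (*) (Phi ` D) (corr D z)"
  proof (rule linear_onI)
    fix x y assume "x \<in> Phi ` D" "y \<in> Phi ` D"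
    then obtain d e where d: "x = Phi d" "d \<in> D" "y = Phi e" "e \<in> D" by blast
    have "corr D z (Phi d + Phi e) = corr D z (Phi (d + e))" by (simp add: Phi_add S d)
    then show "corr D z (x + y) = corr D z x + corr D z y"
      using subsp_add[OF 1(2) d(2,4)] d by (simp add: corr_Phi[OF 1(1)] Y_add S M'.form_add_right)
  next
    fix k x assume "x \<in> Phi ` D"
    then obtain d where d: "x = Phi d" "d \<in> D" by blast
    have "corr D z (Esc G' k (Phi d)) = corr D z (Phi (Esc G k d))" by (simp add: Phi_scale S d)
    then show "corr D z (Esc G' k x) = k * corr D z x"
      using subsp_scale[OF 1(2) d(2)] d by (simp add: corr_Phi[OF 1(1)] Y_scale S M'.form_scale_right)
  qed
  moreover have "finite {\<nu> \<in> Gam n zeta G'. \<exists>e\<in>Ddeg n zeta G' (Phi ` D) \<nu>. corr D z e \<noteq> 0}"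
  proof (rule finite_subset)
    show "{\<nu> \<in> Gam n zeta G'. \<exists>e\<in>Ddeg n zeta G' (Phi ` D) \<nu>. corr D z e \<noteq> 0} \<subseteq> uminus ` {l. z l \<noteq> 0}"
    proof
      fix \<nu> assume "\<nu> \<in> {\<nu> \<in> Gam n zeta G'. \<exists>e\<in>Ddeg n zeta G' (Phi ` D) \<nu>. corr D z e \<noteq> 0}"
      then have "z (- \<nu>) \<noteq> 0" using corr_degree[OF 1(1) z] unfolding M'.Gam_eq by blast
      then show "\<nu> \<in> uminus ` {l. z l \<noteq> 0}" by (intro image_eqI[of _ _ "- \<nu>"]) simp_all
    qed
  qed (use M'.L_finite[OF z] in simp)
  ultimately show ?thesis by (simp add: Ccar_def corr_outside)
qed

lemma corr_Cdeg:
  assumes D: "D_ok n zeta G D" and z: "sing 0 t \<in> M'.L"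
  shows "corr D (sing 0 t) \<in> Cdeg n zeta G' (Phi ` D) 0"
proof -
  have "corr D (sing 0 t) e = 0"
    if "\<nu> \<in> Gam n zeta G'" "\<nu> \<noteq> 0" "e \<in> Ddeg n zeta G' (Phi ` D) \<nu>" for \<nu> e
    using corr_degree[OF TP.T.D_okD(1)[OF D] z _ that(3)] that(1,2) by (auto simp: M'.Gam_eq sing_apply)
  then show ?thesis using corr_Ccar[OF D z] by (simp add: Cdeg_def)
qed

text \<open>The shift by \<open>Y d\<close> turns the derivations of \<open>D'\<close> into the conjugates of those of \<open>D\<close>; the
  functional \<open>corr\<close> is what is needed to make the map an isometry.\<close>

definition chi :: "'a endo set \<Rightarrow> ('k, 'a) eelt \<Rightarrow> ('k, 'b) eelt" where
  "chi D = (\<lambda>(x, c, d). (\<phi> x - Y d, TP.T.trC D c + corr D (\<phi> x - M'.lsc (1 / 2) (Y d)), Phi d))"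

text \<open>The sign of the half changes because \<open>x' = \<phi> x - Y d\<close> gives
  \<open>\<phi> x - Y d / 2 = x' + Y d / 2\<close>.\<close>

definition chi_inv :: "'a endo set \<Rightarrow> ('k, 'b) eelt \<Rightarrow> ('k, 'a) eelt" where
  "chi_inv D = (\<lambda>(x, c, e). (\<phi>i (x + Y (Psi e)),
     TP.J.trC (Phi ` D) (c - corr D (x + M'.lsc (1 / 2) (Y (Psi e)))), Psi e))"

lemma half_split: "y = M'.lsc (1 / 2) y + M'.lsc (1 / 2) y"
  by (rule ext) (simp add: plus_fun_apply Lsc_def flip: M'.scale_left_distrib)

context
  fixes D
  assumes D: "D_ok n zeta G D"
begin

lemmas D_subset = TP.T.D_okD(1)[OF D] and D_comm = TP.T.D_okD(3)[OF D]

lemma D_SCD: "d \<in> D \<Longrightarrow> d \<in> M.SCD"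
  using D_subset by blast

lemma half_L: "d \<in> D \<Longrightarrow> x \<in> M'.L \<Longrightarrow> x - M'.lsc (1 / 2) (Y d) \<in> M'.L"
  "d \<in> D \<Longrightarrow> x \<in> M'.L \<Longrightarrow> x + M'.lsc (1 / 2) (Y d) \<in> M'.L"
  by (simp_all add: M'.L_diff M'.L_add M'.L_scale Y_L D_SCD)

lemma chi_Ecar: "u \<in> Ecar n zeta G D \<Longrightarrow> chi D u \<in> Ecar n zeta G' (Phi ` D)"
  by (auto simp: Ecar_def chi_def D_SCD phi_L Y_L half_L M'.L_diff
      intro!: M'.Ccar_add TP.T.Ccar_image[OF D] corr_Ccar[OF D])

lemma Psi_D: "e \<in> Phi ` D \<Longrightarrow> Psi e \<in> D" "e \<in> Phi ` D \<Longrightarrow> Phi (Psi e) = e"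
  using D_SCD Psi_Phi by auto

lemma chi_inv_Ecar: "v \<in> Ecar n zeta G' (Phi ` D) \<Longrightarrow> chi_inv D v \<in> Ecar n zeta G D"
proof -
  assume v: "v \<in> Ecar n zeta G' (Phi ` D)"
  obtain x c e where v': "v = (x, c, e)" "x \<in> M'.L" "c \<in> Ccar n zeta G' (Phi ` D)" "e \<in> Phi ` D"
    using v by (auto simp: Ecar_def)
  have "c - corr D (x + M'.lsc (1 / 2) (Y (Psi e))) \<in> Ccar n zeta G' (Phi ` D)"
    by (rule M'.Ccar_diff[OF v'(3) corr_Ccar[OF D half_L(2)[OF Psi_D(1)[OF v'(4)] v'(2)]]])
  from TP.J.Ccar_image[OF TP.T.D_ok_image[OF D] this]
  have "TP.J.trC (Phi ` D) (c - corr D (x + M'.lsc (1 / 2) (Y (Psi e)))) \<in> Ccar n zeta G D"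
    by (simp add: TP.Psi_image[OF D_subset])
  then show ?thesis
    using v' Psi_D[OF v'(4)] by (simp add: Ecar_def chi_inv_def phi_inv_L M'.L_add Y_L D_SCD)
qed

lemma chi_inv_chi: "u \<in> Ecar n zeta G D \<Longrightarrow> chi_inv D (chi D u) = u"
proof -
  assume u: "u \<in> Ecar n zeta G D"
  obtain x c d where u': "u = (x, c, d)" "x \<in> M.L" "c \<in> Ccar n zeta G D" "d \<in> D"
    using u by (auto simp: Ecar_def)
  have h: "\<phi> x - Y d + M'.lsc (1 / 2) (Y d) = \<phi> x - M'.lsc (1 / 2) (Y d)"
    using half_split[of "Y d"] by (simp add: algebra_simps)
  show ?thesis
    using u' TP.trC_inverse[OF D_subset TP.T.CcarD(1)[OF u'(3)]]
    by (simp add: chi_def chi_inv_def Psi_Phi D_SCD phi_inv h)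
qed

lemma chi_chi_inv: "v \<in> Ecar n zeta G' (Phi ` D) \<Longrightarrow> chi D (chi_inv D v) = v"
proof -
  assume v: "v \<in> Ecar n zeta G' (Phi ` D)"
  obtain x c e where v': "v = (x, c, e)" "x \<in> M'.L" "c \<in> Ccar n zeta G' (Phi ` D)" "e \<in> Phi ` D"
    using v by (auto simp: Ecar_def)
  note P = Psi_D[OF v'(4)]
  have xL: "x + Y (Psi e) \<in> M'.L" using v'(2) Y_L[OF D_SCD[OF P(1)]] M'.L_add by blast
  have h: "x + Y (Psi e) - M'.lsc (1 / 2) (Y (Psi e)) = x + M'.lsc (1 / 2) (Y (Psi e))"
    using half_split[of "Y (Psi e)"] by (simp add: algebra_simps)
  let ?c = "c - corr D (x + M'.lsc (1 / 2) (Y (Psi e)))"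
  have c: "?c \<in> Ccar n zeta G' (Phi ` D)"
    by (rule M'.Ccar_diff[OF v'(3) corr_Ccar[OF D half_L(2)[OF P(1) v'(2)]]])
  have img: "Phi ` D \<subseteq> M'.SCD" using Phi_SCD D_SCD by blast
  have "TP.T.trC D (TP.J.trC (Phi ` D) ?c) = ?c"
    using PT.trC_inverse[OF img, of ?c, OF TP.J.CcarD(1)[OF c]] TP.Psi_image[OF D_subset] by simp
  then show ?thesis
    using v' P by (simp add: chi_def chi_inv_def phi_inv'[OF xL] h)
qed

lemma chi_bij: "bij_betw (chi D) (Ecar n zeta G D) (Ecar n zeta G' (Phi ` D))"
  by (rule bij_betw_byWitness[where f' = "chi_inv D"])
     (use chi_Ecar chi_inv_Ecar chi_inv_chi chi_chi_inv in auto)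

lemma chi_linear: "linear_on (Escal G) (Escal G') (Ecar n zeta G D) (chi D)"
proof (rule linear_onI)
  interpret v: vector_space M'.lsc by (rule M'.vs_lsc)
  fix u v assume "u \<in> Ecar n zeta G D" "v \<in> Ecar n zeta G D"
  then obtain x c d y b e where u: "u = (x, c, d)" "x \<in> M.L" "d \<in> D" and v: "v = (y, b, e)" "y \<in> M.L" "e \<in> D"
    by (auto simp: Ecar_def)
  have w: "\<phi> x + \<phi> y - M'.lsc (1 / 2) (Y d + Y e) = (\<phi> x - M'.lsc (1 / 2) (Y d)) + (\<phi> y - M'.lsc (1 / 2) (Y e))"
    by (simp add: v.scale_right_distrib)
  show "chi D (u + v) = chi D u + chi D v"
    using u v by (simp add: chi_def phi_add Phi_add Y_add D_SCD TP.T.trC_add w corr_add[OF D_subset] half_L phi_L)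
next
  interpret v: vector_space M'.lsc by (rule M'.vs_lsc)
  fix k u assume "u \<in> Ecar n zeta G D"
  then obtain x c d where u: "u = (x, c, d)" "x \<in> M.L" "d \<in> D" by (auto simp: Ecar_def)
  have w: "M'.lsc k (\<phi> x) - M'.lsc (1 / 2) (M'.lsc k (Y d)) = M'.lsc k (\<phi> x - M'.lsc (1 / 2) (Y d))"
    by (simp add: v.scale_right_diff_distrib mult.commute)
  have "TP.T.trC D (\<lambda>e. k * c e) + corr D (M'.lsc k (\<phi> x - M'.lsc (1 / 2) (Y d)))
      = (\<lambda>e. k * (TP.T.trC D c + corr D (\<phi> x - M'.lsc (1 / 2) (Y d))) e)"
    unfolding TP.T.trC_scale corr_scale[OF D_subset half_L(1)[OF u(3) phi_L[OF u(2)]]]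
    by (rule ext) (simp add: plus_fun_apply algebra_simps)
  then show "chi D (Escal G k u) = Escal G' k (chi D u)"
    using u by (simp add: chi_def Escal_def phi_scale Phi_scale Y_scale D_SCD w v.scale_right_diff_distrib)
qed

lemma corr_half:
  assumes "d \<in> D" "e \<in> D" "x \<in> M'.L"
  shows "corr D (x - M'.lsc (1 / 2) (Y d)) (Phi e) = M'.form x (Y e) - M'.form (Y d) (Y e) / 2"
  using assms
  by (simp add: corr_Phi[OF D_subset] M'.form_diff_left M'.form_scale_left Y_L D_SCD M'.L_scale)

text \<open>The shift creates the terms
  \<open>- (\<phi> x1 | Y d2) - (\<phi> x2 | Y d1) + (Y d1 | Y d2)\<close>. The two functionals
  return the first two with opposite sign, and each takes away half of the last.\<close>

lemma chi_form:
  assumes "u \<in> Ecar n zeta G D" "v \<in> Ecar n zeta G D"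
  shows "Eform G' (chi D u) (chi D v) = ratio * Eform G u v"
proof -
  obtain x1 c1 d1 x2 c2 d2 where u: "u = (x1, c1, d1)" "x1 \<in> M.L" "d1 \<in> D"
    and v: "v = (x2, c2, d2)" "x2 \<in> M.L" "d2 \<in> D" using assms by (auto simp: Ecar_def)
  note y = Y_L[OF D_SCD[OF u(3)]] Y_L[OF D_SCD[OF v(3)]]
  note x = phi_L[OF u(2)] phi_L[OF v(2)]
  have "M'.form (\<phi> x1 - Y d1) (\<phi> x2 - Y d2) = ratio * M.form x1 x2 - M'.form (\<phi> x1) (Y d2)
      - (M'.form (\<phi> x2) (Y d1) - M'.form (Y d2) (Y d1))"
    using M'.form_sym[OF y(1) x(2)] M'.form_sym[OF y(1,2)]
    by (simp add: M'.form_diff_left M'.form_diff_right x y M'.L_diff form_phi u v)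
  moreover have "M'.form (Y d1) (Y d2) = M'.form (Y d2) (Y d1)" by (rule M'.form_sym[OF y])
  ultimately show ?thesis
    unfolding u(1) v(1) chi_def Eform_def
    by (simp add: plus_fun_apply corr_half u v x TP.T.trC_Phi[OF D_subset] algebra_simps)
qed

text \<open>Compared by components. The derivation part is \<open>Phi_comm\<close>; the functional
  part is evaluated at an arbitrary \<open>Phi d3\<close>, where it becomes
  \<open>bracket_correction_identity\<close>.\<close>

lemma chi_bracket:
  assumes "u \<in> Ecar n zeta G D" "v \<in> Ecar n zeta G D"
  shows "chi D (Ebr G D \<tau> u v) = Ebr G' (Phi ` D) (TP.T.trT D \<tau>) (chi D u) (chi D v)"
proof -
  obtain x1 c1 d1 x2 c2 d2 where u: "u = (x1, c1, d1)" "x1 \<in> M.L" "d1 \<in> D"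
    and v: "v = (x2, c2, d2)" "x2 \<in> M.L" "d2 \<in> D" using assms by (auto simp: Ecar_def)
  note d = D_SCD[OF u(3)] D_SCD[OF v(3)]
  note yC = Y_CH[OF d(1)] Y_CH[OF d(2)]
  note y = M'.CH_L[OF yC(1)] M'.CH_L[OF yC(2)]
  note x = phi_L[OF u(2)] phi_L[OF v(2)]
  note e = Phi_SCD[OF d(1)] Phi_SCD[OF d(2)]
  have phi_d: "\<phi> (f z) = Phi f (\<phi> z) - M'.lbr (Y f) (\<phi> z)" if "f \<in> M.SCD" "z \<in> M.L" for f z
    using Phi_phi[OF that] by simp
  let ?x = "M.lbr x1 x2 + d1 x2 - d2 x1"
  have xL: "?x \<in> M.L" using u v d by (simp add: M.L_add M.L_diff M.lbr_L M.SCD_L)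
  have phi_x: "\<phi> ?x = M'.lbr (\<phi> x1) (\<phi> x2) + (Phi d1 (\<phi> x2) - M'.lbr (Y d1) (\<phi> x2))
      - (Phi d2 (\<phi> x1) - M'.lbr (Y d2) (\<phi> x1))"
    using u v d by (simp add: phi_diff phi_add M.L_add M.lbr_L M.SCD_L phi_br phi_d)
  have Y12: "Y (comm d1 d2) = Phi d1 (Y d2) - Phi d2 (Y d1)" by (rule Y_comm[OF d])
  have c12: "comm d1 d2 \<in> D" by (rule D_comm[OF u(3) v(3)])
  \<comment> \<open>The brackets with \<open>Y d1\<close> and \<open>Y d2\<close> on the right are
    the defects of \<open>Phi d1\<close> and \<open>Phi d2\<close> from conjugation;
    \<open>Y_comm\<close> accounts for the rest, as \<open>[Y d1, Y d2] = 0\<close>.\<close>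
  have first: "\<phi> ?x - Y (comm d1 d2)
      = M'.lbr (\<phi> x1 - Y d1) (\<phi> x2 - Y d2) + Phi d1 (\<phi> x2 - Y d2) - Phi d2 (\<phi> x1 - Y d1)"
    using M'.lbr_anti[OF y(2) x(1)] M'.CH_abelian[OF yC]
    unfolding phi_x Y12
    by (simp add: M'.lbr_diff_left M'.lbr_diff_right M'.SCD_diff e x y M'.L_diff algebra_simps)
  let ?c = "sigD G D x1 x2 + act D d1 c2 - act D d2 c1 + \<tau> d1 d2"
  let ?C = "\<lambda>x c d. TP.T.trC D c + corr D (\<phi> x - M'.lsc (1 / 2) (Y d))"
  have second: "?C ?x ?c (comm d1 d2) = sigD G' (Phi ` D) (\<phi> x1 - Y d1) (\<phi> x2 - Y d2)
      + act (Phi ` D) (Phi d1) (?C x2 c2 d2) - act (Phi ` D) (Phi d2) (?C x1 c1 d1)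
      + TP.T.trT D \<tau> (Phi d1) (Phi d2)" (is "?l = ?r")
  proof
    fix f
    show "?l f = ?r f"
    proof (cases "f \<in> Phi ` D")
      case False
      then show ?thesis
        by (simp add: fun_apply TP.T.trC_outside corr_outside sigD_def act_def TP.T.trT_Phi[OF D_subset u(3) v(3)])
    next
      case True
      then obtain d3 where d3: "f = Phi d3" "d3 \<in> D" by blast
      note d3' = D_SCD[OF d3(2)]
      note y3C = Y_CH[OF d3'] and y3 = Y_L[OF d3']
      have c13: "comm d1 d3 \<in> D" and c23: "comm d2 d3 \<in> D" using D_comm u(3) v(3) d3(2) by auto
      \<comment> \<open>The value of \<open>sigD\<close> is moved to the second algebra with
        \<open>\<phi> (d3 x1) = Phi d3 (\<phi> x1) - [Y d3, \<phi> x1]\<close>.\<close>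
      have r: "ratio * M.form (d3 x1) x2 = M'.form (Phi d3 (\<phi> x1) - M'.lbr (Y d3) (\<phi> x1)) (\<phi> x2)"
        using form_phi[OF M.SCD_L[OF d3' u(2)] v(2)] by (simp add: phi_d[OF d3' u(2)])
      have "TP.T.trC D ?c (Phi d3) = ratio * M.form (d3 x1) x2 - ratio * c2 (comm d1 d3)
          + ratio * c1 (comm d2 d3) + ratio * \<tau> d1 d2 d3"
        using d3(2) by (simp add: TP.T.trC_Phi[OF D_subset] fun_apply sigD_def act_def algebra_simps)
      then have l: "?l f = ratio * M.form (d3 x1) x2 - ratio * c2 (comm d1 d3) + ratio * c1 (comm d2 d3)
          + ratio * \<tau> d1 d2 d3 + (M'.form (\<phi> ?x) (Y d3) - M'.form (Y (comm d1 d2)) (Y d3) / 2)"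
        by (simp only: d3(1) plus_fun_apply[of "TP.T.trC D ?c"] corr_half[OF c12 d3(2) phi_L[OF xL]])
      have C: "?C z b g (comm (Phi g') (Phi d3)) = ratio * b (comm g' d3)
          + (M'.form (\<phi> z) (Y (comm g' d3)) - M'.form (Y g) (Y (comm g' d3)) / 2)"
        if "z \<in> M.L" "g \<in> D" "g' \<in> D" for z b g g'
        using that D_comm[OF that(3) d3(2)]
        by (simp add: plus_fun_apply TP.T.trC_Phi[OF D_subset] corr_half phi_L flip: Phi_comm[OF D_SCD[OF that(3)] d3'])
      have rr: "?r f = M'.form (Phi d3 (\<phi> x1 - Y d1)) (\<phi> x2 - Y d2)
          - ?C x2 c2 d2 (comm (Phi d1) (Phi d3)) + ?C x1 c1 d1 (comm (Phi d2) (Phi d3)) + ratio * \<tau> d1 d2 d3"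
        using True d3 by (simp add: plus_fun_apply[of _ _ "Phi d3"] minus_apply[of _ _ "Phi d3"] sigD_def act_def
            TP.T.trT_Phi[OF D_subset u(3) v(3)] TP.T.trC_Phi[OF D_subset])
      show ?thesis
        unfolding l rr C[OF v(2,3) u(3)] C[OF u(2,3) v(3)] r
        unfolding phi_x Y12 Y_comm[OF d(1) d3'] Y_comm[OF d(2) d3']
        using M'.bracket_correction_identity[OF e Phi_SCD[OF d3'] x yC y3C]
        by (simp add: algebra_simps)
    qed
  qed
  show ?thesis
    unfolding u(1) v(1) Ebr_def chi_def prod.case first second Phi_comm[OF d] ..
qed

lemma Y_deg_0: "d \<in> Ddeg n zeta G D 0 \<Longrightarrow> \<exists>t\<in>M'.\<h>. Y d = sing 0 t"
  using Phi_SCdeg(2)[OF M.Mlat_0, of d] p_0 by (simp add: Ddeg_def)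

text \<open>For \<open>d\<close> of degree 0 the shift \<open>Y d\<close> lies in the degree 0 copy
  of the Cartan subalgebra, so it stays inside the subalgebra.\<close>

lemma chi_Hsub: "u \<in> Hsub n zeta G D \<Longrightarrow> chi D u \<in> Hsub n zeta G' (Phi ` D)"
proof -
  assume u: "u \<in> Hsub n zeta G D"
  obtain x c d where u': "u = (x, c, d)" by (cases u)
  obtain t where t: "t \<in> M.\<h>" "x = sing 0 t" and c: "c \<in> Cdeg n zeta G D 0" and d: "d \<in> Ddeg n zeta G D 0"
    using u M.Hsub_iff unfolding u' by blast
  obtain t' where t': "t' \<in> M'.\<h>" "\<phi> x = sing 0 t'" using phi_h[OF t(1)] t(2) by auto
  obtain y where y: "y \<in> M'.\<h>" "Y d = sing 0 y" using Y_deg_0[OF d] by blast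
  have e1: "\<phi> x - Y d = sing 0 (t' - y)"
    by (rule ext) (simp add: t' y fun_apply)
  have e2: "\<phi> x - M'.lsc (1 / 2) (Y d) = sing 0 (t' - M'.sc (1 / 2) y)"
    by (rule ext) (simp add: t' y fun_apply Lsc_def)
  have h: "t' - y \<in> M'.\<h>" "t' - M'.sc (1 / 2) y \<in> M'.\<h>"
    using subsp_diff[OF M'.vs M'.subsp_h t'(1)] y(1) subsp_scale[OF M'.subsp_h y(1)] by auto
  have "TP.T.trC D c \<in> Cdeg n zeta G' (Phi ` D) 0" using TP.T.Cdeg_image[OF D M.Mlat_0 c] p_0 by simp
  moreover have "corr D (sing 0 (t' - M'.sc (1 / 2) y)) \<in> Cdeg n zeta G' (Phi ` D) 0"
    by (rule corr_Cdeg[OF D M'.sing_L[OF Zn_0 M'.h_fixed[OF h(2)]]])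
  moreover have "Phi d \<in> Ddeg n zeta G' (Phi ` D) 0"
    using TP.T.Ddeg_image[OF D_subset M.Mlat_0] d p_0 by auto
  ultimately show ?thesis
    unfolding u' chi_def prod.case M'.Hsub_iff e1 e2 using h(1) M'.Cdeg_add by blast
qed

lemma chi_inv_Hsub: "v \<in> Hsub n zeta G' (Phi ` D) \<Longrightarrow> chi_inv D v \<in> Hsub n zeta G D"
proof -
  assume v: "v \<in> Hsub n zeta G' (Phi ` D)"
  obtain x c e where v': "v = (x, c, e)" by (cases v)
  obtain t where t: "t \<in> M'.\<h>" "x = sing 0 t" and c: "c \<in> Cdeg n zeta G' (Phi ` D) 0"
    and e: "e \<in> Ddeg n zeta G' (Phi ` D) 0"
    using v M'.Hsub_iff unfolding v' by blast
  obtain d where d: "d \<in> Ddeg n zeta G D 0" "e = Phi d"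
    using TP.T.Ddeg_image[OF D_subset M.Mlat_0] e p_0 by auto
  have dD: "d \<in> D" using d(1) by (simp add: Ddeg_def)
  have P: "Psi e = d" using d(2) Psi_Phi[OF D_SCD[OF dD]] by simp
  obtain y where y: "y \<in> M'.\<h>" "Y d = sing 0 y" using Y_deg_0[OF d(1)] by blast
  have e1: "x + Y d = sing 0 (t + y)"
    by (rule ext) (simp add: t y fun_apply)
  have e2: "x + M'.lsc (1 / 2) (Y d) = sing 0 (t + M'.sc (1 / 2) y)"
    by (rule ext) (simp add: t y fun_apply Lsc_def)
  have h: "t + y \<in> M'.\<h>" "t + M'.sc (1 / 2) y \<in> M'.\<h>"
    using subsp_add[OF M'.subsp_h t(1)] y(1) subsp_scale[OF M'.subsp_h y(1)] by auto
  interpret I: multiloop_pair n zeta G' G \<phi>i \<psi>i by (rule inverse_pair)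
  have "corr D (sing 0 (t + M'.sc (1 / 2) y)) \<in> Cdeg n zeta G' (Phi ` D) 0"
    by (rule corr_Cdeg[OF D M'.sing_L[OF Zn_0 M'.h_fixed[OF h(2)]]])
  then have "c - corr D (sing 0 (t + M'.sc (1 / 2) y)) \<in> Cdeg n zeta G' (Phi ` D) 0"
    by (rule M'.Cdeg_diff[OF c])
  from TP.J.Cdeg_image[OF TP.T.D_ok_image[OF D] M'.Mlat_0 this]
  have "TP.J.trC (Phi ` D) (c - corr D (sing 0 (t + M'.sc (1 / 2) y))) \<in> Cdeg n zeta G D 0"
    using I.p_0 by (simp add: TP.Psi_image[OF D_subset])
  moreover have "\<exists>s\<in>M.\<h>. \<phi>i (sing 0 (t + y)) = sing 0 s" by (rule I.phi_h[OF h(1)])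
  ultimately show ?thesis
    unfolding v' chi_inv_def prod.case P M.Hsub_iff e1 e2 using d(1) by blast
qed

lemma Hsub_Ecar: "Hsub n zeta G D \<subseteq> Ecar n zeta G D" "Hsub n zeta G' (Phi ` D) \<subseteq> Ecar n zeta G' (Phi ` D)"
  by (auto simp: Hsub_def Ecar_def Cdeg_def Ddeg_def)

lemma eala_iso_chi: "eala_iso n zeta G D \<tau> G' (Phi ` D) (TP.T.trT D \<tau>)"
  unfolding eala_iso_def
proof (intro exI conjI)
  show "lie_iso (Escal G) (Ebr G D \<tau>) (Ecar n zeta G D) (Escal G') (Ebr G' (Phi ` D) (TP.T.trT D \<tau>))
      (Ecar n zeta G' (Phi ` D)) (chi D)"
    using chi_bij chi_linear chi_bracket by (auto simp: lie_iso_def)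
  show "chi D ` Hsub n zeta G D = Hsub n zeta G' (Phi ` D)"
  proof
    show "chi D ` Hsub n zeta G D \<subseteq> Hsub n zeta G' (Phi ` D)" using chi_Hsub by blast
    show "Hsub n zeta G' (Phi ` D) \<subseteq> chi D ` Hsub n zeta G D"
    proof
      fix v assume v: "v \<in> Hsub n zeta G' (Phi ` D)"
      then have "chi D (chi_inv D v) = v" using chi_chi_inv Hsub_Ecar(2) by blast
      then show "v \<in> chi D ` Hsub n zeta G D" using chi_inv_Hsub[OF v] by (metis imageI)
    qed
  qed
  show "\<forall>u\<in>Ecar n zeta G D. \<forall>v\<in>Ecar n zeta G D. Eform G' (chi D u) (chi D v) = ratio * Eform G u v"
    using chi_form by blast
qed

end

lemma ex_Pset_bijection:
  "\<exists>F. bij_betw F (Pset n zeta G) (Pset n zeta G') \<and>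
    (\<forall>P\<in>Pset n zeta G. eala_iso n zeta G (fst P) (snd P) G' (fst (F P)) (snd (F P)))"
proof (intro exI conjI ballI)
  show "bij_betw TP.T.trP (Pset n zeta G) (Pset n zeta G')" by (rule trP_bij)
  fix P assume "P \<in> Pset n zeta G"
  then have "D_ok n zeta G (fst P)" by (auto simp: Pset_def)
  from eala_iso_chi[OF this]
  show "eala_iso n zeta G (fst P) (snd P) G' (fst (TP.T.trP P)) (snd (TP.T.trP P))"
    by (simp add: TP.T.trP_def)
qed

end

theorem theorem5p2p8:
  fixes n :: nat
    and zeta :: "nat \<Rightarrow> 'k::field_char_0"
    and G :: "('k, 'a::ab_group_add) mldatum"
    and G' :: "('k, 'b::ab_group_add) mldatum"
  assumes "alg_closed TYPE('k)"
    and "roots_ok zeta"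
    and "multiloop_datum n zeta G"
    and "multiloop_datum n zeta G'"
    and "gfix n zeta G \<noteq> {0}"
    and "gfix n zeta G' \<noteq> {0}"
    and "support_iso n zeta G G'"
  shows "\<exists>F. bij_betw F (Pset n zeta G) (Pset n zeta G') \<and>
           (\<forall>P\<in>Pset n zeta G. eala_iso n zeta G (fst P) (snd P) G' (fst (F P)) (snd (F P)))"
proof -
  obtain \<phi> \<psi> where
    "lie_iso (Lsc G) (Lbr G) (Lcar n zeta G) (Lsc G') (Lbr G') (Lcar n zeta G') \<phi>"
    "bij_betw \<psi> (gen_grp (Lsupp n zeta G)) (gen_grp (Lsupp n zeta G'))"
    "\<forall>p\<in>gen_grp (Lsupp n zeta G). \<forall>q\<in>gen_grp (Lsupp n zeta G). \<psi> (p + q) = \<psi> p + \<psi> q"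
    "\<forall>\<alpha> l. (\<alpha>, l) \<in> gen_grp (Lsupp n zeta G) \<longrightarrow>
      \<phi> ` Lgr n zeta G \<alpha> l = Lgr n zeta G' (fst (\<psi> (\<alpha>, l))) (snd (\<psi> (\<alpha>, l)))"
    using assms(7) unfolding support_iso_def by blast
  then interpret multiloop_pair n zeta G G' \<phi> \<psi>
    by unfold_locales (use assms in auto)
  show ?thesis by (rule ex_Pset_bijection)
qed

end
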